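(* Let $*:\hat S\to\widehat{{}^*S}$ be an enlargement, and let $F:\mathcal A\to\mathcal B$ be an additive functor between $\hat S$-small abelian categories. (i) If $\mathcal A$ has enough injectives and if $F$ is left exact, then for all $i\ge 0$ the right derived functors $\mathrm R^iF:\mathcal A\to\mathcal B$ and $\mathrm R^i({}^*F):{}^*\mathcal A\to{}^*\mathcal B$ exist, and one has ${}^*(\mathrm R^iF)\circ *=*\circ\mathrm R^iF$ as functors $\mathcal A\to{}^*\mathcal B$ and ${}^*(\mathrm R^iF)=\mathrm R^i({}^*F)$ as functors ${}^*\mathcal A\to{}^*\mathcal B$. (ii) If $\mathcal A$ has enough projectives and if $F$ is right exact, then for all $i\ge 0$ the left derived functors $\mathrm L^iF:\mathcal A\to\mathcal B$ and $\mathrm L^i({}^*F):{}^*\mathcal A\to{}^*\mathcal B$ exist, and one has ${}^*(\mathrm L^iF)\circ *=*\circ\mathrm L^iF$ as functors $\mathcal A\to{}^*\mathcal B$ and ${}^*(\mathrm L^iF)=\mathrm L^i({}^*F)$ as functors ${}^*\mathcal A\to{}^*\mathcal B$.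
   Context: Superstructures: a base set $S$ is an infinite set whose elements are not sets; $S_0=S$, $S_n=S_{n-1}\cup\mathcal P(S_{n-1})$, and $\hat S=\bigcup_{n\ge 0}S_n$. Formulas in $\hat S$ are built from $=$, $\in$, constants in $\hat S$, variables, ordered pairs and function application by $\neg$, $\wedge$ and bounded quantifiers $\forall x\in t$; statements are formulas without free variables. For $\varphi$ a formula in $\hat S$, ${}^*\varphi$ is obtained by replacing each constant $\tau$ by ${}^*\tau$. Enlargement: a map $*:\hat S\to\hat W$ between superstructures with (1) ${}^*S=W$; (2) ${}^*s=s$ for $s\in S$; (3) (transfer) a statement $\varphi$ in $\hat S$ is true iff ${}^*\varphi$ is true; (4) (saturation) with $\mathcal I=\bigcup_{A\in\hat S\setminus S}{}^*A$ (the internal elements), every nonempty family $\{U_i\}_{i\in I}$ of nonempty sets $U_i\in\mathcal I$ with $|I|\le|\hat S|$ and the finite intersection property has nonempty intersection. $\hat S$-small category: a category $\mathcal A=\langle M,s,t,c\rangle$ given by its set of morphisms $M\in\hat S\setminus S$, the maps $s,t:M\to M$ sending a morphism to the identity of its source resp. target, and the composition relation $c$; objects are identified with their identity morphisms. An abelian $\hat S$-small category is such a category which is abelian in the usual sense, together with the relation $P\subseteq M^3$ recording addition of morphisms. Its enlargement ${}^*\mathcal A=\langle{}^*M,{}^*s,{}^*t,{}^*c\rangle$ with ${}^*P$ is again abelian, $*$ induces an exact functor $*:\mathcal A\to{}^*\mathcal A$, and a functor $F:\mathcal A\to\mathcal B$ (a map on morphism sets) has an enlargement ${}^*F:{}^*\mathcal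 A\to{}^*\mathcal B$. As usual, derived functors are determined up to canonical isomorphism (by the choice of resolutions), and equalities involving $\mathrm R^i({}^*F)$, $\mathrm L^i({}^*F)$ are understood in this sense. *)

theory Defs
  imports "HOL-Algebra.Group" "HOL-Library.Equipollence"
begin

section \<open>Sets over urelements and superstructures\<close>

text \<open>HOL cannot construct the union of all iterated power sets of an infinite type as a type.
  Superstructures are therefore formed inside an arbitrary universe of sets over urelements (objects
  that are not sets). Separation is second order, so \<open>power\<close> yields full power sets. Every superstructure
  over a base set is itself such a universe, so nothing is lost by working in one that contains
  all the superstructures under consideration.\<close>

class set_universe =
  fixes is_set :: "'a \<Rightarrow> bool"
    and elts :: "'a \<Rightarrow> 'a set"
  assumes elts_urelement: "\<not> is_set x \<Longrightarrow> elts x = {}"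
    and extensionality: "is_set x \<Longrightarrow> is_set y \<Longrightarrow> elts x = elts y \<Longrightarrow> x = y"
    and separation: "X \<subseteq> elts a \<Longrightarrow> \<exists>x. is_set x \<and> elts x = X"
    and pairing: "\<exists>x. is_set x \<and> elts x = {a, b}"
    and union: "\<exists>x. is_set x \<and> elts x = (\<Union>b\<in>elts a. elts b)"
    and power: "\<exists>x. is_set x \<and> elts x = {y. is_set y \<and> elts y \<subseteq> elts a}"

definition set_of :: "'u set \<Rightarrow> 'u::set_universe" where
  "set_of X = (THE x. is_set x \<and> elts x = X)"

definition opair :: "'u \<Rightarrow> 'u \<Rightarrow> 'u::set_universe" where
  "opair x y = set_of {set_of {x}, set_of {x, y}}"

definition triple :: "'u \<Rightarrow> 'u \<Rightarrow> 'u \<Rightarrow> 'u::set_universe" where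
  "triple x y z = opair (opair x y) z"

text \<open>Application is total: where \<open>f\<close> has no unique value at \<open>x\<close>, the result is the empty set.\<close>

definition app :: "'u \<Rightarrow> 'u \<Rightarrow> 'u::set_universe" where
  "app f x = (if \<exists>!y. opair x y \<in> elts f then THE y. opair x y \<in> elts f else set_of {})"

definition is_map :: "'u \<Rightarrow> 'u \<Rightarrow> 'u::set_universe \<Rightarrow> bool" where
  "is_map f X Y \<longleftrightarrow> is_set f
     \<and> elts f \<subseteq> {opair x y | x y. x \<in> elts X \<and> y \<in> elts Y}
     \<and> (\<forall>x\<in>elts X. \<exists>!y. opair x y \<in> elts f)"

definition base_set :: "'u::set_universe \<Rightarrow> bool" where
  "base_set S \<longleftrightarrow> is_set S \<and> infinite (elts S) \<and> (\<forall>x\<in>elts S. \<not> is_set x)"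

primrec level :: "'u::set_universe \<Rightarrow> nat \<Rightarrow> 'u set" where
  "level S 0 = elts S"
| "level S (Suc n) = level S n \<union> {x. is_set x \<and> elts x \<subseteq> level S n}"

definition superstr :: "'u::set_universe \<Rightarrow> 'u set" where
  "superstr S = (\<Union>n. level S n)"


section \<open>Formulas and enlargements\<close>

datatype 'u trm = Var nat | Const 'u | Pair "'u trm" "'u trm" | App "'u trm" "'u trm"

datatype 'u fm =
    Eq "'u trm" "'u trm"
  | Mem "'u trm" "'u trm"
  | Neg "'u fm"
  | Conj "'u fm" "'u fm"
  | All_in nat "'u trm" "'u fm"

primrec fv_trm :: "'u trm \<Rightarrow> nat set" where
  "fv_trm (Var n) = {n}"
| "fv_trm (Const a) = {}"
| "fv_trm (Pair s t) = fv_trm s \<union> fv_trm t"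
| "fv_trm (App s t) = fv_trm s \<union> fv_trm t"

primrec fv_fm :: "'u fm \<Rightarrow> nat set" where
  "fv_fm (Eq s t) = fv_trm s \<union> fv_trm t"
| "fv_fm (Mem s t) = fv_trm s \<union> fv_trm t"
| "fv_fm (Neg p) = fv_fm p"
| "fv_fm (Conj p q) = fv_fm p \<union> fv_fm q"
| "fv_fm (All_in n t p) = fv_trm t \<union> (fv_fm p - {n})"

primrec trm_val :: "(nat \<Rightarrow> 'u) \<Rightarrow> 'u trm \<Rightarrow> 'u::set_universe" where
  "trm_val \<rho> (Var n) = \<rho> n"
| "trm_val \<rho> (Const a) = a"
| "trm_val \<rho> (Pair s t) = opair (trm_val \<rho> s) (trm_val \<rho> t)"
| "trm_val \<rho> (App s t) = app (trm_val \<rho> s) (trm_val \<rho> t)"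

primrec sat :: "(nat \<Rightarrow> 'u::set_universe) \<Rightarrow> 'u fm \<Rightarrow> bool" where
  "sat \<rho> (Eq s t) \<longleftrightarrow> trm_val \<rho> s = trm_val \<rho> t"
| "sat \<rho> (Mem s t) \<longleftrightarrow> trm_val \<rho> s \<in> elts (trm_val \<rho> t)"
| "sat \<rho> (Neg p) \<longleftrightarrow> \<not> sat \<rho> p"
| "sat \<rho> (Conj p q) \<longleftrightarrow> sat \<rho> p \<and> sat \<rho> q"
| "sat \<rho> (All_in n t p) \<longleftrightarrow> (\<forall>a\<in>elts (trm_val \<rho> t). sat (\<rho>(n := a)) p)"

text \<open>\<open>set_fm p\<close> is the set of constants occurring in \<open>p\<close>; \<open>map_fm star p\<close> replaces each of them by
  its image under \<open>star\<close>.\<close>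

definition statement_in :: "'u::set_universe \<Rightarrow> 'u fm \<Rightarrow> bool" where
  "statement_in S p \<longleftrightarrow> fv_fm p = {} \<and> set_fm p \<subseteq> superstr S"

definition fm_true :: "'u::set_universe fm \<Rightarrow> bool" where
  "fm_true p \<longleftrightarrow> (\<forall>\<rho>. sat \<rho> p)"

definition internal :: "'u::set_universe \<Rightarrow> ('u \<Rightarrow> 'u) \<Rightarrow> 'u set" where
  "internal S star = (\<Union>A\<in>superstr S - elts S. elts (star A))"

definition enlargement :: "'u::set_universe \<Rightarrow> ('u \<Rightarrow> 'u) \<Rightarrow> bool" where
  "enlargement S star \<longleftrightarrow>
     base_set S \<and> base_set (star S) \<and> star ` superstr S \<subseteq> superstr (star S)
   \<and> (\<forall>s\<in>elts S. star s = s)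
   \<and> (\<forall>p. statement_in S p \<longrightarrow> (fm_true p \<longleftrightarrow> fm_true (map_fm star p)))
   \<and> (\<forall>\<U>. \<U> \<noteq> {} \<and> \<U> \<subseteq> internal S star \<and> (\<forall>U\<in>\<U>. elts U \<noteq> {}) \<and> \<U> \<lesssim> superstr S
        \<and> (\<forall>\<V>. \<V> \<subseteq> \<U> \<and> finite \<V> \<and> \<V> \<noteq> {} \<longrightarrow> (\<Inter>U\<in>\<V>. elts U) \<noteq> {})
        \<longrightarrow> (\<Inter>U\<in>\<U>. elts U) \<noteq> {})"


section \<open>Small categories\<close>

record 'u small_cat =
  mors :: 'u
  srcs :: 'u
  tgts :: 'u
  comps :: 'u

definition Mor :: "('u::set_universe, 'b) small_cat_scheme \<Rightarrow> 'u set" where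
  "Mor C = elts (mors C)"

definition src :: "('u::set_universe, 'b) small_cat_scheme \<Rightarrow> 'u \<Rightarrow> 'u" where
  "src C f = app (srcs C) f"

definition tgt :: "('u::set_universe, 'b) small_cat_scheme \<Rightarrow> 'u \<Rightarrow> 'u" where
  "tgt C f = app (tgts C) f"

text \<open>\<open>triple f g h\<close> belongs to the composition relation iff \<open>h\<close> is \<open>f\<close> after \<open>g\<close>. As triples are
  nested to the left, the relation is a partial map on pairs.\<close>

definition cmp :: "('u::set_universe, 'b) small_cat_scheme \<Rightarrow> 'u \<Rightarrow> 'u \<Rightarrow> 'u" where
  "cmp C f g = app (comps C) (opair f g)"

definition Ob :: "('u::set_universe, 'b) small_cat_scheme \<Rightarrow> 'u set" where
  "Ob C = {X \<in> Mor C. src C X = X}"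

definition Hom :: "('u::set_universe, 'b) small_cat_scheme \<Rightarrow> 'u \<Rightarrow> 'u \<Rightarrow> 'u set" where
  "Hom C X Y = {f \<in> Mor C. src C f = X \<and> tgt C f = Y}"

definition small_category :: "'u::set_universe \<Rightarrow> ('u, 'b) small_cat_scheme \<Rightarrow> bool" where
  "small_category S C \<longleftrightarrow>
     mors C \<in> superstr S - elts S
   \<and> is_map (srcs C) (mors C) (mors C) \<and> is_map (tgts C) (mors C) (mors C)
   \<and> is_set (comps C)
   \<and> elts (comps C) \<subseteq> {triple f g h | f g h. f \<in> Mor C \<and> g \<in> Mor C \<and> h \<in> Mor C}
   \<and> (\<forall>f\<in>Mor C. src C (src C f) = src C f \<and> tgt C (src C f) = src C f
        \<and> src C (tgt C f) = tgt C f \<and> tgt C (tgt C f) = tgt C f)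
   \<and> (\<forall>f\<in>Mor C. \<forall>g\<in>Mor C. (\<exists>h. triple f g h \<in> elts (comps C)) \<longleftrightarrow> src C f = tgt C g)
   \<and> (\<forall>f g h h'. triple f g h \<in> elts (comps C) \<and> triple f g h' \<in> elts (comps C) \<longrightarrow> h = h')
   \<and> (\<forall>f\<in>Mor C. \<forall>g\<in>Mor C. src C f = tgt C g \<longrightarrow>
        src C (cmp C f g) = src C g \<and> tgt C (cmp C f g) = tgt C f)
   \<and> (\<forall>f\<in>Mor C. cmp C f (src C f) = f \<and> cmp C (tgt C f) f = f)
   \<and> (\<forall>f\<in>Mor C. \<forall>g\<in>Mor C. \<forall>h\<in>Mor C. src C f = tgt C g \<and> src C g = tgt C h \<longrightarrow>
        cmp C (cmp C f g) h = cmp C f (cmp C g h))"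

definition mono_in :: "('u::set_universe, 'b) small_cat_scheme \<Rightarrow> 'u \<Rightarrow> bool" where
  "mono_in C m \<longleftrightarrow> m \<in> Mor C \<and>
     (\<forall>f\<in>Mor C. \<forall>g\<in>Mor C. src C f = src C g \<and> tgt C f = src C m \<and> tgt C g = src C m
        \<and> cmp C m f = cmp C m g \<longrightarrow> f = g)"

definition epi_in :: "('u::set_universe, 'b) small_cat_scheme \<Rightarrow> 'u \<Rightarrow> bool" where
  "epi_in C e \<longleftrightarrow> e \<in> Mor C \<and>
     (\<forall>f\<in>Mor C. \<forall>g\<in>Mor C. tgt C f = tgt C g \<and> src C f = tgt C e \<and> src C g = tgt C e
        \<and> cmp C f e = cmp C g e \<longrightarrow> f = g)"

definition iso_in :: "('u::set_universe, 'b) small_cat_scheme \<Rightarrow> 'u \<Rightarrow> bool" where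
  "iso_in C f \<longleftrightarrow> f \<in> Mor C \<and>
     (\<exists>g\<in>Hom C (tgt C f) (src C f). cmp C g f = src C f \<and> cmp C f g = tgt C f)"

definition zero_object :: "('u::set_universe, 'b) small_cat_scheme \<Rightarrow> 'u \<Rightarrow> bool" where
  "zero_object C Z \<longleftrightarrow> Z \<in> Ob C \<and>
     (\<forall>X\<in>Ob C. (\<exists>!f. f \<in> Hom C X Z) \<and> (\<exists>!f. f \<in> Hom C Z X))"

definition is_product ::
  "('u::set_universe, 'b) small_cat_scheme \<Rightarrow> 'u \<Rightarrow> 'u \<Rightarrow> 'u \<Rightarrow> 'u \<Rightarrow> bool" where
  "is_product C X Y p q \<longleftrightarrow>
     p \<in> Mor C \<and> q \<in> Mor C \<and> src C p = src C q \<and> tgt C p = X \<and> tgt C q = Y \<and>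
     (\<forall>f\<in>Mor C. \<forall>g\<in>Mor C. src C f = src C g \<and> tgt C f = X \<and> tgt C g = Y \<longrightarrow>
        (\<exists>!u. u \<in> Hom C (src C f) (src C p) \<and> cmp C p u = f \<and> cmp C q u = g))"

definition injective_object :: "('u::set_universe, 'b) small_cat_scheme \<Rightarrow> 'u \<Rightarrow> bool" where
  "injective_object C I \<longleftrightarrow> I \<in> Ob C \<and>
     (\<forall>m f. mono_in C m \<and> f \<in> Hom C (src C m) I \<longrightarrow> (\<exists>g\<in>Hom C (tgt C m) I. cmp C g m = f))"

definition projective_object :: "('u::set_universe, 'b) small_cat_scheme \<Rightarrow> 'u \<Rightarrow> bool" where
  "projective_object C P \<longleftrightarrow> P \<in> Ob C \<and>
     (\<forall>e f. epi_in C e \<and> f \<in> Hom C P (tgt C e) \<longrightarrow> (\<exists>g\<in>Hom C P (src C e). cmp C e g = f))"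

definition enough_injectives :: "('u::set_universe, 'b) small_cat_scheme \<Rightarrow> bool" where
  "enough_injectives C \<longleftrightarrow>
     (\<forall>X\<in>Ob C. \<exists>m. mono_in C m \<and> src C m = X \<and> injective_object C (tgt C m))"

definition enough_projectives :: "('u::set_universe, 'b) small_cat_scheme \<Rightarrow> bool" where
  "enough_projectives C \<longleftrightarrow>
     (\<forall>X\<in>Ob C. \<exists>e. epi_in C e \<and> tgt C e = X \<and> projective_object C (src C e))"


section \<open>Abelian categories\<close>

record 'u add_cat = "'u small_cat" +
  adds :: 'u

definition add :: "('u::set_universe, 'b) add_cat_scheme \<Rightarrow> 'u \<Rightarrow> 'u \<Rightarrow> 'u" where
  "add C f g = app (adds C) (opair f g)"

definition zero_mor :: "('u::set_universe, 'b) add_cat_scheme \<Rightarrow> 'u \<Rightarrow> bool" where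
  "zero_mor C f \<longleftrightarrow> f \<in> Mor C \<and>
     (\<forall>g\<in>Hom C (src C f) (tgt C f). add C f g = g \<and> add C g f = g)"

definition is_kernel :: "('u::set_universe, 'b) add_cat_scheme \<Rightarrow> 'u \<Rightarrow> 'u \<Rightarrow> bool" where
  "is_kernel C k f \<longleftrightarrow> k \<in> Mor C \<and> f \<in> Mor C \<and> tgt C k = src C f \<and> zero_mor C (cmp C f k) \<and>
     (\<forall>g\<in>Mor C. tgt C g = src C f \<and> zero_mor C (cmp C f g) \<longrightarrow>
        (\<exists>!u. u \<in> Hom C (src C g) (src C k) \<and> cmp C k u = g))"

definition is_cokernel :: "('u::set_universe, 'b) add_cat_scheme \<Rightarrow> 'u \<Rightarrow> 'u \<Rightarrow> bool" where
  "is_cokernel C q f \<longleftrightarrow> q \<in> Mor C \<and> f \<in> Mor C \<and> src C q = tgt C f \<and> zero_mor C (cmp C q f) \<and>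
     (\<forall>g\<in>Mor C. src C g = tgt C f \<and> zero_mor C (cmp C g f) \<longrightarrow>
        (\<exists>!u. u \<in> Hom C (tgt C q) (tgt C g) \<and> cmp C u q = g))"

definition abelian_small_category :: "'u::set_universe \<Rightarrow> 'u add_cat \<Rightarrow> bool" where
  "abelian_small_category S C \<longleftrightarrow>
     small_category S C
   \<and> is_set (adds C)
   \<and> elts (adds C) \<subseteq> {triple f g h | f g h. f \<in> Mor C \<and> g \<in> Mor C \<and> h \<in> Mor C}
   \<and> (\<forall>f\<in>Mor C. \<forall>g\<in>Mor C.
        (\<exists>h. triple f g h \<in> elts (adds C)) \<longleftrightarrow> src C f = src C g \<and> tgt C f = tgt C g)
   \<and> (\<forall>f g h h'. triple f g h \<in> elts (adds C) \<and> triple f g h' \<in> elts (adds C) \<longrightarrow> h = h')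
   \<and> (\<forall>X\<in>Ob C. \<forall>Y\<in>Ob C. \<exists>e. comm_group \<lparr>carrier = Hom C X Y, monoid.mult = add C, one = e\<rparr>)
   \<and> (\<forall>f\<in>Mor C. \<forall>g\<in>Mor C. \<forall>h\<in>Mor C. src C f = src C g \<and> tgt C f = tgt C g \<and> tgt C h = src C f \<longrightarrow>
        cmp C (add C f g) h = add C (cmp C f h) (cmp C g h))
   \<and> (\<forall>f\<in>Mor C. \<forall>g\<in>Mor C. \<forall>h\<in>Mor C. src C f = src C g \<and> tgt C f = tgt C g \<and> src C h = tgt C f \<longrightarrow>
        cmp C h (add C f g) = add C (cmp C h f) (cmp C h g))
   \<and> (\<exists>Z. zero_object C Z)
   \<and> (\<forall>X\<in>Ob C. \<forall>Y\<in>Ob C. \<exists>p q. is_product C X Y p q)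
   \<and> (\<forall>f\<in>Mor C. (\<exists>k. is_kernel C k f) \<and> (\<exists>q. is_cokernel C q f))
   \<and> (\<forall>m. mono_in C m \<longrightarrow> (\<exists>f. is_kernel C m f))
   \<and> (\<forall>e. epi_in C e \<longrightarrow> (\<exists>f. is_cokernel C e f))"

text \<open>Exactness at the middle object: the image of \<open>f\<close>, that is, the kernel of its cokernel, is the
  kernel of \<open>g\<close>.\<close>

definition exact :: "('u::set_universe, 'b) add_cat_scheme \<Rightarrow> 'u \<Rightarrow> 'u \<Rightarrow> bool" where
  "exact C f g \<longleftrightarrow> (\<exists>q k. is_cokernel C q f \<and> is_kernel C k q \<and> is_kernel C k g)"

definition short_exact :: "('u::set_universe, 'b) add_cat_scheme \<Rightarrow> 'u \<Rightarrow> 'u \<Rightarrow> bool" where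
  "short_exact C f g \<longleftrightarrow> mono_in C f \<and> exact C f g \<and> epi_in C g"

definition star_cat :: "('u \<Rightarrow> 'u) \<Rightarrow> 'u add_cat \<Rightarrow> 'u add_cat" where
  "star_cat star C = \<lparr>mors = star (mors C), srcs = star (srcs C), tgts = star (tgts C),
     comps = star (comps C), adds = star (adds C)\<rparr>"


section \<open>Functors\<close>

definition functor_map ::
  "('u::set_universe, 'b) small_cat_scheme \<Rightarrow> ('u, 'c) small_cat_scheme \<Rightarrow> ('u \<Rightarrow> 'u) \<Rightarrow> bool" where
  "functor_map C D \<Phi> \<longleftrightarrow>
     (\<forall>f\<in>Mor C. \<Phi> f \<in> Mor D \<and> \<Phi> (src C f) = src D (\<Phi> f) \<and> \<Phi> (tgt C f) = tgt D (\<Phi> f))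
   \<and> (\<forall>f\<in>Mor C. \<forall>g\<in>Mor C. src C f = tgt C g \<longrightarrow> \<Phi> (cmp C f g) = cmp D (\<Phi> f) (\<Phi> g))"

definition functor_eq ::
  "('u::set_universe, 'b) small_cat_scheme \<Rightarrow> ('u, 'c) small_cat_scheme
    \<Rightarrow> ('u \<Rightarrow> 'u) \<Rightarrow> ('u \<Rightarrow> 'u) \<Rightarrow> bool" where
  "functor_eq C D \<Phi> \<Psi> \<longleftrightarrow> functor_map C D \<Phi> \<and> functor_map C D \<Psi> \<and> (\<forall>f\<in>Mor C. \<Phi> f = \<Psi> f)"

definition is_functor ::
  "('u::set_universe, 'b) small_cat_scheme \<Rightarrow> ('u, 'c) small_cat_scheme \<Rightarrow> 'u \<Rightarrow> bool" where
  "is_functor C D F \<longleftrightarrow> is_map F (mors C) (mors D) \<and> functor_map C D (app F)"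

definition additive_functor ::
  "('u::set_universe, 'b) add_cat_scheme \<Rightarrow> ('u, 'c) add_cat_scheme \<Rightarrow> 'u \<Rightarrow> bool" where
  "additive_functor C D F \<longleftrightarrow> is_functor C D F \<and>
     (\<forall>f\<in>Mor C. \<forall>g\<in>Mor C. src C f = src C g \<and> tgt C f = tgt C g \<longrightarrow>
        app F (add C f g) = add D (app F f) (app F g))"

definition left_exact ::
  "('u::set_universe, 'b) add_cat_scheme \<Rightarrow> ('u, 'c) add_cat_scheme \<Rightarrow> 'u \<Rightarrow> bool" where
  "left_exact C D F \<longleftrightarrow>
     (\<forall>f g. short_exact C f g \<longrightarrow> mono_in D (app F f) \<and> exact D (app F f) (app F g))"

definition right_exact ::
  "('u::set_universe, 'b) add_cat_scheme \<Rightarrow> ('u, 'c) add_cat_scheme \<Rightarrow> 'u \<Rightarrow> bool" where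
  "right_exact C D F \<longleftrightarrow>
     (\<forall>f g. short_exact C f g \<longrightarrow> exact D (app F f) (app F g) \<and> epi_in D (app F g))"


section \<open>Homology\<close>

text \<open>Homology at the middle object of \<open>a\<close> followed by \<open>a'\<close>: \<open>z\<close> embeds the cycles, and \<open>q\<close>
  maps the cycles onto the homology object \<open>tgt C q\<close>.\<close>

definition homology ::
  "('u::set_universe, 'b) add_cat_scheme \<Rightarrow> 'u \<Rightarrow> 'u \<Rightarrow> 'u \<Rightarrow> 'u \<Rightarrow> bool" where
  "homology C a a' z q \<longleftrightarrow> is_kernel C z a' \<and>
     (\<exists>b\<in>Hom C (src C a) (src C z). cmp C z b = a \<and> is_cokernel C q b)"

text \<open>\<open>h\<close> is the map on homology induced by the component \<open>v\<close> of a map of complexes.\<close>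

definition homology_map ::
  "('u::set_universe, 'b) add_cat_scheme \<Rightarrow> 'u \<Rightarrow> 'u \<Rightarrow> 'u \<Rightarrow> 'u \<Rightarrow> 'u \<Rightarrow> 'u \<Rightarrow> bool" where
  "homology_map C v z q z' q' h \<longleftrightarrow> h \<in> Hom C (tgt C q) (tgt C q') \<and>
     (\<exists>u\<in>Hom C (src C z) (src C z'). cmp C z' u = cmp C v z \<and> cmp C h q = cmp C q' u)"

text \<open>Cohomology of the cochain complex \<open>d 0, d 1, \<dots>\<close>; in degree 0 the incoming
  differential is a morphism from a zero object.\<close>

definition cohomology_at ::
  "('u::set_universe, 'b) add_cat_scheme \<Rightarrow> (nat \<Rightarrow> 'u) \<Rightarrow> nat \<Rightarrow> 'u \<Rightarrow> 'u \<Rightarrow> bool" where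
  "cohomology_at C d i z q \<longleftrightarrow>
     (case i of
        0 \<Rightarrow> \<exists>a\<in>Mor C. zero_object C (src C a) \<and> tgt C a = src C (d 0) \<and> homology C a (d 0) z q
      | Suc j \<Rightarrow> homology C (d j) (d i) z q)"

text \<open>Homology of the chain complex with differentials \<open>d n\<close> from degree \<open>n + 1\<close> to degree \<open>n\<close>.\<close>

definition homology_at ::
  "('u::set_universe, 'b) add_cat_scheme \<Rightarrow> (nat \<Rightarrow> 'u) \<Rightarrow> nat \<Rightarrow> 'u \<Rightarrow> 'u \<Rightarrow> bool" where
  "homology_at C d i z q \<longleftrightarrow>
     (case i of
        0 \<Rightarrow> \<exists>a\<in>Mor C. zero_object C (tgt C a) \<and> src C a = tgt C (d 0) \<and> homology C (d 0) a z q
      | Suc j \<Rightarrow> homology C (d i) (d j) z q)"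


section \<open>Derived functors\<close>

text \<open>The choices made for one object: a resolution (\<open>aug\<close> and \<open>diff\<close>), and the (co)homology of
  its image under the functor in the degree in question (\<open>cyc\<close> and \<open>quo\<close>).\<close>

record 'u choice =
  aug :: 'u
  diff :: "nat \<Rightarrow> 'u"
  cyc :: 'u
  quo :: 'u

definition injective_resolution ::
  "('u::set_universe, 'b) add_cat_scheme \<Rightarrow> 'u \<Rightarrow> ('u, 'c) choice_scheme \<Rightarrow> bool" where
  "injective_resolution C X r \<longleftrightarrow>
     aug r \<in> Hom C X (src C (diff r 0))
   \<and> (\<forall>n. diff r n \<in> Mor C \<and> tgt C (diff r n) = src C (diff r (Suc n))
        \<and> injective_object C (src C (diff r n)))
   \<and> mono_in C (aug r) \<and> exact C (aug r) (diff r 0)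
   \<and> (\<forall>n. exact C (diff r n) (diff r (Suc n)))"

definition injective_lift ::
  "('u::set_universe, 'b) add_cat_scheme \<Rightarrow> 'u \<Rightarrow> 'u choice \<Rightarrow> 'u choice \<Rightarrow> (nat \<Rightarrow> 'u) \<Rightarrow> bool" where
  "injective_lift C f r r' \<phi> \<longleftrightarrow>
     (\<forall>n. \<phi> n \<in> Hom C (src C (diff r n)) (src C (diff r' n)))
   \<and> cmp C (\<phi> 0) (aug r) = cmp C (aug r') f
   \<and> (\<forall>n. cmp C (\<phi> (Suc n)) (diff r n) = cmp C (diff r' n) (\<phi> n))"

text \<open>The morphism \<open>h\<close> is obtained from \<open>f\<close> by lifting \<open>f\<close> to the chosen resolutions, applying \<open>F\<close>,
  and passing to cohomology in degree \<open>i\<close>.\<close>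

definition right_induced ::
  "'u::set_universe add_cat \<Rightarrow> 'u add_cat \<Rightarrow> 'u \<Rightarrow> nat \<Rightarrow> 'u \<Rightarrow> 'u choice \<Rightarrow> 'u choice \<Rightarrow> 'u \<Rightarrow> bool"
  where
  "right_induced A B F i f r r' h \<longleftrightarrow>
     (\<exists>\<phi>. injective_lift A f r r' \<phi> \<and> homology_map B (app F (\<phi> i)) (cyc r) (quo r) (cyc r') (quo r') h)"

definition right_derived_by ::
  "'u::set_universe add_cat \<Rightarrow> 'u add_cat \<Rightarrow> 'u \<Rightarrow> nat \<Rightarrow> ('u \<Rightarrow> 'u choice) \<Rightarrow> 'u \<Rightarrow> bool" where
  "right_derived_by A B F i r R \<longleftrightarrow> is_functor A B R
   \<and> (\<forall>X\<in>Ob A. injective_resolution A X (r X)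
        \<and> cohomology_at B (\<lambda>n. app F (diff (r X) n)) i (cyc (r X)) (quo (r X))
        \<and> app R X = tgt B (quo (r X)))
   \<and> (\<forall>f\<in>Mor A. right_induced A B F i f (r (src A f)) (r (tgt A f)) (app R f))"

definition right_derived ::
  "'u::set_universe add_cat \<Rightarrow> 'u add_cat \<Rightarrow> 'u \<Rightarrow> nat \<Rightarrow> 'u \<Rightarrow> bool" where
  "right_derived A B F i R \<longleftrightarrow> (\<exists>r. right_derived_by A B F i r R)"

definition natural_iso ::
  "('u::set_universe, 'b) small_cat_scheme \<Rightarrow> ('u, 'c) small_cat_scheme
    \<Rightarrow> 'u \<Rightarrow> 'u \<Rightarrow> ('u \<Rightarrow> 'u) \<Rightarrow> bool" where
  "natural_iso A B R R' \<eta> \<longleftrightarrow>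
     (\<forall>X\<in>Ob A. \<eta> X \<in> Hom B (app R X) (app R' X) \<and> iso_in B (\<eta> X))
   \<and> (\<forall>f\<in>Mor A. cmp B (app R' f) (\<eta> (src A f)) = cmp B (\<eta> (tgt A f)) (app R f))"

text \<open>Equality up to canonical isomorphism: both functors are right derived functors of \<open>F\<close>, and for
  whatever choices of resolutions they arise from, the lifts of the identities \<open>X\<close> induce
  a natural isomorphism between them.\<close>

definition right_derived_eq ::
  "'u::set_universe add_cat \<Rightarrow> 'u add_cat \<Rightarrow> 'u \<Rightarrow> nat \<Rightarrow> 'u \<Rightarrow> 'u \<Rightarrow> bool" where
  "right_derived_eq A B F i R R' \<longleftrightarrow>
     right_derived A B F i R \<and> right_derived A B F i R'
   \<and> (\<forall>r r'. right_derived_by A B F i r R \<and> right_derived_by A B F i r' R' \<longrightarrow>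
        (\<exists>\<eta>. natural_iso A B R R' \<eta> \<and> (\<forall>X\<in>Ob A. right_induced A B F i X (r X) (r' X) (\<eta> X))))"

definition projective_resolution ::
  "('u::set_universe, 'b) add_cat_scheme \<Rightarrow> 'u \<Rightarrow> ('u, 'c) choice_scheme \<Rightarrow> bool" where
  "projective_resolution C X r \<longleftrightarrow>
     aug r \<in> Hom C (tgt C (diff r 0)) X
   \<and> (\<forall>n. diff r n \<in> Mor C \<and> src C (diff r n) = tgt C (diff r (Suc n))
        \<and> projective_object C (tgt C (diff r n)))
   \<and> epi_in C (aug r) \<and> exact C (diff r 0) (aug r)
   \<and> (\<forall>n. exact C (diff r (Suc n)) (diff r n))"

definition projective_lift ::
  "('u::set_universe, 'b) add_cat_scheme \<Rightarrow> 'u \<Rightarrow> 'u choice \<Rightarrow> 'u choice \<Rightarrow> (nat \<Rightarrow> 'u) \<Rightarrow> bool" where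
  "projective_lift C f r r' \<phi> \<longleftrightarrow>
     (\<forall>n. \<phi> n \<in> Hom C (tgt C (diff r n)) (tgt C (diff r' n)))
   \<and> cmp C (aug r') (\<phi> 0) = cmp C f (aug r)
   \<and> (\<forall>n. cmp C (\<phi> n) (diff r n) = cmp C (diff r' n) (\<phi> (Suc n)))"

definition left_induced ::
  "'u::set_universe add_cat \<Rightarrow> 'u add_cat \<Rightarrow> 'u \<Rightarrow> nat \<Rightarrow> 'u \<Rightarrow> 'u choice \<Rightarrow> 'u choice \<Rightarrow> 'u \<Rightarrow> bool"
  where
  "left_induced A B F i f r r' h \<longleftrightarrow>
     (\<exists>\<phi>. projective_lift A f r r' \<phi> \<and> homology_map B (app F (\<phi> i)) (cyc r) (quo r) (cyc r') (quo r') h)"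

definition left_derived_by ::
  "'u::set_universe add_cat \<Rightarrow> 'u add_cat \<Rightarrow> 'u \<Rightarrow> nat \<Rightarrow> ('u \<Rightarrow> 'u choice) \<Rightarrow> 'u \<Rightarrow> bool" where
  "left_derived_by A B F i r L \<longleftrightarrow> is_functor A B L
   \<and> (\<forall>X\<in>Ob A. projective_resolution A X (r X)
        \<and> homology_at B (\<lambda>n. app F (diff (r X) n)) i (cyc (r X)) (quo (r X))
        \<and> app L X = tgt B (quo (r X)))
   \<and> (\<forall>f\<in>Mor A. left_induced A B F i f (r (src A f)) (r (tgt A f)) (app L f))"

definition left_derived ::
  "'u::set_universe add_cat \<Rightarrow> 'u add_cat \<Rightarrow> 'u \<Rightarrow> nat \<Rightarrow> 'u \<Rightarrow> bool" where
  "left_derived A B F i L \<longleftrightarrow> (\<exists>r. left_derived_by A B F i r L)"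

definition left_derived_eq ::
  "'u::set_universe add_cat \<Rightarrow> 'u add_cat \<Rightarrow> 'u \<Rightarrow> nat \<Rightarrow> 'u \<Rightarrow> 'u \<Rightarrow> bool" where
  "left_derived_eq A B F i L L' \<longleftrightarrow>
     left_derived A B F i L \<and> left_derived A B F i L'
   \<and> (\<forall>r r'. left_derived_by A B F i r L \<and> left_derived_by A B F i r' L' \<longrightarrow>
        (\<exists>\<eta>. natural_iso A B L L' \<eta> \<and> (\<forall>X\<in>Ob A. left_induced A B F i X (r X) (r' X) (\<eta> X))))"

end

theory Submission
  imports Defs
begin

text \<open>Derived functors are computed degree by degree, and the cohomology in degree \<open>i\<close> involves only
  finitely many terms of a resolution. So the choices behind a derived functor of \<open>F\<close>, cut off after
  degree \<open>i\<close>, form finitely many maps inside the superstructure. By transfer, their images under the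
  enlargement are truncated resolutions and lifts in the enlarged category; its enough
  injectives (projectives) extend these to full, in general external, resolutions and lifts.
  Therefore \<open>star R\<close> is a derived functor of \<open>star F\<close>, and the comparison with any other one is the
  usual uniqueness of lifts up to homotopy.\<close>

subsection \<open>Sets, pairs and superstructures\<close>

text \<open>Cutting off is forced by the formula language. A formula is finite, and a resolution
  kept whole, as one map on the natural numbers, would be sent to a family indexed by the enlarged
  natural numbers. Each entry of a truncated resolution is therefore a constant of its own, a map
  from objects to morphisms, and the conditions on these entries are finite conjunctions. Continuing
  the transferred pieces must not change them, so the existence of resolutions and lifts is proved
  in the form: a given finite piece extends. Uniqueness, on the other hand, is never transferred. It
  is claimed against every derived functor of \<open>star F\<close>, whatever external choices it
  arises from, so the homological algebra is done for arbitrary abelian categories and used twice,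
  for \<open>F\<close> and for \<open>star F\<close>. The projective case reuses resolutions and
  lifts through the opposite of the source category only: \<open>homology\<close> is a quotient of
  the cycles, a description that is not its own dual, so the target category and the functor stay as
  they are.\<close>

lemma set_of_eqI: "is_set x \<Longrightarrow> elts x = X \<Longrightarrow> set_of X = (x::'u::set_universe)"
  unfolding set_of_def by (rule the_equality) (auto intro: extensionality)

lemma set_of_subset:
  assumes "X \<subseteq> elts (a::'u::set_universe)"
  shows "is_set (set_of X)" "elts (set_of X) = X"
  using separation[OF assms] set_of_eqI by metis+

lemma set_of_pair:
  "is_set (set_of {a, b})" "elts (set_of {a, b}) = {a, b::'u::set_universe}"
  using pairing[of a b] set_of_eqI by metis+

lemma set_of_singleton:
  "is_set (set_of {a})" "elts (set_of {a}) = {a::'u::set_universe}"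
  using set_of_pair[of a a] by simp_all

lemma opair_elts: "elts (opair x y) = {set_of {x}, set_of {x, y::'u::set_universe}}"
  unfolding opair_def by (rule set_of_pair)

lemma opair_inject [simp]: "opair x y = opair x' y' \<longleftrightarrow> x = x' \<and> y = (y'::'u::set_universe)"
proof
  assume "opair x y = opair x' y'"
  then have *: "{set_of {x}, set_of {x, y}} = {set_of {x'}, set_of {x', y'}}"
    using opair_elts by metis
  have "elts ` {set_of {x}, set_of {x, y}} = elts ` {set_of {x'}, set_of {x', y'}}"
    using * by simp
  then have "{{x}, {x, y}} = {{x'}, {x', y'}}"
    by (simp add: set_of_pair set_of_singleton)
  then show "x = x' \<and> y = y'"
    by (auto simp: doubleton_eq_iff)
qed simp

lemma triple_inject [simp]:
  "triple x y z = triple x' y' z' \<longleftrightarrow> x = x' \<and> y = y' \<and> z = (z'::'u::set_universe)"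
  by (auto simp: triple_def)

text \<open>Kuratowski pairs lie two power sets above the union of \<open>a\<close> and
  \<open>b\<close>. A superset is enough, because separation cuts every relation out of it.\<close>

lemma product_exists:
  "\<exists>p. {opair x y | x y. x \<in> elts a \<and> y \<in> elts b} \<subseteq> elts (p::'u::set_universe)"
proof -
  obtain c where c: "is_set c" "elts c = {a, b}" using pairing by blast
  obtain u where u: "elts u = (\<Union>x\<in>elts c. elts x)" using union by blast
  obtain p where p: "elts p = {y. is_set y \<and> elts y \<subseteq> elts u}" using power by blast
  obtain q where q: "elts q = {y. is_set y \<and> elts y \<subseteq> elts p}" using power by blast
  have "opair x y \<in> elts q" if "x \<in> elts a" "y \<in> elts b" for x y
    unfolding q using that
    by (auto simp: p u c opair_elts set_of_pair set_of_singleton)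
       (simp add: opair_def set_of_pair)
  then show ?thesis by blast
qed

lemma set_of_relation:
  assumes "X \<subseteq> {opair x y | x y. x \<in> elts a \<and> y \<in> elts (b::'u::set_universe)}"
  shows "is_set (set_of X)" "elts (set_of X) = X"
proof -
  obtain p where "X \<subseteq> elts p" using product_exists[of a b] assms by blast
  then show "is_set (set_of X)" "elts (set_of X) = X" by (rule set_of_subset)+
qed

lemma app_eqI:
  "opair x y \<in> elts f \<Longrightarrow> (\<And>y'. opair x y' \<in> elts f \<Longrightarrow> y' = y) \<Longrightarrow> app f x = (y::'u::set_universe)"
  unfolding app_def by (subst if_P) (blast intro: the_equality)+

lemma is_map_app:
  assumes "is_map f X (Y::'u::set_universe)" "x \<in> elts X"
  shows "app f x \<in> elts Y" "opair x (app f x) \<in> elts f"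
proof -
  obtain y where y: "opair x y \<in> elts f" "\<And>y'. opair x y' \<in> elts f \<Longrightarrow> y' = y"
    using assms unfolding is_map_def by blast
  then have "app f x = y" by (rule app_eqI)
  with y(1) show "opair x (app f x) \<in> elts f" by simp
  with assms(1) show "app f x \<in> elts Y" by (auto simp: is_map_def)
qed

lemma ex_map:
  assumes "g ` D \<subseteq> elts b" "D \<subseteq> elts (a::'u::set_universe)"
  shows "\<exists>G. is_set G \<and> elts G = (\<lambda>x. opair x (g x)) ` D \<and> (\<forall>x\<in>D. app G x = g x)"
proof -
  let ?X = "(\<lambda>x. opair x (g x)) ` D"
  have "?X \<subseteq> {opair x y | x y. x \<in> elts a \<and> y \<in> elts b}" using assms by auto
  note * = set_of_relation[OF this]
  have "app (set_of ?X) x = g x" if "x \<in> D" for x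
    using that by (intro app_eqI) (auto simp: *)
  with * show ?thesis by blast
qed

lemma is_mapI:
  assumes "is_set G" "elts G = (\<lambda>x. opair x (g x)) ` elts a" "g ` elts a \<subseteq> elts b"
  shows "is_map G a (b::'u::set_universe)"
  using assms unfolding is_map_def by auto

lemma level_mono: "m \<le> n \<Longrightarrow> level S m \<subseteq> level (S::'u::set_universe) n"
  by (induction rule: dec_induct) auto

text \<open>Levels are transitive: at the bottom because urelements have no elements, above it
  because a new set has all its elements in the previous level.\<close>

lemma level_elts:
  assumes "base_set (S::'u::set_universe)"
  shows "x \<in> level S n \<Longrightarrow> elts x \<subseteq> level S n"
proof (induction n)
  case 0
  then show ?case using assms by (auto simp: base_set_def elts_urelement)
next
  case (Suc n)
  then show ?case by auto
qed

lemma level_opair: 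
  assumes "x \<in> level S n" "y \<in> level (S::'u::set_universe) n"
  shows "opair x y \<in> level S (Suc (Suc n))"
proof -
  have "is_set (opair x y)" by (simp add: opair_def set_of_pair)
  moreover have "set_of {x} \<in> level S (Suc n)" "set_of {x, y} \<in> level S (Suc n)"
    using assms by (auto simp: set_of_pair set_of_singleton)
  ultimately show ?thesis by (auto simp: opair_elts)
qed

lemma superstr_level2:
  assumes "a \<in> superstr S" "b \<in> superstr (S::'u::set_universe)"
  obtains n where "a \<in> level S n" "b \<in> level S n"
proof -
  obtain k m where "a \<in> level S k" "b \<in> level S m" using assms by (auto simp: superstr_def)
  then have "a \<in> level S (max k m)" "b \<in> level S (max k m)"
    using level_mono[of k "max k m" S] level_mono[of m "max k m" S] by auto
  then show ?thesis by (rule that)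
qed

lemma superstr_relation:
  assumes "base_set (S::'u::set_universe)" "a \<in> superstr S" "b \<in> superstr S" "is_set f"
    and sub: "elts f \<subseteq> {opair x y | x y. x \<in> elts a \<and> y \<in> elts b}"
  shows "f \<in> superstr S"
proof -
  obtain n where n: "a \<in> level S n" "b \<in> level S n" using superstr_level2 assms by blast
  have "elts f \<subseteq> level S (Suc (Suc n))"
    using sub level_elts[OF assms(1) n(1)] level_elts[OF assms(1) n(2)] level_opair[of _ S n] by blast
  then have "f \<in> level S (Suc (Suc (Suc n)))" using assms(4) by simp
  then show ?thesis unfolding superstr_def by blast
qed

lemma superstr_ternary:
  assumes "base_set (S::'u::set_universe)" "a \<in> superstr S" "is_set f"
    and sub: "elts f \<subseteq> {triple x y z | x y z. x \<in> elts a \<and> y \<in> elts a \<and> z \<in> elts a}"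
  shows "f \<in> superstr S"
proof -
  obtain n where n: "a \<in> level S n" using assms by (auto simp: superstr_def)
  note e = level_elts[OF assms(1) n]
  \<comment> \<open>A left-nested triple takes two pairings, and each raises the level by
    two.\<close>
  have "triple x y z \<in> level S (Suc (Suc (Suc (Suc n))))"
    if "x \<in> elts a" "y \<in> elts a" "z \<in> elts a" for x y z
    unfolding triple_def using that e level_mono[of n "Suc (Suc n)" S]
    by (intro level_opair) (auto simp del: level.simps)
  then have "f \<in> level S (Suc (Suc (Suc (Suc (Suc n)))))" using assms(3) sub 
    by (subst level.simps) blast
  then show ?thesis unfolding superstr_def by blast
qed

text \<open>This turns a choice made in HOL into an element of the superstructure, which may then
  occur as a constant in a formula.\<close>

lemma superstr_map_exists:
  assumes "base_set (S::'u::set_universe)" "a \<in> superstr S" "b \<in> superstr S"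
    and "D \<subseteq> elts a" "g ` D \<subseteq> elts b"
  shows "\<exists>G\<in>superstr S. \<forall>x\<in>D. app G x = g x"
proof -
  obtain G where G: "is_set G" "elts G = (\<lambda>x. opair x (g x)) ` D" "\<forall>x\<in>D. app G x = g x"
    using ex_map[OF assms(5,4)] by blast
  have "G \<in> superstr S"
    by (rule superstr_relation[OF assms(1-3) G(1)]) (unfold G(2), use assms(4,5) in blast)
  with G show ?thesis by blast
qed

subsection \<open>Abelian categories without products\<close>

text \<open>The part of the axioms that the argument uses. It is self-dual on the nose, and each axiom is
  a bounded formula, so that it can be transferred.\<close>

locale abelian_cat =
  fixes C :: "'u::set_universe add_cat"
  assumes ax_src_tgt: "\<forall>f\<in>Mor C. src C f \<in> Mor C \<and> tgt C f \<in> Mor C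
      \<and> src C (src C f) = src C f \<and> tgt C (src C f) = src C f
      \<and> src C (tgt C f) = tgt C f \<and> tgt C (tgt C f) = tgt C f"
    and ax_cmp: "\<forall>f\<in>Mor C. \<forall>g\<in>Mor C. src C f = tgt C g \<longrightarrow>
      cmp C f g \<in> Mor C \<and> src C (cmp C f g) = src C g \<and> tgt C (cmp C f g) = tgt C f"
    and ax_unit: "\<forall>f\<in>Mor C. cmp C f (src C f) = f \<and> cmp C (tgt C f) f = f"
    and ax_assoc: "\<forall>f\<in>Mor C. \<forall>g\<in>Mor C. \<forall>h\<in>Mor C. src C f = tgt C g \<and> src C g = tgt C h \<longrightarrow>
      cmp C (cmp C f g) h = cmp C f (cmp C g h)"
    and ax_add: "\<forall>f\<in>Mor C. \<forall>g\<in>Mor C. src C f = src C g \<and> tgt C f = tgt C g \<longrightarrow>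
      add C f g \<in> Mor C \<and> src C (add C f g) = src C f \<and> tgt C (add C f g) = tgt C f
      \<and> add C f g = add C g f"
    and ax_add_assoc: "\<forall>f\<in>Mor C. \<forall>g\<in>Mor C. \<forall>h\<in>Mor C.
      src C f = src C g \<and> tgt C f = tgt C g \<and> src C g = src C h \<and> tgt C g = tgt C h \<longrightarrow>
      add C (add C f g) h = add C f (add C g h)"
    and ax_zero: "\<forall>f\<in>Mor C. \<forall>g\<in>Mor C. \<exists>z\<in>Mor C. z \<in> Hom C (src C f) (tgt C g) \<and> zero_mor C z"
    and ax_neg: "\<forall>f\<in>Mor C. \<exists>g\<in>Mor C. g \<in> Hom C (src C f) (tgt C f) \<and> zero_mor C (add C f g)"
    and ax_distr: "\<forall>f\<in>Mor C. \<forall>g\<in>Mor C. \<forall>h\<in>Mor C.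
      src C f = src C g \<and> tgt C f = tgt C g \<and> tgt C h = src C f \<longrightarrow>
        cmp C (add C f g) h = add C (cmp C f h) (cmp C g h)"
    and ax_distl: "\<forall>f\<in>Mor C. \<forall>g\<in>Mor C. \<forall>h\<in>Mor C.
      src C f = src C g \<and> tgt C f = tgt C g \<and> src C h = tgt C f \<longrightarrow>
        cmp C h (add C f g) = add C (cmp C h f) (cmp C h g)"
    and ax_zero_object: "\<exists>Z\<in>Mor C. zero_object C Z"
    and ax_kernels: "\<forall>f\<in>Mor C. (\<exists>k\<in>Mor C. is_kernel C k f) \<and> (\<exists>q\<in>Mor C. is_cokernel C q f)"
    and ax_mono: "\<forall>m\<in>Mor C. mono_in C m \<longrightarrow> (\<exists>f\<in>Mor C. is_kernel C m f)"
    and ax_epi: "\<forall>e\<in>Mor C. epi_in C e \<longrightarrow> (\<exists>f\<in>Mor C. is_cokernel C e f)"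

lemma is_mapD_app:
  assumes "is_map f (mors C) (mors C)" "x \<in> Mor (C::('u::set_universe, 'b) small_cat_scheme)"
  shows "app f x \<in> Mor C"
  using is_map_app[OF assms(1)] assms(2) by (simp add: Mor_def)

lemma app_pair:
  fixes r :: "'u::set_universe"
  assumes "\<And>f g h. triple f g h \<in> elts r \<Longrightarrow> h \<in> M"
    and "\<forall>f g h h'. triple f g h \<in> elts r \<and> triple f g h' \<in> elts r \<longrightarrow> h = h'"
    and "\<exists>h. triple f g h \<in> elts r"
  shows "app r (opair f g) \<in> M"
proof -
  obtain h where h: "triple f g h \<in> elts r" using assms by blast
  have "app r (opair f g) = h"
    by (rule app_eqI) (use h assms(2) in \<open>auto simp: triple_def\<close>)
  with h assms(1) show ?thesis by metis
qed

text \<open>Strips off the record, in which the neutral element is only existentially bound, and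
  keeps the part that refers to the carrier and the operation alone.\<close>

lemma comm_group_record:
  assumes "comm_group \<lparr>carrier = H, monoid.mult = p, one = e\<rparr>"
  shows "\<exists>z\<in>H. (\<forall>g\<in>H. p z g = g \<and> p g z = g) \<and> (\<forall>f\<in>H. \<exists>g\<in>H. p f g = z)
    \<and> (\<forall>f\<in>H. \<forall>g\<in>H. p f g \<in> H \<and> p f g = p g f \<and> (\<forall>h\<in>H. p (p f g) h = p f (p g h)))"
proof -
  interpret comm_group "\<lparr>carrier = H, monoid.mult = p, one = e\<rparr>" by fact
  have c: "p x y \<in> H" if "x \<in> H" "y \<in> H" for x y using m_closed that by simp
  have m: "p x y = p y x" if "x \<in> H" "y \<in> H" for x y using m_comm that by simp
  have a: "p (p x y) z = p x (p y z)" if "x \<in> H" "y \<in> H" "z \<in> H" for x y z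
    using m_assoc that by simp
  have i: "\<exists>y\<in>H. p x y = e" if "x \<in> H" for x using r_inv_ex that by simp
  have e: "e \<in> H" using one_closed by simp
  have u: "p e x = x" "p x e = x" if "x \<in> H" for x using l_one r_one that by simp_all
  show ?thesis
    by (rule bexI[OF _ e], intro conjI ballI) (fact c m a i u)+
qed

lemma kernelM:
  "is_kernel C k f \<Longrightarrow> k \<in> Mor C" "is_kernel C k f \<Longrightarrow> f \<in> Mor C"
  "is_cokernel C q f \<Longrightarrow> q \<in> Mor C" "is_cokernel C q f \<Longrightarrow> f \<in> Mor C"
  unfolding is_kernel_def is_cokernel_def by (elim conjE, assumption)+

lemma abelian_catI:
  assumes "abelian_small_category S (C::'u::set_universe add_cat)"
  shows "abelian_cat C"
proof -
  have sc: "small_category S C" and addset: "is_set (adds C)"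
    "elts (adds C) \<subseteq> {triple f g h | f g h. f \<in> Mor C \<and> g \<in> Mor C \<and> h \<in> Mor C}"
    and addex: "\<forall>f\<in>Mor C. \<forall>g\<in>Mor C.
        (\<exists>h. triple f g h \<in> elts (adds C)) \<longleftrightarrow> src C f = src C g \<and> tgt C f = tgt C g"
    and adduniq: "\<forall>f g h h'. triple f g h \<in> elts (adds C) \<and> triple f g h' \<in> elts (adds C) \<longrightarrow> h = h'"
    and grp: "\<forall>X\<in>Ob C. \<forall>Y\<in>Ob C. \<exists>e. comm_group \<lparr>carrier = Hom C X Y, monoid.mult = add C, one = e\<rparr>"
    and distr: "\<forall>f\<in>Mor C. \<forall>g\<in>Mor C. \<forall>h\<in>Mor C. src C f = src C g \<and> tgt C f = tgt C g \<and> tgt C h = src C f \<longrightarrow>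
        cmp C (add C f g) h = add C (cmp C f h) (cmp C g h)"
    and distl: "\<forall>f\<in>Mor C. \<forall>g\<in>Mor C. \<forall>h\<in>Mor C. src C f = src C g \<and> tgt C f = tgt C g \<and> src C h = tgt C f \<longrightarrow>
        cmp C h (add C f g) = add C (cmp C h f) (cmp C h g)"
    and zo: "\<exists>Z. zero_object C Z"
    and ker: "\<forall>f\<in>Mor C. (\<exists>k. is_kernel C k f) \<and> (\<exists>q. is_cokernel C q f)"
    and mono: "\<forall>m. mono_in C m \<longrightarrow> (\<exists>f. is_kernel C m f)"
    and epi: "\<forall>e. epi_in C e \<longrightarrow> (\<exists>f. is_cokernel C e f)"
    using assms unfolding abelian_small_category_def by - (elim conjE, assumption)+
  have srcmap: "is_map (srcs C) (mors C) (mors C)" and tgtmap: "is_map (tgts C) (mors C) (mors C)"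
    and compset: "elts (comps C) \<subseteq> {triple f g h | f g h. f \<in> Mor C \<and> g \<in> Mor C \<and> h \<in> Mor C}"
    and st: "\<forall>f\<in>Mor C. src C (src C f) = src C f \<and> tgt C (src C f) = src C f
        \<and> src C (tgt C f) = tgt C f \<and> tgt C (tgt C f) = tgt C f"
    and cex: "\<forall>f\<in>Mor C. \<forall>g\<in>Mor C. (\<exists>h. triple f g h \<in> elts (comps C)) \<longleftrightarrow> src C f = tgt C g"
    and cuniq: "\<forall>f g h h'. triple f g h \<in> elts (comps C) \<and> triple f g h' \<in> elts (comps C) \<longrightarrow> h = h'"
    and cst: "\<forall>f\<in>Mor C. \<forall>g\<in>Mor C. src C f = tgt C g \<longrightarrow>
        src C (cmp C f g) = src C g \<and> tgt C (cmp C f g) = tgt C f"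
    and unit: "\<forall>f\<in>Mor C. cmp C f (src C f) = f \<and> cmp C (tgt C f) f = f"
    and assoc: "\<forall>f\<in>Mor C. \<forall>g\<in>Mor C. \<forall>h\<in>Mor C. src C f = tgt C g \<and> src C g = tgt C h \<longrightarrow>
        cmp C (cmp C f g) h = cmp C f (cmp C g h)"
    using sc unfolding small_category_def by - (elim conjE, assumption)+
  have srcM: "src C f \<in> Mor C" and tgtM: "tgt C f \<in> Mor C" if "f \<in> Mor C" for f
    using that srcmap tgtmap is_mapD_app unfolding src_def tgt_def by blast+
  have ob: "src C f \<in> Ob C" "tgt C f \<in> Ob C" if "f \<in> Mor C" for f
    using that srcM tgtM st by (auto simp: Ob_def)
  have cM: "cmp C f g \<in> Mor C" if "f \<in> Mor C" "g \<in> Mor C" "src C f = tgt C g" for f g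
    unfolding cmp_def by (rule app_pair) (use compset that cuniq cex in auto)
  \<comment> \<open>The neutral element of each group of morphisms is the zero morphism wanted by
    \<open>ax_zero\<close>, and inverses relative to it give \<open>ax_neg\<close>.\<close>
  have zero: "\<exists>z\<in>Hom C X Y. (\<forall>g\<in>Hom C X Y. add C z g = g \<and> add C g z = g) \<and>
      (\<forall>f\<in>Hom C X Y. \<exists>g\<in>Hom C X Y. add C f g = z) \<and> (\<forall>f\<in>Hom C X Y. \<forall>g\<in>Hom C X Y.
       add C f g \<in> Hom C X Y \<and> add C f g = add C g f \<and> (\<forall>h\<in>Hom C X Y. 
       add C (add C f g) h = add C f (add C g h)))" if "X \<in> Ob C" "Y \<in> Ob C" for X Y
  proof -
    have "\<exists>e. comm_group \<lparr>carrier = Hom C X Y, monoid.mult = add C, one = e\<rparr>"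
      using bspec[OF bspec[OF grp that(1)] that(2)] .
    then show ?thesis by (elim exE) (rule comm_group_record)
  qed
  have zm: "zero_mor C z" if "z\<in>Hom C X Y" "\<forall>g\<in>Hom C X Y. add C z g = g \<and> add C g z = g" for z X Y
    using that by (auto simp: zero_mor_def Hom_def)
  have sameH: "g \<in> Hom C (src C f) (tgt C f)" if "g \<in> Mor C" "src C f = src C g" "tgt C f = tgt C g" for f g
    using that by (simp add: Hom_def)
  show ?thesis
  proof
    show "\<forall>f\<in>Mor C. src C f \<in> Mor C \<and> tgt C f \<in> Mor C
      \<and> src C (src C f) = src C f \<and> tgt C (src C f) = src C f
      \<and> src C (tgt C f) = tgt C f \<and> tgt C (tgt C f) = tgt C f"
      using srcM tgtM st by blast
    show "\<forall>f\<in>Mor C. \<forall>g\<in>Mor C. src C f = tgt C g \<longrightarrow>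
      cmp C f g \<in> Mor C \<and> src C (cmp C f g) = src C g \<and> tgt C (cmp C f g) = tgt C f"
      using cM cst by blast
    show "\<forall>f\<in>Mor C. \<forall>g\<in>Mor C. src C f = src C g \<and> tgt C f = tgt C g \<longrightarrow>
      add C f g \<in> Mor C \<and> src C (add C f g) = src C f \<and> tgt C (add C f g) = tgt C f
      \<and> add C f g = add C g f"
    proof (intro ballI impI)
      fix f g assume *: "f \<in> Mor C" "g \<in> Mor C" "src C f = src C g \<and> tgt C f = tgt C g"
      then have "add C f g \<in> Hom C (src C f) (tgt C f) \<and> add C f g = add C g f"
        using zero[OF ob[OF *(1)]] sameH[of g f] sameH[of f f] by blast
      then show "add C f g \<in> Mor C \<and> src C (add C f g) = src C f \<and> tgt C (add C f g) = tgt C f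
      \<and> add C f g = add C g f" unfolding Hom_def by blast
    qed
    show "\<forall>f\<in>Mor C. \<forall>g\<in>Mor C. \<forall>h\<in>Mor C.
      src C f = src C g \<and> tgt C f = tgt C g \<and> src C g = src C h \<and> tgt C g = tgt C h \<longrightarrow>
      add C (add C f g) h = add C f (add C g h)"
    proof (intro ballI impI)
      fix f g h assume *: "f \<in> Mor C" "g \<in> Mor C" "h \<in> Mor C"
       "src C f = src C g \<and> tgt C f = tgt C g \<and> src C g = src C h \<and> tgt C g = tgt C h"
      then have "f \<in> Hom C (src C f) (tgt C f)" "g \<in> Hom C (src C f) (tgt C f)"
        "h \<in> Hom C (src C f) (tgt C f)" by (auto simp: Hom_def)
      with zero[OF ob[OF *(1)]] show "add C (add C f g) h = add C f (add C g h)"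
        by (elim bexE conjE) blast
    qed
    show "\<forall>f\<in>Mor C. \<forall>g\<in>Mor C. \<exists>z\<in>Mor C. z \<in> Hom C (src C f) (tgt C g) \<and> zero_mor C z"
    proof (intro ballI)
      fix f g assume "f \<in> Mor C" "g \<in> Mor C"
      then obtain z where "z \<in> Hom C (src C f) (tgt C g)" "zero_mor C z"
        using zero[of "src C f" "tgt C g"] zm ob by meson
      then show "\<exists>z\<in>Mor C. z \<in> Hom C (src C f) (tgt C g) \<and> zero_mor C z"
        by (auto simp: Hom_def)
    qed
    show "\<forall>f\<in>Mor C. \<exists>g\<in>Mor C. g \<in> Hom C (src C f) (tgt C f) \<and> zero_mor C (add C f g)"
    proof
      fix f assume f: "f \<in> Mor C"
      then obtain g where "g \<in> Hom C (src C f) (tgt C f)" "zero_mor C (add C f g)"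
        using zero[OF ob[OF f]] zm sameH[of f f] by metis
      then show "\<exists>g\<in>Mor C. g \<in> Hom C (src C f) (tgt C f) \<and> zero_mor C (add C f g)"
        by (auto simp: Hom_def)
    qed
    show "\<exists>Z\<in>Mor C. zero_object C Z" using zo by (auto simp: zero_object_def Ob_def)
    show "\<forall>f\<in>Mor C. (\<exists>k\<in>Mor C. is_kernel C k f) \<and> (\<exists>q\<in>Mor C. is_cokernel C q f)"
      using ker kernelM by blast
    show "\<forall>m\<in>Mor C. mono_in C m \<longrightarrow> (\<exists>f\<in>Mor C. is_kernel C m f)"
      using mono kernelM by blast
    show "\<forall>m\<in>Mor C. epi_in C m \<longrightarrow> (\<exists>f\<in>Mor C. is_cokernel C m f)"
      using epi kernelM by blast
  qed (fact unit assoc distl distr)+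
qed

section \<open>The opposite category and duality\<close>

definition op_cat :: "'u::set_universe add_cat \<Rightarrow> 'u add_cat" where
  "op_cat C = \<lparr>mors = mors C, srcs = tgts C, tgts = srcs C,
     comps = set_of {triple g f h | f g h. triple f g h \<in> elts (comps C)}, adds = adds C\<rparr>"

text \<open>\<open>set_of\<close> is meaningful only once the collection is known to be a set.
  Nothing is assumed about \<open>c\<close>, so an ambient product is built from the components of
  the pairs in it.\<close>

lemma op_comps: "elts (set_of {triple g f h | f g h. triple f g h \<in> elts c})
  = {triple g f h | f g h. triple f g h \<in> elts (c::'u::set_universe)}"
proof -
  have un: "\<exists>u. \<forall>x\<in>elts a. elts x \<subseteq> elts u" for a :: 'u
    using union[of a] by blast
  \<comment> \<open>Both components of a Kuratowski pair in \<open>c\<close> are elements of the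
    double union of \<open>c\<close>. For nested triples this is applied twice.\<close>
  have pr: "\<exists>p. \<forall>x y. opair x y \<in> elts c \<longrightarrow> x \<in> elts p \<and> y \<in> elts p" for c :: 'u
  proof -
    obtain u v where u: "\<forall>x\<in>elts c. elts x \<subseteq> elts u" and v: "\<forall>x\<in>elts u. elts x \<subseteq> elts v"
      using un by metis
    have "x \<in> elts v \<and> y \<in> elts v" if "opair x y \<in> elts c" for x y
    proof -
      have "set_of {x, y} \<in> elts u" using u that opair_elts by fastforce
      with v show ?thesis by (force simp: set_of_pair)
    qed
    then show ?thesis by blast
  qed
  obtain p where p: "\<forall>x y. opair x y \<in> elts c \<longrightarrow> x \<in> elts p \<and> y \<in> elts p" using pr by metis
  obtain q where q: "\<forall>x y. opair x y \<in> elts p \<longrightarrow> x \<in> elts q \<and> y \<in> elts q" using pr by metis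
  obtain r where r: "{opair x y | x y. x \<in> elts q \<and> y \<in> elts q} \<subseteq> elts r"
    using product_exists[of q q] by blast
  have "{triple g f h | f g h. triple f g h \<in> elts c}
    \<subseteq> {opair x y | x y. x \<in> elts r \<and> y \<in> elts p}"
  proof safe
    fix f g h assume "triple f g h \<in> elts c"
    then have "opair f g \<in> elts p" "h \<in> elts p" using p by (simp_all add: triple_def)
    moreover from this q have "f \<in> elts q" "g \<in> elts q" by simp_all
    ultimately show "\<exists>x y. triple g f h = opair x y \<and> x \<in> elts r \<and> y \<in> elts p"
      using r by (auto simp: triple_def)
  qed
  then show ?thesis by (rule set_of_relation(2))
qed

lemma Mor_op [simp]: "Mor (op_cat C) = Mor C"
  and src_op [simp]: "src (op_cat C) f = tgt C f"
  and tgt_op [simp]: "tgt (op_cat C) f = src C f"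
  and add_op [simp]: "add (op_cat C) f g = add C f g"
  by (simp_all add: op_cat_def Mor_def src_def tgt_def add_def)

lemma cmp_op [simp]: "cmp (op_cat C) f g = cmp C g f"
proof -
  have "opair (opair f g) h \<in> elts (comps (op_cat C)) \<longleftrightarrow> opair (opair g f) h \<in> elts (comps C)" for h
    by (auto simp: op_cat_def op_comps simp flip: triple_def)
  then show ?thesis by (simp add: cmp_def app_def)
qed

lemma Hom_op [simp]: "Hom (op_cat C) X Y = Hom C Y X"
  and mono_op [simp]: "mono_in (op_cat C) = epi_in C"
  and epi_op [simp]: "epi_in (op_cat C) = mono_in C"
  by (auto simp: Hom_def mono_in_def epi_in_def fun_eq_iff)

lemma zero_mor_op [simp]: "zero_mor (op_cat C) = zero_mor C"
  by (auto simp: zero_mor_def fun_eq_iff)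

lemma kernel_op [simp]: "is_kernel (op_cat C) k f = is_cokernel C k f"
  and cokernel_op [simp]: "is_cokernel (op_cat C) k f = is_kernel C k f"
  by (simp_all add: is_kernel_def is_cokernel_def)

text \<open>An object is recognised by its source in \<open>C\<close> but by its target in
  \<open>op_cat C\<close>; by \<open>ax_src_tgt\<close> the two tests agree.\<close>

lemma (in abelian_cat) Ob_op [simp]: "Ob (op_cat C) = Ob C"
  unfolding Ob_def using ax_src_tgt by auto

lemma (in abelian_cat) zero_object_op [simp]: "zero_object (op_cat C) = zero_object C"
  by (simp add: fun_eq_iff zero_object_def conj_commute)

text \<open>The dual lemmas below are instances of this locale at \<open>op_cat C\<close>, with the
  simp rules above translating them back.\<close>

lemma (in abelian_cat) abelian_cat_op: "abelian_cat (op_cat C)"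
  by unfold_locales (use ax_zero_object ax_src_tgt ax_cmp ax_unit ax_assoc ax_add ax_add_assoc
    ax_zero ax_neg ax_distr ax_distl ax_kernels ax_mono ax_epi in auto)

text \<open>The choice refers only to \<open>Hom\<close> and \<open>zero_mor\<close>, so a category
  and its opposite pick the same morphism and \<open>zer_op\<close> is an equation on the
  nose.\<close>

definition zer :: "('u::set_universe, 'b) add_cat_scheme \<Rightarrow> 'u \<Rightarrow> 'u \<Rightarrow> 'u" where
  "zer C X Y = (SOME z. z \<in> Hom C X Y \<and> zero_mor C z)"

lemma zer_op [simp]: "zer (op_cat C) X Y = zer C Y X"
  by (simp add: zer_def)

lemma HomI: "f \<in> Mor C \<Longrightarrow> f \<in> Hom C (src C f) (tgt C f)"
  by (simp add: Hom_def)

lemma HomD: "f \<in> Hom C X Y \<Longrightarrow> f \<in> Mor C" "f \<in> Hom C X Y \<Longrightarrow> src C f = X" "f \<in> Hom C X Y \<Longrightarrow> tgt C f = Y"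
  by (simp_all add: Hom_def)

section \<open>Arithmetic of morphisms, monomorphisms and epimorphisms\<close>

context abelian_cat
begin

lemma Hom_Ob: "f \<in> Hom C X Y \<Longrightarrow> X \<in> Ob C" "f \<in> Hom C X Y \<Longrightarrow> Y \<in> Ob C"
  using ax_src_tgt by (auto simp: Hom_def Ob_def)

lemma Mor_Ob: "f \<in> Mor C \<Longrightarrow> src C f \<in> Ob C" "f \<in> Mor C \<Longrightarrow> tgt C f \<in> Ob C"
  using Hom_Ob[OF HomI] by auto

lemma Ob_Mor: "X \<in> Ob C \<Longrightarrow> X \<in> Mor C" "X \<in> Ob C \<Longrightarrow> src C X = X" "X \<in> Ob C \<Longrightarrow> tgt C X = X"
proof -
  assume X: "X \<in> Ob C"
  then show "X \<in> Mor C" and s: "src C X = X" by (simp_all add: Ob_def)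
  with ax_src_tgt show "tgt C X = X" by metis
qed

lemma id_Hom: "X \<in> Ob C \<Longrightarrow> X \<in> Hom C X X"
  by (simp add: Hom_def Ob_Mor)

lemma cmp_Hom: "f \<in> Hom C Y Z \<Longrightarrow> g \<in> Hom C X Y \<Longrightarrow> cmp C f g \<in> Hom C X Z"
  using ax_cmp by (simp add: Hom_def)

lemma cmp_assoc: "f \<in> Hom C Y Z \<Longrightarrow> g \<in> Hom C X Y \<Longrightarrow> h \<in> Hom C W X \<Longrightarrow>
   cmp C (cmp C f g) h = cmp C f (cmp C g h)"
  using ax_assoc by (simp add: Hom_def)

lemma id_left: "f \<in> Hom C X Y \<Longrightarrow> cmp C Y f = f"
  and id_right: "f \<in> Hom C X Y \<Longrightarrow> cmp C f X = f"
  using ax_unit by (auto simp: Hom_def)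

lemma add_Hom: "f \<in> Hom C X Y \<Longrightarrow> g \<in> Hom C X Y \<Longrightarrow> add C f g \<in> Hom C X Y"
  using ax_add unfolding Hom_def mem_Collect_eq by metis

lemma add_comm: "f \<in> Hom C X Y \<Longrightarrow> g \<in> Hom C X Y \<Longrightarrow> add C f g = add C g f"
  using ax_add unfolding Hom_def mem_Collect_eq by metis

lemma add_assoc: "f \<in> Hom C X Y \<Longrightarrow> g \<in> Hom C X Y \<Longrightarrow> h \<in> Hom C X Y \<Longrightarrow>
   add C (add C f g) h = add C f (add C g h)"
  using ax_add_assoc unfolding Hom_def mem_Collect_eq by metis

lemma distr: "f \<in> Hom C X Y \<Longrightarrow> g \<in> Hom C X Y \<Longrightarrow> h \<in> Hom C W X \<Longrightarrow>
   cmp C (add C f g) h = add C (cmp C f h) (cmp C g h)"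
  using ax_distr unfolding Hom_def mem_Collect_eq by metis

lemma distl: "f \<in> Hom C X Y \<Longrightarrow> g \<in> Hom C X Y \<Longrightarrow> h \<in> Hom C Y Z \<Longrightarrow>
   cmp C h (add C f g) = add C (cmp C h f) (cmp C h g)"
  using ax_distl unfolding Hom_def mem_Collect_eq by metis

lemma zer: 
  assumes "X \<in> Ob C" "Y \<in> Ob C"
  shows zer_Hom: "zer C X Y \<in> Hom C X Y" and zero_mor_zer: "zero_mor C (zer C X Y)"
proof -
  have "\<exists>z. z \<in> Hom C X Y \<and> zero_mor C z"
    using ax_zero Ob_Mor[OF assms(1)] Ob_Mor[OF assms(2)] by metis
  from someI_ex[OF this] show "zer C X Y \<in> Hom C X Y" "zero_mor C (zer C X Y)"
    unfolding zer_def by blast+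
qed

lemma zero_mor_iff: assumes "f \<in> Hom C X Y" shows "zero_mor C f \<longleftrightarrow> f = zer C X Y"
proof
  assume f: "zero_mor C f"
  note z = zer[OF Hom_Ob[OF assms]]
  have "add C f (zer C X Y) = zer C X Y" using f z(1) HomD[OF assms] by (simp add: zero_mor_def)
  moreover have "add C f (zer C X Y) = f" using z HomD[OF z(1)] assms by (simp add: zero_mor_def)
  ultimately show "f = zer C X Y" by simp
qed (use zero_mor_zer Hom_Ob[OF assms] in simp)

lemma add_zer: assumes "f \<in> Hom C X Y" shows "add C f (zer C X Y) = f" "add C (zer C X Y) f = f"
  using zero_mor_zer[OF Hom_Ob[OF assms]] HomD[OF zer_Hom[OF Hom_Ob[OF assms]]] assms 
  by (simp_all add: zero_mor_def)

lemma ex_neg: assumes "f \<in> Hom C X Y" shows "\<exists>g\<in>Hom C X Y. add C f g = zer C X Y"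
  using ax_neg zero_mor_iff add_Hom HomD[OF assms] assms by metis

text \<open>Serves to show that composites with zero vanish: by distributivity such a composite
  equals its own double.\<close>

lemma add_idem: assumes "f \<in> Hom C X Y" "add C f f = f" shows "f = zer C X Y"
proof -
  obtain g where "g \<in> Hom C X Y" "add C f g = zer C X Y" using ex_neg[OF assms(1)] by blast
  then show ?thesis using add_assoc[OF assms(1) assms(1), of g] assms add_zer by metis
qed

lemma cmp_zer: 
  assumes "f \<in> Hom C Y Z"
  shows "X \<in> Ob C \<Longrightarrow> cmp C f (zer C X Y) = zer C X Z"
    and "W \<in> Ob C \<Longrightarrow> cmp C (zer C Z W) f = zer C Y W"
proof -
  assume X: "X \<in> Ob C"
  note z = zer_Hom[OF X Hom_Ob(1)[OF assms]]
  show "cmp C f (zer C X Y) = zer C X Z"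
    by (rule add_idem[OF cmp_Hom[OF assms z]]) (simp add: add_zer[OF z] distl[OF z z assms, symmetric])
next
  assume W: "W \<in> Ob C"
  note z = zer_Hom[OF Hom_Ob(2)[OF assms] W]
  show "cmp C (zer C Z W) f = zer C Y W"
    by (rule add_idem[OF cmp_Hom[OF z assms]]) (simp add: add_zer[OF z] distr[OF z z assms, symmetric])
qed

text \<open>Subtraction: \<open>d\<close> is \<open>f\<close> minus \<open>g\<close>. The last two
  clauses turn agreement after composition into vanishing, so that questions of equality reduce to
  questions about zero.\<close>

lemma ex_diff: 
  assumes "f \<in> Hom C X Y" "g \<in> Hom C X Y"
  obtains d where "d \<in> Hom C X Y" "f = add C g d" "d = zer C X Y \<longleftrightarrow> f = g"
    "\<And>h Z. h \<in> Hom C Y Z \<Longrightarrow> cmp C h f = cmp C h g \<Longrightarrow> cmp C h d = zer C X Z"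
    "\<And>h W. h \<in> Hom C W X \<Longrightarrow> cmp C f h = cmp C g h \<Longrightarrow> cmp C d h = zer C W Y"
proof -
  obtain n where n: "n \<in> Hom C X Y" "add C g n = zer C X Y" using ex_neg[OF assms(2)] by blast
  let ?d = "add C n f"
  have d: "?d \<in> Hom C X Y" using n assms add_Hom by blast
  have fd: "f = add C g ?d"
    using add_assoc[OF assms(2) n(1) assms(1)] n(2) add_zer(2)[OF assms(1)] by simp
  have ng: "add C n g = zer C X Y" using add_comm n assms by metis
  have 0: "?d = zer C X Y \<longleftrightarrow> f = g"
    using fd ng add_zer(1)[OF assms(2)] by metis
  have l: "cmp C h ?d = zer C X Z" if "h \<in> Hom C Y Z" "cmp C h f = cmp C h g" for h Z
  proof -
    have "cmp C h ?d = cmp C h (add C n g)"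
      using that distl[OF n(1) assms(1) that(1)] distl[OF n(1) assms(2) that(1)] by simp
    then show ?thesis using ng cmp_zer(1)[OF that(1) Hom_Ob(1)[OF assms(1)]] by simp
  qed
  have r: "cmp C ?d h = zer C W Y" if "h \<in> Hom C W X" "cmp C f h = cmp C g h" for h W
  proof -
    have "cmp C ?d h = cmp C (add C n g) h"
      using that distr[OF n(1) assms(1) that(1)] distr[OF n(1) assms(2) that(1)] by simp
    then show ?thesis using ng cmp_zer(2)[OF that(1) Hom_Ob(2)[OF assms(1)]] by simp
  qed
  show ?thesis by (rule that[OF d fd 0 l r])
qed

lemma monoI:
  assumes "m \<in> Hom C X Y" "\<And>W x. x \<in> Hom C W X \<Longrightarrow> cmp C m x = zer C W Y \<Longrightarrow> x = zer C W X"
  shows "mono_in C m"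
  unfolding mono_in_def
proof (intro conjI ballI impI)
  fix f g assume fg: "f \<in> Mor C" "g \<in> Mor C" "src C f = src C g \<and> tgt C f = src C m \<and> tgt C g = src C m
        \<and> cmp C m f = cmp C m g"
  then have "f \<in> Hom C (src C f) X" "g \<in> Hom C (src C f) X" using HomD[OF assms(1)] by (simp_all add: Hom_def)
  from ex_diff[OF this] show "f = g" using assms fg by metis
qed (use HomD[OF assms(1)] in simp)

lemma monoD:
  assumes "mono_in C m" "m \<in> Hom C X Y" "x \<in> Hom C W X" "x' \<in> Hom C W X" "cmp C m x = cmp C m x'"
  shows "x = x'"
  using assms(1)[unfolded mono_in_def] assms(5) HomD[OF assms(2)] HomD[OF assms(3)]
    HomD[OF assms(4)] by metis

lemma mono_zer:
  assumes "mono_in C m" "m \<in> Hom C X Y" "x \<in> Hom C W X" "cmp C m x = zer C W Y"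
  shows "x = zer C W X"
  using monoD[OF assms(1-3) zer_Hom] assms(4) cmp_zer[OF assms(2)] Hom_Ob[OF assms(3)] by simp

lemmas epiI = abelian_cat.monoI[OF abelian_cat_op, simplified]
lemmas epiD = abelian_cat.monoD[OF abelian_cat_op, simplified]

lemma mono_cmp:
  assumes "mono_in C m" "mono_in C n" "m \<in> Hom C X Y" "n \<in> Hom C Y Z"
  shows "mono_in C (cmp C n m)"
proof (rule monoI[OF cmp_Hom[OF assms(4,3)]])
  fix W x assume x: "x \<in> Hom C W X" "cmp C (cmp C n m) x = zer C W Z"
  then have "cmp C n (cmp C m x) = zer C W Z" using cmp_assoc[OF assms(4,3) x(1)] by simp
  then have "cmp C m x = zer C W Y" by (rule mono_zer[OF assms(2,4) cmp_Hom[OF assms(3) x(1)]])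
  then show "x = zer C W X" by (rule mono_zer[OF assms(1,3) x(1)])
qed

section \<open>Kernels, cokernels and exact pairs\<close>

lemma kernel_Hom: "is_kernel C k f \<Longrightarrow> f \<in> Hom C X Y \<Longrightarrow> k \<in> Hom C (src C k) X"
  by (auto simp: is_kernel_def Hom_def)

text \<open>Trades uniqueness of the factorization for monicity, and \<open>zero_mor\<close> for the
  explicit \<open>zer\<close>, with all objects named. The dual form serves for cokernels.\<close>

lemma is_kernel_iff:
  assumes k: "k \<in> Hom C K X" and f: "f \<in> Hom C X Y"
  shows "is_kernel C k f \<longleftrightarrow> cmp C f k = zer C K Y \<and> mono_in C k
    \<and> (\<forall>W g. g \<in> Hom C W X \<longrightarrow> cmp C f g = zer C W Y \<longrightarrow> (\<exists>u\<in>Hom C W K. cmp C k u = g))"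
    (is "_ \<longleftrightarrow> ?R")
proof
  assume *: "is_kernel C k f"
  have 0: "cmp C f k = zer C K Y"
    using * zero_mor_iff[OF cmp_Hom[OF f k]] by (simp add: is_kernel_def)
  have u: "\<exists>!u. u \<in> Hom C W K \<and> cmp C k u = g" if "g \<in> Hom C W X" "cmp C f g = zer C W Y" for W g
    using * that zero_mor_iff[OF cmp_Hom[OF f that(1)]] HomD[OF k] HomD[OF f] HomD[OF that(1)]
    unfolding is_kernel_def by metis
  have "mono_in C k"
  proof (rule monoI[OF k])
    fix W x assume x: "x \<in> Hom C W K" "cmp C k x = zer C W X"
    note W = Hom_Ob[OF x(1)] and X = Hom_Ob[OF f]
    \<comment> \<open>Uniqueness is applied to the zero morphism into \<open>X\<close>: both
      \<open>x\<close> and the zero morphism into \<open>K\<close> factor it through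
      \<open>k\<close>.\<close>
    have "cmp C k (zer C W K) = zer C W X" using cmp_zer(1)[OF k W(1)] .
    with x u[OF zer_Hom[OF W(1) X(1)]] cmp_zer(1)[OF f W(1)] zer_Hom[OF W]
    show "x = zer C W K" by metis
  qed
  with 0 u show ?R by (metis (no_types, lifting))
next
  assume *: ?R
  have "\<exists>!u. u \<in> Hom C (src C g) (src C k) \<and> cmp C k u = g"
    if "g \<in> Mor C" "tgt C g = src C f \<and> zero_mor C (cmp C f g)" for g
  proof -
    have g: "g \<in> Hom C (src C g) X" using that HomD[OF f] by (simp add: Hom_def)
    then have "cmp C f g = zer C (src C g) Y" using that zero_mor_iff[OF cmp_Hom[OF f g]] by simp
    with * g obtain u where "u \<in> Hom C (src C g) K" "cmp C k u = g" by blast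
    then show ?thesis using HomD[OF k] monoD[OF _ k] * by (intro ex1I[of _ u]) auto
  qed
  then show "is_kernel C k f"
    using * HomD[OF k] HomD[OF f] zero_mor_iff[OF cmp_Hom[OF f k]] by (simp add: is_kernel_def)
qed

lemma ex_kernel:
  assumes "f \<in> Hom C X Y"
  obtains k K where "k \<in> Hom C K X" "is_kernel C k f"
  using ax_kernels kernel_Hom[OF _ assms] HomD(1)[OF assms] by metis

lemmas cokernel_Hom = abelian_cat.kernel_Hom[OF abelian_cat_op, simplified]
lemmas is_cokernel_iff = abelian_cat.is_kernel_iff[OF abelian_cat_op, simplified]
lemmas ex_cokernel = abelian_cat.ex_kernel[OF abelian_cat_op, simplified]

text \<open>By the axiom on epimorphisms \<open>q\<close> is a cokernel of some \<open>f\<close>.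
  This \<open>f\<close> factors through \<open>k\<close>, so whatever kills \<open>k\<close> kills
  \<open>f\<close> and hence factors through \<open>q\<close>.\<close>

lemma epi_is_cokernel:
  assumes "epi_in C q" "q \<in> Hom C X Q" "k \<in> Hom C K X" "is_kernel C k q"
  shows "is_cokernel C q k"
proof -
  obtain f where f: "is_cokernel C q f" using ax_epi assms HomD by metis
  then have fH: "f \<in> Hom C (src C f) X"
    using assms(2) by (auto simp: is_cokernel_def Hom_def)
  note kD = assms(4)[unfolded is_kernel_iff[OF assms(3,2)]]
  note fD = f[unfolded is_cokernel_iff[OF assms(2) fH]]
  obtain u where u: "u \<in> Hom C (src C f) K" "cmp C k u = f" using kD fD fH by blast
  have "\<exists>u\<in>Hom C Q W. cmp C u q = g" if g: "g \<in> Hom C X W" "cmp C g k = zer C K W" for W g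
  proof -
    have "cmp C g f = cmp C (cmp C g k) u" using cmp_assoc[OF g(1) assms(3) u(1)] u(2) by simp
    also have "\<dots> = zer C (src C f) W" using g cmp_zer(2)[OF u(1)] Hom_Ob[OF g(1)] by simp
    finally show ?thesis using fD g by blast
  qed
  then show ?thesis using kD assms by (simp add: is_cokernel_iff[OF assms(2,3)])
qed

lemmas mono_is_kernel = abelian_cat.epi_is_cokernel[OF abelian_cat_op, simplified]

text \<open>The last conclusion restores the symmetry that the definition of \<open>exact\<close>
  lacks: \<open>q\<close> is a cokernel of both \<open>a\<close> and \<open>k\<close>, and
  \<open>k\<close> is a kernel of both \<open>q\<close> and \<open>b\<close>.\<close>

lemma exactE:
  assumes "exact C a b" "a \<in> Hom C W X" "b \<in> Hom C X Y"
  obtains q Q k K where "q \<in> Hom C X Q" "k \<in> Hom C K X" "is_cokernel C q a" "is_kernel C k q"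
    "is_kernel C k b" "is_cokernel C q k"
proof -
  obtain q k where *: "is_cokernel C q a" "is_kernel C k q" "is_kernel C k b"
    using assms(1) by (auto simp: exact_def)
  note H = cokernel_Hom[OF *(1) assms(2)] kernel_Hom[OF *(3) assms(3)]
  have "epi_in C q" using *(1) is_cokernel_iff[OF H(1) assms(2)] by simp
  from that[OF H * epi_is_cokernel[OF this H *(2)]] show ?thesis .
qed

lemma exact_op: "exact (op_cat C) b a \<longleftrightarrow> exact C a b"
proof
  assume *: "exact C a b"
  then have "a \<in> Mor C" "b \<in> Mor C" "tgt C a = src C b"
    unfolding exact_def is_kernel_def is_cokernel_def by (metis (no_types))+
  then have "a \<in> Hom C (src C a) (src C b)" "b \<in> Hom C (src C b) (tgt C b)" by (simp_all add: Hom_def)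
  from exactE[OF * this] show "exact (op_cat C) b a" unfolding exact_def by (metis kernel_op cokernel_op)
next
  assume "exact (op_cat C) b a"
  then obtain q k where *: "is_cokernel C q a" "is_cokernel C q k" "is_kernel C k b"
    by (auto simp: exact_def)
  then have "k \<in> Mor C" "q \<in> Mor C" "src C q = tgt C k" 
    unfolding is_kernel_def is_cokernel_def by (metis (no_types))+
  then have H: "q \<in> Hom C (tgt C k) (tgt C q)" "k \<in> Hom C (src C k) (tgt C k)" by (simp_all add: Hom_def)
  have "b \<in> Mor C" "src C b = tgt C k" using *(3) by (auto simp: is_kernel_def)
  then have bH: "b \<in> Hom C (tgt C k) (tgt C b)" by (simp add: Hom_def)
  have "mono_in C k" using *(3) is_kernel_iff[OF H(2) bH] by simp
  from mono_is_kernel[OF this H(2,1) *(2)] * show "exact C a b" unfolding exact_def by blast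
qed

lemma exact_zer:
  assumes "exact C a b" "a \<in> Hom C W X" "b \<in> Hom C X Y"
  shows "cmp C b a = zer C W Y"
proof -
  obtain q Q k K where *: "q \<in> Hom C X Q" "k \<in> Hom C K X" "is_cokernel C q a" "is_kernel C k q"
    "is_kernel C k b" using exactE[OF assms] by metis
  obtain u where u: "u \<in> Hom C W K" "cmp C k u = a"
    using *(3)[unfolded is_cokernel_iff[OF *(1) assms(2)]] *(4)[unfolded is_kernel_iff[OF *(2,1)]]
      assms(2) by metis
  have "cmp C b a = cmp C (cmp C b k) u" using cmp_assoc[OF assms(3) *(2) u(1)] u by simp
  also have "\<dots> = zer C W Y" 
    using *(5)[unfolded is_kernel_iff[OF *(2) assms(3)]] cmp_zer(2)[OF u(1)] Hom_Ob[OF assms(3)] by simp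
  finally show ?thesis .
qed

text \<open>Here \<open>q\<close> is the coimage of the composite of \<open>b'\<close> and
  \<open>q\<close>. If \<open>b'\<close> kills \<open>x\<close>, then the cokernel \<open>c\<close>
  of \<open>x\<close> turns out to have a left inverse, which forces \<open>x\<close> to be
  zero.\<close>

lemma coimage_mono:
  assumes k: "k \<in> Hom C K X" and q: "q \<in> Hom C X Q" and b': "b' \<in> Hom C Q Y"
    and ker: "is_kernel C k (cmp C b' q)" and coker: "is_cokernel C q k"
  shows "mono_in C b'"
proof (rule monoI[OF b'])
  fix W x assume x: "x \<in> Hom C W Q" "cmp C b' x = zer C W Y"
  obtain c P where c: "c \<in> Hom C Q P" "is_cokernel C c x" using ex_cokernel[OF x(1)] .
  note cD = c(2)[unfolded is_cokernel_iff[OF c(1) x(1)]]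
    and qD = coker[unfolded is_cokernel_iff[OF q k]]
    and kD = ker[unfolded is_kernel_iff[OF k cmp_Hom[OF b' q]]]
  note cq = cmp_Hom[OF c(1) q]
  obtain d where d: "d \<in> Hom C P Y" "cmp C d c = b'" using cD x b' by blast
  \<comment> \<open>The composite of \<open>c\<close> and \<open>q\<close> is epi, hence a cokernel
    of its own kernel \<open>w\<close>.\<close>
  have epi: "epi_in C (cmp C c q)"
    using abelian_cat.mono_cmp[OF abelian_cat_op, simplified] cD qD c(1) q by blast
  obtain w V where w: "w \<in> Hom C V X" "is_kernel C w (cmp C c q)" using ex_kernel[OF cq] .
  note wD = w(2)[unfolded is_kernel_iff[OF w(1) cq]]
  have V: "V \<in> Ob C" and Y: "Y \<in> Ob C" using w b' Hom_Ob by blast+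
  \<comment> \<open>The composite of \<open>b'\<close> and \<open>q\<close> kills \<open>w\<close>,
    so \<open>w\<close> factors through \<open>k\<close> and is killed by \<open>q\<close>. Hence
    \<open>q\<close> factors through its own composite with \<open>c\<close>, and the factor
    \<open>j\<close> is the left inverse of \<open>c\<close>.\<close>
  have "cmp C (cmp C b' q) w = cmp C d (cmp C (cmp C c q) w)"
    using d cmp_assoc[OF d(1) c(1) q] cmp_assoc[OF d(1) cq w(1)] by simp
  also have "\<dots> = zer C V Y" using wD cmp_zer(1)[OF d(1) V] by simp
  finally obtain w' where w': "w' \<in> Hom C V K" "cmp C k w' = w" using kD w(1) by blast
  have "cmp C q w = cmp C (cmp C q k) w'" using cmp_assoc[OF q k w'(1)] w' by simp
  also have "\<dots> = zer C V Q" using qD cmp_zer(2)[OF w'(1)] Hom_Ob[OF b'] by simp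
  finally obtain j where j: "j \<in> Hom C P Q" "cmp C j (cmp C c q) = q"
    using epi_is_cokernel[OF epi cq w(1,2), unfolded is_cokernel_iff[OF cq w(1)]] q by blast
  note Q = id_Hom[OF Hom_Ob(1)[OF b']]
  have "cmp C (cmp C j c) q = cmp C Q q"
    using j cmp_assoc[OF j(1) c(1) q] id_left[OF q] by simp
  then have jc: "cmp C j c = Q" using epiD[OF _ q cmp_Hom[OF j(1) c(1)] Q] qD by simp
  have "x = cmp C j (cmp C c x)" using jc cmp_assoc[OF j(1) c(1) x(1)] id_left[OF x(1)] by simp
  then show "x = zer C W Q" using cD cmp_zer(1)[OF j(1) Hom_Ob(1)[OF x(1)]] by simp
qed

section \<open>Extending morphisms into injective objects\<close>

lemma injective_extend:
  assumes "injective_object C J" "mono_in C m" "m \<in> Hom C X Y" "f \<in> Hom C X J"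
  obtains g where "g \<in> Hom C Y J" "cmp C g m = f"
  using assms HomD[OF assms(3)] unfolding injective_object_def by metis

text \<open>Both \<open>g\<close> and \<open>b\<close> kill \<open>a\<close>, so they descend to the
  cokernel of \<open>a\<close>. The descended \<open>b\<close> is monic by
  \<open>coimage_mono\<close>, and injectivity of \<open>J\<close> extends the descended
  \<open>g\<close> along it.\<close>

lemma exact_extend:
  assumes "exact C a b" "a \<in> Hom C W X" "b \<in> Hom C X Y" "injective_object C J" "g \<in> Hom C X J"
    and "cmp C g a = zer C W J"
  obtains h where "h \<in> Hom C Y J" "cmp C h b = g"
proof -
  obtain q Q k K where *: "q \<in> Hom C X Q" "k \<in> Hom C K X" "is_cokernel C q a" "is_kernel C k q"
    "is_kernel C k b" "is_cokernel C q k" using exactE[OF assms(1-3)] .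
  obtain g' where g': "g' \<in> Hom C Q J" "cmp C g' q = g"
    using *(3)[unfolded is_cokernel_iff[OF *(1) assms(2)]] assms(5,6) by blast
  obtain b' where b': "b' \<in> Hom C Q Y" "cmp C b' q = b"
    using *(3)[unfolded is_cokernel_iff[OF *(1) assms(2)]] assms(3) exact_zer[OF assms(1-3)] by blast
  have "mono_in C b'" by (rule coimage_mono[OF *(2,1) b'(1) _ *(6)]) (simp add: b' *)
  then obtain h where h: "h \<in> Hom C Y J" "cmp C h b' = g'"
    using injective_extend[OF assms(4) _ b'(1) g'(1)] by blast
  have "cmp C h b = g" using cmp_assoc[OF h(1) b'(1) *(1)] h b' g' by simp
  with h(1) show ?thesis by (rule that)
qed

lemma exact_extend_diff:
  assumes "exact C a b" "a \<in> Hom C W X" "b \<in> Hom C X Y" "injective_object C J"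
    and "f \<in> Hom C X J" "g \<in> Hom C X J" "cmp C f a = cmp C g a"
  obtains h where "h \<in> Hom C Y J" "f = add C g (cmp C h b)"
proof -
  obtain d where d: "d \<in> Hom C X J" "f = add C g d" "cmp C d a = zer C W J"
    using ex_diff[OF assms(5,6)] assms(2,7) by metis
  obtain h where "h \<in> Hom C Y J" "cmp C h b = d" using exact_extend[OF assms(1-4) d(1,3)] .
  with d show ?thesis using that by simp
qed

text \<open>Produces the next differential of a resolution: the cokernel of the last one, embedded
  into an injective object. Composing with a monomorphism leaves the kernel unchanged.\<close>

lemma exact_cokernel_mono:
  assumes "a \<in> Hom C W X" "q \<in> Hom C X Q" "is_cokernel C q a" "m \<in> Hom C Q Y" "mono_in C m"
  shows "exact C a (cmp C m q)"
proof -
  obtain k K where k: "k \<in> Hom C K X" "is_kernel C k q" using ex_kernel[OF assms(2)] .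
  note kD = k(2)[unfolded is_kernel_iff[OF k(1) assms(2)]]
  note mq = cmp_Hom[OF assms(4,2)]
  have "is_kernel C k (cmp C m q)"
    unfolding is_kernel_iff[OF k(1) mq]
  proof (intro conjI allI impI)
    show "cmp C (cmp C m q) k = zer C K Y"
      using kD cmp_assoc[OF assms(4,2) k(1)] cmp_zer(1)[OF assms(4)] Hom_Ob[OF k(1)] by simp
    fix V g assume g: "g \<in> Hom C V X" "cmp C (cmp C m q) g = zer C V Y"
    then have "cmp C m (cmp C q g) = zer C V Y" using cmp_assoc[OF assms(4,2) g(1)] by simp
    then have "cmp C q g = zer C V Q" using mono_zer[OF assms(5,4) cmp_Hom[OF assms(2) g(1)]] by simp
    then show "\<exists>u\<in>Hom C V K. cmp C k u = g" using kD g by blast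
  qed (use kD in simp)
  with k assms show ?thesis unfolding exact_def by blast
qed

end

subsection \<open>Truncated injective resolutions\<close>

text \<open>The augmentation is the entry \<open>e 0\<close> and the differential in degree \<open>n\<close> is \<open>e (Suc n)\<close>, so that
  lifting a morphism starts from its square at index 0 without a separate base case.\<close>

definition inj_res :: "'u::set_universe add_cat \<Rightarrow> nat \<Rightarrow> (nat \<Rightarrow> 'u) \<Rightarrow> bool" where
  "inj_res C N e \<longleftrightarrow> mono_in C (e 0)
     \<and> (\<forall>n<Suc N. e n \<in> Mor C \<and> injective_object C (tgt C (e n)))
     \<and> (\<forall>n<N. tgt C (e n) = src C (e (Suc n)) \<and> exact C (e n) (e (Suc n)))"

text \<open>The strict bounds here and in \<open>inj_res\<close> have the shape that
  \<open>tr_all_less\<close> unrolls into a finite conjunction. Both sequences start with the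
  augmentation, so \<open>\<psi> 0\<close> is the morphism being lifted.\<close>

definition res_lift :: "'u::set_universe add_cat \<Rightarrow> nat \<Rightarrow> (nat \<Rightarrow> 'u) \<Rightarrow> (nat \<Rightarrow> 'u) \<Rightarrow> (nat \<Rightarrow> 'u) \<Rightarrow> bool"
  where "res_lift C N e e' \<psi> \<longleftrightarrow> (\<forall>n<Suc N. \<psi> n \<in> Hom C (src C (e n)) (src C (e' n)))
     \<and> (\<forall>n<N. cmp C (\<psi> (Suc n)) (e n) = cmp C (e' n) (\<psi> n))"

text \<open>A step changes only the next entry, so entry \<open>k\<close> is final from stage
  \<open>k\<close> on and the diagonal \<open>f k k\<close> is the limit. It inherits
  \<open>P\<close> because, by \<open>local\<close>, the property at \<open>n\<close> looks no
  further than entry \<open>n\<close>.\<close>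

lemma extend_sequence:
  assumes start: "P N e"
    and local: "\<And>n e e'. P n e \<Longrightarrow> (\<And>k. k \<le> n \<Longrightarrow> e' k = e k) \<Longrightarrow> P n e'"
    and step: "\<And>n e. P n e \<Longrightarrow> \<exists>x. P (Suc n) (e(Suc n := x))"
  shows "\<exists>e'. (\<forall>k\<le>N. e' k = e k) \<and> (\<forall>n\<ge>N. P n e')"
proof -
  \<comment> \<open>Stage \<open>n\<close> handles the index \<open>N + n\<close>. The clause for
    \<open>n = 0\<close> pins the starting sequence, whose entries up to \<open>N\<close> must
    survive.\<close>
  let ?Q = "\<lambda>n g. P (N + n) g \<and> (n = 0 \<longrightarrow> g = e)"
  have "\<exists>f. \<forall>n. ?Q n (f n) \<and> (\<exists>x. f (Suc n) = (f n)(Suc (N + n) := x))"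
    by (rule dependent_nat_choice) (use start step in fastforce)+
  then obtain f where f: "\<And>n. ?Q n (f n)" "\<And>n. \<exists>x. f (Suc n) = (f n)(Suc (N + n) := x)" by blast
  have stable: "f m k = f n k" if "n \<le> m" "k \<le> N + n" for m n k
    using that(1)
  proof (induction rule: dec_induct)
    case (step m)
    obtain x where "f (Suc m) = (f m)(Suc (N + m) := x)" using f(2) by blast
    then show ?case using step that(2) by simp
  qed simp
  have diag: "f k k = f n k" if "k \<le> N + n" for k n
    using stable[of k n k] stable[of n k k] that by (cases "k \<le> n") auto
  have "P n (\<lambda>k. f k k)" if "n \<ge> N" for n
    by (rule local[of n "f (n - N)"]) (use f(1)[of "n - N"] diag that in auto)
  moreover have "f k k = e k" if "k \<le> N" for k using diag[of k 0] f(1)[of 0] that by simp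
  ultimately show ?thesis by (intro exI[of _ "\<lambda>k. f k k"]) blast
qed

lemma inj_res_cong: "inj_res C n e \<Longrightarrow> (\<And>k. k \<le> n \<Longrightarrow> e' k = e k) \<Longrightarrow> inj_res C n e'"
  by (simp add: inj_res_def)

lemma inj_res_mono: "inj_res C N e \<Longrightarrow> M \<le> N \<Longrightarrow> inj_res C M e"
  by (simp add: inj_res_def)

lemma res_lift_cong:
  assumes "res_lift C n e e' \<psi>" "\<And>k. k \<le> n \<Longrightarrow> d k = e k" "\<And>k. k \<le> n \<Longrightarrow> d' k = e' k"
    "\<And>k. k \<le> n \<Longrightarrow> \<phi> k = \<psi> k"
  shows "res_lift C n d d' \<phi>"
  using assms by (simp add: res_lift_def)

lemma res_lift_mono: "res_lift C N e e' \<psi> \<Longrightarrow> M \<le> N \<Longrightarrow> res_lift C M e e' \<psi>"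
  by (simp add: res_lift_def)

lemma res_liftD:
  assumes "\<And>N. res_lift C N e e' \<psi>"
  shows "\<psi> n \<in> Hom C (src C (e n)) (src C (e' n))" "cmp C (\<psi> (Suc n)) (e n) = cmp C (e' n) (\<psi> n)"
  using assms[of "Suc n"] by (simp_all add: res_lift_def)

context abelian_cat
begin

lemma injective_op [simp]: "injective_object (op_cat C) = projective_object C"
  by (simp add: injective_object_def projective_object_def fun_eq_iff)

lemma enough_injectives_op [simp]: "enough_injectives (op_cat C) = enough_projectives C"
  by (simp add: enough_injectives_def enough_projectives_def)

lemma inj_resD:
  assumes "\<And>N. inj_res C N e"
  shows "e n \<in> Hom C (src C (e n)) (src C (e (Suc n)))" "exact C (e n) (e (Suc n))"
    "injective_object C (src C (e (Suc n)))" "mono_in C (e 0)"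
proof -
  have *: "mono_in C (e 0)" "e n \<in> Mor C" "injective_object C (tgt C (e n))"
    "tgt C (e n) = src C (e (Suc n))" "exact C (e n) (e (Suc n))"
    using assms[of "Suc n"] lessI[of n] less_SucI[OF lessI[of n]]
    unfolding inj_res_def by blast+
  then show "e n \<in> Hom C (src C (e n)) (src C (e (Suc n)))" by (simp add: Hom_def)
  from * show "exact C (e n) (e (Suc n))" "injective_object C (src C (e (Suc n)))" "mono_in C (e 0)"
    by simp_all
qed

lemma inj_res_start:
  assumes "enough_injectives C" "X \<in> Ob C"
  shows "\<exists>e. inj_res C 0 e \<and> src C (e 0) = X"
proof -
  obtain m where "mono_in C m" "src C m = X" "injective_object C (tgt C m)"
    using assms by (auto simp: enough_injectives_def)
  then show ?thesis by (intro exI[of _ "\<lambda>_. m"]) (auto simp: inj_res_def mono_in_def)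
qed

text \<open>Keeping the given entries is the point: a transferred truncation is continued by new,
  possibly external terms.\<close>

lemma inj_res_extend:
  assumes "enough_injectives C" "inj_res C N e"
  obtains e' where "\<And>k. k \<le> N \<Longrightarrow> e' k = e k" "\<And>M. inj_res C M e'"
proof -
  have "\<exists>x. inj_res C (Suc n) (e(Suc n := x))" if e: "inj_res C n e" for n e
  proof -
    have en: "e n \<in> Hom C (src C (e n)) (tgt C (e n))" using e by (simp add: inj_res_def Hom_def)
    obtain q Q where q: "q \<in> Hom C (tgt C (e n)) Q" "is_cokernel C q (e n)" using ex_cokernel[OF en] .
    obtain m where m: "mono_in C m" "src C m = Q" "injective_object C (tgt C m)"
      using assms(1) Hom_Ob(2)[OF q(1)] by (auto simp: enough_injectives_def)
    have mH: "m \<in> Hom C Q (tgt C m)" using m by (simp add: mono_in_def Hom_def)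
    have x: "cmp C m q \<in> Hom C (tgt C (e n)) (tgt C m)" using cmp_Hom[OF mH q(1)] .
    have "exact C (e n) (cmp C m q)" by (rule exact_cokernel_mono[OF en q mH m(1)])
    with e m x have "inj_res C (Suc n) (e(Suc n := cmp C m q))"
      by (auto simp: inj_res_def less_Suc_eq HomD[OF x])
    then show ?thesis ..
  qed
  note step = this
  have "\<exists>e'. (\<forall>k\<le>N. e' k = e k) \<and> (\<forall>n\<ge>N. inj_res C n e')"
    by (rule extend_sequence[where P = "inj_res C"], rule assms(2), erule inj_res_cong, blast, erule step)
  then obtain e' where e': "\<forall>k\<le>N. e' k = e k" "\<forall>n\<ge>N. inj_res C n e'" by blast
  have "inj_res C M e'" for M using e'(2) inj_res_mono[of C "max M N" e' M] by simp
  with e' show ?thesis using that by blast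
qed

text \<open>The next component has to extend the composite of \<open>e' n\<close> and
  \<open>\<psi> n\<close>. At index 0 it does so along the monic augmentation; later the composite
  kills the preceding differential and \<open>exact_extend\<close> applies.\<close>

lemma res_lift_extend:
  assumes e: "\<And>N. inj_res C N e" and e': "\<And>N. inj_res C N e'" and "res_lift C N e e' \<psi>"
  obtains \<phi> where "\<And>k. k \<le> N \<Longrightarrow> \<phi> k = \<psi> k" "\<And>M. res_lift C M e e' \<phi>"
proof -
  note E = inj_resD[OF e] and E' = inj_resD[OF e']
  have "\<exists>x. res_lift C (Suc n) e e' (\<psi>(Suc n := x))" if l: "res_lift C n e e' \<psi>" for n \<psi>
  proof -
    have pn: "\<psi> n \<in> Hom C (src C (e n)) (src C (e' n))" using l by (simp add: res_lift_def)
    have g: "cmp C (e' n) (\<psi> n) \<in> Hom C (src C (e n)) (src C (e' (Suc n)))" using cmp_Hom[OF E'(1) pn] .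
    have "\<exists>h\<in>Hom C (src C (e (Suc n))) (src C (e' (Suc n))). cmp C h (e n) = cmp C (e' n) (\<psi> n)"
    proof (cases n)
      case 0
      with injective_extend[OF E'(3) E(4) E(1)[of 0]] g show ?thesis by metis
    next
      case (Suc k)
      have pk: "\<psi> k \<in> Hom C (src C (e k)) (src C (e' k))" and
        sq: "cmp C (\<psi> n) (e k) = cmp C (e' k) (\<psi> k)" using l Suc by (auto simp: res_lift_def)
      note ek = E(1)[of k, folded Suc] and ek' = E'(1)[of k, folded Suc]
      have "cmp C (cmp C (e' n) (\<psi> n)) (e k) = cmp C (cmp C (e' n) (e' k)) (\<psi> k)"
        using cmp_assoc[OF E'(1) pn ek] cmp_assoc[OF E'(1) ek' pk] sq by simp
      also have "\<dots> = zer C (src C (e k)) (src C (e' (Suc n)))"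
        using exact_zer[OF E'(2)[of k, folded Suc] ek' E'(1)] cmp_zer(2)[OF pk] Hom_Ob[OF g] by simp
      finally show ?thesis using exact_extend[OF E(2)[of k, folded Suc] ek E(1) E'(3) g] by metis
    qed
    then obtain h where "h \<in> Hom C (src C (e (Suc n))) (src C (e' (Suc n)))"
      "cmp C h (e n) = cmp C (e' n) (\<psi> n)" by blast
    with l have "res_lift C (Suc n) e e' (\<psi>(Suc n := h))" by (auto simp: res_lift_def less_Suc_eq)
    then show ?thesis ..
  qed
  note step = this
  have "\<exists>\<phi>. (\<forall>k\<le>N. \<phi> k = \<psi> k) \<and> (\<forall>n\<ge>N. res_lift C n e e' \<phi>)"
    by (rule extend_sequence[where P = "\<lambda>n. res_lift C n e e'"], rule assms(3),
      erule res_lift_cong[OF _ refl refl], blast, erule step)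
  then obtain \<phi> where p: "\<forall>k\<le>N. \<phi> k = \<psi> k" "\<forall>n\<ge>N. res_lift C n e e' \<phi>" by blast
  have "res_lift C M e e' \<phi>" for M using p(2) res_lift_mono[of C "max M N" e e' \<phi> M] by simp
  with p show ?thesis using that by blast
qed

lemma res_lift_exists:
  assumes e: "\<And>N. inj_res C N e" and e': "\<And>N. inj_res C N e'"
    and f: "f \<in> Hom C (src C (e 0)) (src C (e' 0))"
  obtains \<phi> where "\<phi> 0 = f" "\<And>M. res_lift C M e e' \<phi>"
proof -
  have "res_lift C 0 e e' (\<lambda>_. f)" using f by (simp add: res_lift_def)
  from res_lift_extend[OF e e' this] that show ?thesis by (metis le0)
qed

text \<open>In the last conjunct, the first homotopy component vanishes as it maps into the augmented
  object, on which the two lifts agree.\<close>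

lemma res_lift_homotopy:
  assumes e: "\<And>N. inj_res C N e" and e': "\<And>N. inj_res C N e'"
    and l: "\<And>N. res_lift C N e e' \<phi>" and l': "\<And>N. res_lift C N e e' \<psi>" and "\<phi> 0 = \<psi> 0"
  shows "\<exists>h k. h \<in> Hom C (src C (e (Suc (Suc n)))) (src C (e' (Suc n)))
     \<and> k \<in> Hom C (src C (e (Suc n))) (src C (e' n))
     \<and> \<phi> (Suc n) = add C (\<psi> (Suc n)) (add C (cmp C h (e (Suc n))) (cmp C (e' n) k))
     \<and> (n = 0 \<longrightarrow> zero_mor C k)"
proof (induction n)
  note E = inj_resD[OF e] and E' = inj_resD[OF e'] and L = res_liftD[OF l] and L' = res_liftD[OF l']
  case 0
  have "cmp C (\<phi> (Suc 0)) (e 0) = cmp C (\<psi> (Suc 0)) (e 0)" using L(2) L'(2) assms(5) by simp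
  from exact_extend_diff[OF E(2,1,1) E'(3) L(1) L'(1) this]
  obtain h where h: "h \<in> Hom C (src C (e (Suc (Suc 0)))) (src C (e' (Suc 0)))"
    "\<phi> (Suc 0) = add C (\<psi> (Suc 0)) (cmp C h (e (Suc 0)))" .
  note X = Hom_Ob(1)[OF E(1)[of "Suc 0"]] and Y = Hom_Ob(1)[OF E'(1)[of 0]]
  have "add C (cmp C h (e (Suc 0))) (cmp C (e' 0) (zer C (src C (e (Suc 0))) (src C (e' 0))))
     = cmp C h (e (Suc 0))"
    using cmp_zer(1)[OF E'(1) X] add_zer(1)[OF cmp_Hom[OF h(1) E(1)]] by simp
  with h zer[OF X Y] show ?case
    by (intro exI[of _ h] exI[of _ "zer C (src C (e (Suc 0))) (src C (e' 0))"]) simp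
next
  note E = inj_resD[OF e] and E' = inj_resD[OF e'] and L = res_liftD[OF l] and L' = res_liftD[OF l']
  case (Suc n)
  let ?n = "Suc n" and ?m = "Suc (Suc n)"
  obtain h k where h: "h \<in> Hom C (src C (e ?m)) (src C (e' ?n))"
    and k: "k \<in> Hom C (src C (e ?n)) (src C (e' n))"
    and eq: "\<phi> ?n = add C (\<psi> ?n) (add C (cmp C h (e ?n)) (cmp C (e' n) k))" using Suc.IH by blast
  note he = cmp_Hom[OF h E(1)] and ek = cmp_Hom[OF E'(1) k] and eh = cmp_Hom[OF E'(1) h]
  \<comment> \<open>Consecutive differentials compose to zero, so the old \<open>k\<close> drops out
    once the next differential is applied.\<close>
  have 0: "cmp C (e' ?n) (cmp C (e' n) k) = zer C (src C (e ?n)) (src C (e' ?m))"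
    using cmp_assoc[OF E'(1) E'(1) k] exact_zer[OF E'(2) E'(1) E'(1)]
      cmp_zer(2)[OF k] Hom_Ob[OF E'(1)[of ?n]] by simp
  have "cmp C (\<phi> ?m) (e ?n) = cmp C (e' ?n) (\<phi> ?n)" by (rule L(2))
  also have "\<dots> = add C (cmp C (e' ?n) (\<psi> ?n)) (add C (cmp C (e' ?n) (cmp C h (e ?n)))
      (cmp C (e' ?n) (cmp C (e' n) k)))"
    unfolding eq using distl[OF L'(1) add_Hom[OF he ek] E'(1)] distl[OF he ek E'(1)] by simp
  also have "\<dots> = add C (cmp C (e' ?n) (\<psi> ?n)) (cmp C (e' ?n) (cmp C h (e ?n)))"
    unfolding 0 using add_zer(1)[OF cmp_Hom[OF E'(1) he]] by simp
  also have "\<dots> = cmp C (add C (\<psi> ?m) (cmp C (e' ?n) h)) (e ?n)"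
    using distr[OF L'(1) eh E(1)] cmp_assoc[OF E'(1) h E(1)] L'(2) by simp
  finally obtain h' where h': "h' \<in> Hom C (src C (e (Suc ?m))) (src C (e' ?m))"
    "\<phi> ?m = add C (add C (\<psi> ?m) (cmp C (e' ?n) h)) (cmp C h' (e ?m))"
    using exact_extend_diff[OF E(2,1,1) E'(3) L(1) add_Hom[OF L'(1) eh]] by blast
  note he' = cmp_Hom[OF h'(1) E(1)]
  have "\<phi> ?m = add C (\<psi> ?m) (add C (cmp C h' (e ?m)) (cmp C (e' ?n) h))"
    using h'(2) add_assoc[OF L'(1) eh he'] add_comm[OF eh he'] by simp
  \<comment> \<open>The old \<open>h\<close> takes over the role of \<open>k\<close> in the next
    degree.\<close>
  with h h' show ?case by blast
qed

lemma res_lift_id: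
  assumes e: "\<And>N. inj_res C N e"
  shows "res_lift C N e e (\<lambda>n. src C (e n))"
  unfolding res_lift_def
  using id_Hom[OF Hom_Ob(1)[OF inj_resD(1)[OF e]]] id_left[OF inj_resD(1)[OF e]]
    id_right[OF inj_resD(1)[OF e]] by simp

lemma res_lift_cmp:
  assumes e: "\<And>N. inj_res C N e" and e': "\<And>N. inj_res C N e'" and e'': "\<And>N. inj_res C N e''"
    and l: "\<And>N. res_lift C N e e' \<phi>" and l': "\<And>N. res_lift C N e' e'' \<psi>"
  shows "res_lift C N e e'' (\<lambda>n. cmp C (\<psi> n) (\<phi> n))"
proof -
  note E = inj_resD[OF e] and E' = inj_resD[OF e'] and E'' = inj_resD[OF e'']
    and L = res_liftD[OF l] and L' = res_liftD[OF l']
  have "cmp C (cmp C (\<psi> (Suc n)) (\<phi> (Suc n))) (e n) = cmp C (e'' n) (cmp C (\<psi> n) (\<phi> n))" for n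
    using cmp_assoc[OF L'(1) L(1) E(1)] cmp_assoc[OF L'(1) E'(1) L(1)] L(2) L'(2)
      cmp_assoc[OF E''(1) L'(1) L(1)] by metis
  then show ?thesis using cmp_Hom[OF L'(1) L(1)] by (simp add: res_lift_def)
qed

end

subsection \<open>Maps on homology\<close>

context abelian_cat
begin

lemma homologyE:
  assumes "homology C a a' z q"
  obtains b where "a \<in> Hom C (src C a) (src C a')" "a' \<in> Hom C (src C a') (tgt C a')"
    "z \<in> Hom C (src C z) (src C a')" "q \<in> Hom C (src C z) (tgt C q)" "b \<in> Hom C (src C a) (src C z)"
    "cmp C z b = a" "mono_in C z" "epi_in C q" "cmp C a' z = zer C (src C z) (tgt C a')"
    "cmp C q b = zer C (src C a) (tgt C q)"
    "\<And>W g. g \<in> Hom C W (src C a') \<Longrightarrow> cmp C a' g = zer C W (tgt C a') \<Longrightarrow>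
        \<exists>u\<in>Hom C W (src C z). cmp C z u = g"
    "\<And>W g. g \<in> Hom C (src C z) W \<Longrightarrow> cmp C g b = zer C (src C a) W \<Longrightarrow>
        \<exists>u\<in>Hom C (tgt C q) W. cmp C u q = g"
proof -
  obtain b where b: "is_kernel C z a'" "b \<in> Hom C (src C a) (src C z)" "cmp C z b = a" "is_cokernel C q b"
    using assms by (auto simp: homology_def)
  have a': "a' \<in> Hom C (src C a') (tgt C a')" using kernelM(2)[OF b(1)] by (simp add: Hom_def)
  have q: "q \<in> Hom C (src C z) (tgt C q)" using cokernel_Hom[OF b(4,2)] .
  note z = kernel_Hom[OF b(1) a']
  have a: "a \<in> Hom C (src C a) (src C a')" using cmp_Hom[OF z b(2)] b(3) by simp
  note k = b(1)[unfolded is_kernel_iff[OF z a']] and c = b(4)[unfolded is_cokernel_iff[OF q b(2)]]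
  show ?thesis
    by (rule that[OF a a' z q b(2,3)]) (use k c in blast)+
qed

lemma homology_exists:
  assumes "a \<in> Hom C W X" "a' \<in> Hom C X Y" "cmp C a' a = zer C W Y"
  obtains z q where "homology C a a' z q"
proof -
  obtain z Z where z: "z \<in> Hom C Z X" "is_kernel C z a'" using ex_kernel[OF assms(2)] .
  obtain b where b: "b \<in> Hom C W Z" "cmp C z b = a"
    using z(2)[unfolded is_kernel_iff[OF z(1) assms(2)]] assms by blast
  obtain q Q where "q \<in> Hom C Z Q" "is_cokernel C q b" using ex_cokernel[OF b(1)] .
  with z b HomD[OF assms(1)] HomD[OF z(1)] have "homology C a a' z q" by (auto simp: homology_def)
  then show ?thesis by (rule that)
qed

lemma homology_mapE:
  assumes "homology_map C v z q z' q' h"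
  obtains u where "h \<in> Hom C (tgt C q) (tgt C q')" "u \<in> Hom C (src C z) (src C z')"
    "cmp C z' u = cmp C v z" "cmp C h q = cmp C q' u"
  using assms by (auto simp: homology_map_def)

text \<open>The square with \<open>v1\<close> sends cycles to cycles, the square with
  \<open>v0\<close> boundaries to boundaries. The outer components are arbitrary, so that in degree
  0 a missing neighbour can be a morphism between zero objects.\<close>

lemma homology_map_exists:
  assumes "homology C a a' z q" "homology C c c' y p"
    and v: "v \<in> Hom C (src C a') (src C c')"
    and v0: "v0 \<in> Hom C (src C a) (src C c)" "cmp C v a = cmp C c v0"
    and v1: "v1 \<in> Hom C (tgt C a') (tgt C c')" "cmp C c' v = cmp C v1 a'"
  shows "\<exists>h. homology_map C v z q y p h"
proof -
  obtain b where z: "z \<in> Hom C (src C z) (src C a')" and q: "q \<in> Hom C (src C z) (tgt C q)"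
    and b: "b \<in> Hom C (src C a) (src C z)" "cmp C z b = a"
    and a': "a' \<in> Hom C (src C a') (tgt C a')" "cmp C a' z = zer C (src C z) (tgt C a')"
    and coker: "\<And>W g. g \<in> Hom C (src C z) W \<Longrightarrow> cmp C g b = zer C (src C a) W \<Longrightarrow>
        \<exists>u\<in>Hom C (tgt C q) W. cmp C u q = g"
    using homologyE[OF assms(1)] by metis
  obtain d where y: "y \<in> Hom C (src C y) (src C c')" "mono_in C y" and p: "p \<in> Hom C (src C y) (tgt C p)"
    and d: "d \<in> Hom C (src C c) (src C y)" "cmp C y d = c" "cmp C p d = zer C (src C c) (tgt C p)"
    and c': "c' \<in> Hom C (src C c') (tgt C c')"
    and ker: "\<And>W g. g \<in> Hom C W (src C c') \<Longrightarrow> cmp C c' g = zer C W (tgt C c') \<Longrightarrow>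
        \<exists>u\<in>Hom C W (src C y). cmp C y u = g"
    using homologyE[OF assms(2)] by metis
  have "cmp C c' (cmp C v z) = cmp C v1 (cmp C a' z)"
    using cmp_assoc[OF c' v z] cmp_assoc[OF v1(1) a'(1) z] v1(2) by simp
  also have "\<dots> = zer C (src C z) (tgt C c')"
    using a'(2) cmp_zer(1)[OF v1(1) Hom_Ob(1)[OF z]] by simp
  finally obtain u where u: "u \<in> Hom C (src C z) (src C y)" "cmp C y u = cmp C v z"
    using ker[OF cmp_Hom[OF v z]] by blast
  have "cmp C y (cmp C u b) = cmp C y (cmp C d v0)"
    using cmp_assoc[OF y(1) u(1) b(1)] cmp_assoc[OF v z b(1)] cmp_assoc[OF y(1) d(1) v0(1)] u b d v0
    by simp
  then have ub: "cmp C u b = cmp C d v0"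
    by (rule monoD[OF y(2,1) cmp_Hom[OF u(1) b(1)] cmp_Hom[OF d(1) v0(1)]])
  have "cmp C (cmp C p u) b = zer C (src C a) (tgt C p)"
    using cmp_assoc[OF p u(1) b(1)] cmp_assoc[OF p d(1) v0(1)] ub d(3)
      cmp_zer(2)[OF v0(1) Hom_Ob(2)[OF p]] by simp
  from coker[OF cmp_Hom[OF p u(1)] this] obtain h where "h \<in> Hom C (tgt C q) (tgt C p)"
    "cmp C h q = cmp C p u" by blast
  with u show ?thesis unfolding homology_map_def by blast
qed

text \<open>On cycles, the term through \<open>s\<close> vanishes because \<open>a'\<close> kills
  \<open>z\<close>, and the term through \<open>t\<close> becomes a boundary, which \<open>p\<close>
  kills. As \<open>q\<close> is epi, the induced maps agree.\<close>

lemma homology_map_homotopic: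
  assumes "homology C a a' z q" "homology C c c' y p"
    and v: "v \<in> Hom C (src C a') (src C c')" and w: "w \<in> Hom C (src C a') (src C c')"
    and s: "s \<in> Hom C (tgt C a') (src C c')" and t: "t \<in> Hom C (src C a') (src C c)"
    and vw: "v = add C w (add C (cmp C s a') (cmp C c t))"
    and "homology_map C v z q y p h" "homology_map C w z q y p k"
  shows "h = k"
proof -
  obtain b where z: "z \<in> Hom C (src C z) (src C a')" 
    and q: "q \<in> Hom C (src C z) (tgt C q)" "epi_in C q"
    and a': "a' \<in> Hom C (src C a') (tgt C a')" "cmp C a' z = zer C (src C z) (tgt C a')"
    using homologyE[OF assms(1)] by metis
  obtain d where y: "y \<in> Hom C (src C y) (src C c')" "mono_in C y" and p: "p \<in> Hom C (src C y) (tgt C p)"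
    and d: "d \<in> Hom C (src C c) (src C y)" "cmp C y d = c" "cmp C p d = zer C (src C c) (tgt C p)"
    and c: "c \<in> Hom C (src C c) (src C c')"
    using homologyE[OF assms(2)] by metis
  obtain u where h: "h \<in> Hom C (tgt C q) (tgt C p)" and u: "u \<in> Hom C (src C z) (src C y)"
    "cmp C y u = cmp C v z" "cmp C h q = cmp C p u" using homology_mapE[OF assms(8)] by metis
  obtain u' where k: "k \<in> Hom C (tgt C q) (tgt C p)" and u': "u' \<in> Hom C (src C z) (src C y)"
    "cmp C y u' = cmp C w z" "cmp C k q = cmp C p u'" using homology_mapE[OF assms(9)] by metis
  note tz = cmp_Hom[OF t z] and dt = cmp_Hom[OF d(1) cmp_Hom[OF t z]]
  note sa = cmp_Hom[OF s a'(1)] and ct = cmp_Hom[OF c t]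
  have 0: "cmp C (cmp C s a') z = zer C (src C z) (src C c')"
    using cmp_assoc[OF s a'(1) z] a'(2) cmp_zer(1)[OF s Hom_Ob(1)[OF z]] by simp
  have ctz: "cmp C (cmp C c t) z = cmp C y (cmp C d (cmp C t z))"
    using cmp_assoc[OF c t z] cmp_assoc[OF y(1) d(1) tz] d(2) by simp
  have "cmp C v z = add C (cmp C w z) (cmp C y (cmp C d (cmp C t z)))"
    unfolding vw distr[OF w add_Hom[OF sa ct] z] distr[OF sa ct z] 0 ctz
    using add_zer(2)[OF cmp_Hom[OF y(1) dt]] by simp
  then have "cmp C y u = cmp C y (add C u' (cmp C d (cmp C t z)))"
    using u(2) u'(2) distl[OF u'(1) dt y(1)] by simp
  then have uu: "u = add C u' (cmp C d (cmp C t z))"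
    by (rule monoD[OF y(2,1) u(1) add_Hom[OF u'(1) dt]])
  have "cmp C p (cmp C d (cmp C t z)) = zer C (src C z) (tgt C p)"
    using cmp_assoc[OF p d(1) tz] d(3) cmp_zer(2)[OF tz Hom_Ob(2)[OF p]] by simp
  then have "cmp C h q = cmp C k q"
    using u(3) u'(3) uu distl[OF u'(1) dt p] add_zer(1)[OF cmp_Hom[OF p u'(1)]] by simp
  then show ?thesis by (rule epiD[OF q(2,1) h k])
qed

lemma homology_map_cmp:
  assumes "homology C a a' z q" "homology C c c' y p" "homology C g g' x r"
    and v: "v \<in> Hom C (src C a') (src C c')" and w: "w \<in> Hom C (src C c') (src C g')"
    and "homology_map C v z q y p h" "homology_map C w y p x r k"
  shows "homology_map C (cmp C w v) z q x r (cmp C k h)"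
proof -
  have z: "z \<in> Hom C (src C z) (src C a')" and q: "q \<in> Hom C (src C z) (tgt C q)"
    using homologyE[OF assms(1)] by metis+
  have y: "y \<in> Hom C (src C y) (src C c')" and p: "p \<in> Hom C (src C y) (tgt C p)"
    using homologyE[OF assms(2)] by metis+
  have x: "x \<in> Hom C (src C x) (src C g')" and r: "r \<in> Hom C (src C x) (tgt C r)"
    using homologyE[OF assms(3)] by metis+
  obtain u where h: "h \<in> Hom C (tgt C q) (tgt C p)" and u: "u \<in> Hom C (src C z) (src C y)"
    "cmp C y u = cmp C v z" "cmp C h q = cmp C p u" using homology_mapE[OF assms(6)] by metis
  obtain u' where k: "k \<in> Hom C (tgt C p) (tgt C r)" and u': "u' \<in> Hom C (src C y) (src C x)"
    "cmp C x u' = cmp C w y" "cmp C k p = cmp C r u'" using homology_mapE[OF assms(7)] by metis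
  have "cmp C x (cmp C u' u) = cmp C (cmp C w v) z"
    using cmp_assoc[OF x u'(1) u(1)] cmp_assoc[OF w y u(1)] cmp_assoc[OF w v z] u u' by simp
  moreover have "cmp C (cmp C k h) q = cmp C r (cmp C u' u)"
    using cmp_assoc[OF k h q] cmp_assoc[OF k p u(1)] cmp_assoc[OF r u'(1) u(1)] u u' by simp
  ultimately show ?thesis
    using cmp_Hom[OF k h] cmp_Hom[OF u'(1) u(1)] unfolding homology_map_def by blast
qed

lemma homology_map_id:
  assumes "homology C a a' z q"
  shows "homology_map C (src C a') z q z q (tgt C q)"
proof -
  have z: "z \<in> Hom C (src C z) (src C a')" and q: "q \<in> Hom C (src C z) (tgt C q)"
    using homologyE[OF assms(1)] by metis+
  show ?thesis
    unfolding homology_map_def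
    using id_Hom[OF Hom_Ob(2)[OF q]] id_Hom[OF Hom_Ob(1)[OF z]] id_right[OF z] id_left[OF z]
      id_left[OF q] id_right[OF q] by auto
qed

end

subsection \<open>Functors defined by induced maps\<close>

text \<open>Both kinds of derived functors come from a relation between morphisms and maps on
  homology; functoriality and the comparison isomorphism follow from the properties listed here.
  Objects are their own identities, so in \<open>induced_id\<close> both \<open>X\<close> and
  \<open>tgt B (quo c)\<close> stand for identity morphisms.\<close>

locale derived_system = A: abelian_cat A + B: abelian_cat B
  for A B :: "'u::set_universe add_cat" +
  fixes valid :: "'u \<Rightarrow> 'u choice \<Rightarrow> bool"
    and induced :: "'u \<Rightarrow> 'u choice \<Rightarrow> 'u choice \<Rightarrow> 'u \<Rightarrow> bool"
  assumes valid_exists: "X \<in> Ob A \<Longrightarrow> \<exists>c. valid X c"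
    and induced_Hom: "induced f c c' h \<Longrightarrow> h \<in> Hom B (tgt B (quo c)) (tgt B (quo c'))"
    and induced_exists: "valid X c \<Longrightarrow> valid Y c' \<Longrightarrow> f \<in> Hom A X Y \<Longrightarrow> \<exists>h. induced f c c' h"
    and induced_unique: "valid X c \<Longrightarrow> valid Y c' \<Longrightarrow> f \<in> Hom A X Y \<Longrightarrow>
      induced f c c' h \<Longrightarrow> induced f c c' k \<Longrightarrow> h = k"
    and induced_cmp: "valid X c \<Longrightarrow> valid Y c' \<Longrightarrow> valid Z c'' \<Longrightarrow> f \<in> Hom A X Y \<Longrightarrow> g \<in> Hom A Y Z \<Longrightarrow>
      induced f c c' h \<Longrightarrow> induced g c' c'' k \<Longrightarrow> induced (cmp A g f) c c'' (cmp B k h)"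
    and induced_id: "X \<in> Ob A \<Longrightarrow> valid X c \<Longrightarrow> induced X c c (tgt B (quo c))"
begin

definition derived_by :: "('u \<Rightarrow> 'u choice) \<Rightarrow> 'u \<Rightarrow> bool" where
  "derived_by r R \<longleftrightarrow> is_functor A B R
     \<and> (\<forall>X\<in>Ob A. valid X (r X) \<and> app R X = tgt B (quo (r X)))
     \<and> (\<forall>f\<in>Mor A. induced f (r (src A f)) (r (tgt A f)) (app R f))"

lemma derived_exists: "\<exists>r R. derived_by r R"
proof -
  obtain r where r: "\<And>X. X \<in> Ob A \<Longrightarrow> valid X (r X)" using valid_exists by metis
  have "\<exists>h. induced f (r (src A f)) (r (tgt A f)) h" if "f \<in> Mor A" for f
    using induced_exists[OF r r HomI] A.Mor_Ob that by blast
  then obtain g where g: "\<And>f. f \<in> Mor A \<Longrightarrow> induced f (r (src A f)) (r (tgt A f)) (g f)" by metis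
  note gH = induced_Hom[OF g]
  have gM: "g ` elts (mors A) \<subseteq> elts (mors B)" using gH by (force simp: Hom_def Mor_def)
  obtain R where R: "is_set R" "elts R = (\<lambda>x. opair x (g x)) ` elts (mors A)"
    "\<forall>x\<in>elts (mors A). app R x = g x" using ex_map[OF gM subset_refl] by blast
  have Rg: "app R f = g f" if "f \<in> Mor A" for f using R(3) that by (simp add: Mor_def)
  \<comment> \<open>On an object, \<open>g\<close> returns a map induced by its identity, and
    uniqueness identifies this map with the identity of the homology object.\<close>
  have RX: "app R X = tgt B (quo (r X))" if "X \<in> Ob A" for X
    using induced_unique[OF r r A.id_Hom[OF that] _ induced_id[OF that r]] that g[OF A.Ob_Mor(1)[OF that]]
    by (simp add: Rg A.Ob_Mor)
  have "functor_map A B (app R)"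
    unfolding functor_map_def
  proof (intro conjI ballI impI)
    fix f assume f: "f \<in> Mor A"
    show "app R f \<in> Mor B" "app R (src A f) = src B (app R f)" "app R (tgt A f) = tgt B (app R f)"
      using HomD[OF gH[OF f]] RX A.Mor_Ob[OF f] f by (simp_all add: Rg)
  next
    fix f h assume *: "f \<in> Mor A" "h \<in> Mor A" "src A f = tgt A h"
    have H: "f \<in> Hom A (tgt A h) (tgt A f)" "h \<in> Hom A (src A h) (tgt A h)" using * by (simp_all add: Hom_def)
    note fh = A.cmp_Hom[OF H]
    note ob = r[OF A.Mor_Ob(1)[OF *(2)]] r[OF A.Mor_Ob(2)[OF *(2)]] r[OF A.Mor_Ob(2)[OF *(1)]]
    have "induced (cmp A f h) (r (src A h)) (r (tgt A f)) (cmp B (g f) (g h))"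
      by (rule induced_cmp[OF ob H(2,1)]) (use g[OF *(1)] g[OF *(2)] *(3) in simp_all)
    moreover have "induced (cmp A f h) (r (src A h)) (r (tgt A f)) (g (cmp A f h))"
      using g[OF HomD(1)[OF fh]] HomD[OF fh] by simp
    ultimately show "app R (cmp A f h) = cmp B (app R f) (app R h)"
      using induced_unique[OF ob(1,3) fh] * HomD(1)[OF fh] by (simp add: Rg)
  qed
  with is_mapI[OF R(1,2) gM] have "is_functor A B R" by (simp add: is_functor_def)
  then have "derived_by r R" using r RX g by (simp add: derived_by_def Rg)
  then show ?thesis by blast
qed

text \<open>The comparison and its inverse are both induced by identities. Each equation, for the
  inverse and for naturality, compares two maps induced by the same morphism.\<close>

lemma derived_natural_iso:
  assumes "derived_by r R" "derived_by r' R'"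
  shows "\<exists>\<eta>. natural_iso A B R R' \<eta> \<and> (\<forall>X\<in>Ob A. induced X (r X) (r' X) (\<eta> X))"
proof -
  have v: "valid X (r X)" "app R X = tgt B (quo (r X))" "valid X (r' X)" "app R' X = tgt B (quo (r' X))"
    if "X \<in> Ob A" for X using assms that by (simp_all add: derived_by_def)
  have i: "induced f (r (src A f)) (r (tgt A f)) (app R f)"
    "induced f (r' (src A f)) (r' (tgt A f)) (app R' f)" if "f \<in> Mor A" for f
    using assms that by (simp_all add: derived_by_def)
  obtain \<eta> where \<eta>: "\<And>X. X \<in> Ob A \<Longrightarrow> induced X (r X) (r' X) (\<eta> X)"
    using induced_exists[OF v(1,3) A.id_Hom] by metis
  obtain \<theta> where \<theta>: "\<And>X. X \<in> Ob A \<Longrightarrow> induced X (r' X) (r X) (\<theta> X)"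
    using induced_exists[OF v(3,1) A.id_Hom] by metis
  have \<eta>H: "\<eta> X \<in> Hom B (app R X) (app R' X)" if "X \<in> Ob A" for X
    using induced_Hom[OF \<eta>[OF that]] v that by simp
  have \<theta>H: "\<theta> X \<in> Hom B (app R' X) (app R X)" if "X \<in> Ob A" for X
    using induced_Hom[OF \<theta>[OF that]] v that by simp
  have iso: "iso_in B (\<eta> X)" if X: "X \<in> Ob A" for X
  proof -
    note X1 = A.id_Hom[OF X] and XX = A.id_left[OF A.id_Hom[OF X]]
    have "cmp B (\<theta> X) (\<eta> X) = app R X"
      using induced_unique[OF v(1)[OF X] v(1)[OF X] X1
          induced_cmp[OF v(1)[OF X] v(3)[OF X] v(1)[OF X] X1 X1 \<eta>[OF X] \<theta>[OF X], unfolded XX]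
          induced_id[OF X v(1)[OF X]]] v X by simp
    moreover have "cmp B (\<eta> X) (\<theta> X) = app R' X"
      using induced_unique[OF v(3)[OF X] v(3)[OF X] X1
          induced_cmp[OF v(3)[OF X] v(1)[OF X] v(3)[OF X] X1 X1 \<theta>[OF X] \<eta>[OF X], unfolded XX]
          induced_id[OF X v(3)[OF X]]] v X by simp
    ultimately show ?thesis unfolding iso_in_def using \<theta>H[OF X] HomD[OF \<eta>H[OF X]] by auto
  qed
  have nat: "cmp B (app R' f) (\<eta> (src A f)) = cmp B (\<eta> (tgt A f)) (app R f)" if f: "f \<in> Mor A" for f
  proof -
    note X = A.Mor_Ob(1)[OF f] and Y = A.Mor_Ob(2)[OF f] and fH = HomI[OF f]
    from induced_cmp[OF v(1)[OF X] v(3)[OF X] v(3)[OF Y] A.id_Hom[OF X] fH \<eta>[OF X] i(2)[OF f]]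
      induced_cmp[OF v(1)[OF X] v(1)[OF Y] v(3)[OF Y] fH A.id_Hom[OF Y] i(1)[OF f] \<eta>[OF Y]]
    show ?thesis
      unfolding A.id_left[OF fH] A.id_right[OF fH] by (rule induced_unique[OF v(1)[OF X] v(3)[OF Y] fH])
  qed
  show ?thesis using \<eta>H iso nat \<eta> unfolding natural_iso_def by blast
qed

end

text \<open>Stated for bare \<open>app F\<close>, in bounded form, so that it can be instantiated at
  \<open>F\<close> and, after transfer, at \<open>star F\<close>.\<close>

locale additive_functor_setup = A: abelian_cat A + B: abelian_cat B
  for A B :: "'u::set_universe add_cat" +
  fixes F :: 'u
  assumes functorial: "functor_map A B (app F)"
    and additive: "\<forall>f\<in>Mor A. \<forall>g\<in>Mor A. src A f = src A g \<and> tgt A f = tgt A g \<longrightarrow>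
      app F (add A f g) = add B (app F f) (app F g)"
begin

lemma F_Hom: "f \<in> Hom A X Y \<Longrightarrow> app F f \<in> Hom B (app F X) (app F Y)"
  using functorial unfolding functor_map_def by (simp add: Hom_def) metis

lemma F_cmp: "f \<in> Hom A Y Z \<Longrightarrow> g \<in> Hom A X Y \<Longrightarrow> app F (cmp A f g) = cmp B (app F f) (app F g)"
  using functorial unfolding functor_map_def by (simp add: Hom_def)

lemma F_add: "f \<in> Hom A X Y \<Longrightarrow> g \<in> Hom A X Y \<Longrightarrow> app F (add A f g) = add B (app F f) (app F g)"
  using additive by (simp add: Hom_def)

lemma F_Ob: "X \<in> Ob A \<Longrightarrow> app F X \<in> Ob B"
  using F_Hom[OF A.id_Hom] B.Hom_Ob by blast

lemma F_zer: 
  assumes "X \<in> Ob A" "Y \<in> Ob A"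
  shows "app F (zer A X Y) = zer B (app F X) (app F Y)"
  by (rule B.add_idem[OF F_Hom])
    (simp_all add: A.zer_Hom assms A.add_zer[OF A.zer_Hom] flip: F_add[OF A.zer_Hom A.zer_Hom])

end

subsection \<open>Derived functors\<close>

definition choice_seq :: "'u choice \<Rightarrow> nat \<Rightarrow> 'u" where
  "choice_seq c = case_nat (aug c) (diff c)"

lemma choice_seq_simps [simp]: "choice_seq c 0 = aug c" "choice_seq c (Suc n) = diff c n"
  by (simp_all add: choice_seq_def)

lemma injective_resolution_iff:
  "injective_resolution C X c \<longleftrightarrow> src C (aug c) = X \<and> (\<forall>N. inj_res C N (choice_seq c))"
  (is "?L \<longleftrightarrow> ?R")
proof
  assume ?L
  then have l: "aug c \<in> Mor C" "src C (aug c) = X" "tgt C (aug c) = src C (diff c 0)"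
    "diff c n \<in> Mor C" "tgt C (diff c n) = src C (diff c (Suc n))"
    "injective_object C (src C (diff c n))" "mono_in C (aug c)" "exact C (aug c) (diff c 0)"
    "exact C (diff c n) (diff c (Suc n))" for n
    by (auto simp: injective_resolution_def Hom_def)
  have "choice_seq c n \<in> Mor C" "tgt C (choice_seq c n) = src C (choice_seq c (Suc n))"
    "injective_object C (src C (choice_seq c (Suc n)))"
    "exact C (choice_seq c n) (choice_seq c (Suc n))" for n
    by (cases n; simp add: l)+
  with l show ?R by (simp add: inj_res_def)
next
  assume R: ?R
  have *: "choice_seq c n \<in> Mor C" "injective_object C (tgt C (choice_seq c n))"
    "tgt C (choice_seq c n) = src C (choice_seq c (Suc n))"
    "exact C (choice_seq c n) (choice_seq c (Suc n))" for n
    using conjunct2[OF R, rule_format, of "Suc n"] lessI[of n] less_SucI[OF lessI[of n]]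
    unfolding inj_res_def by blast+
  have "mono_in C (aug c)" using R by (simp add: inj_res_def)
  with R *[of 0] *[of "Suc _"] *(2,3)[of "_"] show ?L
    unfolding injective_resolution_def Hom_def
    by (auto simp: choice_seq_def split: nat.splits)
qed

lemma (in abelian_cat) projective_resolution_iff:
  "projective_resolution C X c \<longleftrightarrow> injective_resolution (op_cat C) X c"
  by (simp add: projective_resolution_def injective_resolution_def exact_op)

lemma injective_lift_iff:
  assumes "f \<in> Hom C (src C (aug c)) (src C (aug c'))"
  shows "injective_lift C f c c' \<phi> \<longleftrightarrow>
    (\<forall>N. res_lift C N (choice_seq c) (choice_seq c') (case_nat f \<phi>))" (is "?L \<longleftrightarrow> ?R")
proof
  assume ?L
  then have l: "\<phi> n \<in> Hom C (src C (diff c n)) (src C (diff c' n))"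
    "cmp C (\<phi> 0) (aug c) = cmp C (aug c') f"
    "cmp C (\<phi> (Suc n)) (diff c n) = cmp C (diff c' n) (\<phi> n)" for n
    by (simp_all add: injective_lift_def)
  have "case_nat f \<phi> n \<in> Hom C (src C (choice_seq c n)) (src C (choice_seq c' n))"
    "cmp C (case_nat f \<phi> (Suc n)) (choice_seq c n) = cmp C (choice_seq c' n) (case_nat f \<phi> n)" for n
    using assms by (cases n; simp add: l)+
  then show ?R by (simp add: res_lift_def)
next
  assume R: ?R
  note D = res_liftD[OF R[rule_format]]
  from D[of 0] D[of "Suc _"] show ?L by (simp add: injective_lift_def)
qed

lemma injective_liftI:
  assumes "\<And>N. res_lift C N (choice_seq c) (choice_seq c') \<psi>" "\<psi> 0 = f"
  shows "injective_lift C f c c' (\<lambda>n. \<psi> (Suc n))"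
proof -
  have "case_nat f (\<lambda>n. \<psi> (Suc n)) = \<psi>" using assms(2) by (auto simp: fun_eq_iff split: nat.splits)
  moreover have "f \<in> Hom C (src C (aug c)) (src C (aug c'))"
    using assms(1)[of 0] assms(2) by (simp add: res_lift_def)
  ultimately show ?thesis using assms(1) by (simp add: injective_lift_iff)
qed

text \<open>Reversing the arrows also exchanges the resolutions: a lift from \<open>c\<close> to
  \<open>c'\<close> becomes one from \<open>c'\<close> to \<open>c\<close>.\<close>

lemma projective_lift_iff: "projective_lift C f c c' \<phi> \<longleftrightarrow> injective_lift (op_cat C) f c' c \<phi>"
  by (auto simp: projective_lift_def injective_lift_def)

context abelian_cat
begin

lemma zero_object_unique:
  assumes "zero_object C Z"
  shows "f \<in> Hom C Z X \<Longrightarrow> g \<in> Hom C Z X \<Longrightarrow> f = g"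
    and "f \<in> Hom C X Z \<Longrightarrow> g \<in> Hom C X Z \<Longrightarrow> f = g"
  using assms Hom_Ob unfolding zero_object_def by metis+

lemma zero_object_exists:
  obtains Z where "zero_object C Z" "Z \<in> Ob C"
  using ax_zero_object by (auto simp: zero_object_def)

end

context additive_functor_setup
begin

text \<open>By the index shift, entry \<open>Suc i\<close> leaves degree \<open>i\<close> and entry
  \<open>i\<close> enters it. In degree 0 the latter would be the augmentation, which is not part of
  the complex; a morphism from a zero object stands in its place.\<close>

lemma cohomologyE:
  assumes "cohomology_at B (\<lambda>n. app F (diff c n)) i z q"
  obtains a where "homology B a (app F (choice_seq c (Suc i))) z q"
    "i = 0 \<Longrightarrow> zero_object B (src B a)" "i > 0 \<Longrightarrow> a = app F (choice_seq c i)"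
  using assms by (cases i) (auto simp: cohomology_at_def)

lemma homologyE:
  assumes "homology_at B (\<lambda>n. app F (diff c n)) i z q"
  obtains a where "homology B (app F (choice_seq c (Suc i))) a z q"
    "i = 0 \<Longrightarrow> zero_object B (tgt B a)" "i > 0 \<Longrightarrow> a = app F (choice_seq c i)"
  using assms by (cases i) (auto simp: homology_at_def)

lemma cohomology_exists:
  assumes "\<And>N. inj_res A N (choice_seq c)"
  shows "\<exists>z q. cohomology_at B (\<lambda>n. app F (diff c n)) i z q"
proof (cases i)
  note E = A.inj_resD[OF assms]
  case 0
  obtain Z where Z: "zero_object B Z" "Z \<in> Ob B" using B.zero_object_exists .
  note d = F_Hom[OF E(1)[of "Suc 0"]]
  note a = B.zer_Hom[OF Z(2) B.Hom_Ob(1)[OF d]]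
  obtain z q where "homology B (zer B Z (app F (src A (choice_seq c (Suc 0)))))
    (app F (choice_seq c (Suc 0))) z q"
    using B.homology_exists[OF a d B.cmp_zer(1)[OF d Z(2)]] .
  with Z 0 HomD[OF a] HomD[OF d] show ?thesis
    by (intro exI[of _ z] exI[of _ q])
      (auto simp: cohomology_at_def intro!: bexI[of _ "zer B Z (app F (src A (diff c 0)))"])
next
  note E = A.inj_resD[OF assms]
  case (Suc j)
  have "cmp B (app F (choice_seq c (Suc (Suc j)))) (app F (choice_seq c (Suc j))) =
    app F (cmp A (choice_seq c (Suc (Suc j))) (choice_seq c (Suc j)))"
    by (rule F_cmp[OF E(1) E(1), symmetric])
  also have "\<dots> = zer B (app F (src A (choice_seq c (Suc j)))) (app F (src A (choice_seq c (Suc (Suc (Suc j))))))"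
    unfolding A.exact_zer[OF E(2) E(1) E(1)]
    by (rule F_zer) (use A.Hom_Ob[OF E(1)] in blast)+
  finally obtain z q where
    "homology B (app F (choice_seq c (Suc j))) (app F (choice_seq c (Suc (Suc j)))) z q"
    by (rule B.homology_exists[OF F_Hom[OF E(1)] F_Hom[OF E(1)]])
  then show ?thesis using Suc by (auto simp: cohomology_at_def)
qed

lemma homology_exists:
  assumes "\<And>N. inj_res (op_cat A) N (choice_seq c)"
  shows "\<exists>z q. homology_at B (\<lambda>n. app F (diff c n)) i z q"
proof (cases i)
  interpret O: abelian_cat "op_cat A" by (rule A.abelian_cat_op)
  note E = O.inj_resD[OF assms, simplified]
  case 0
  obtain Z where Z: "zero_object B Z" "Z \<in> Ob B" using B.zero_object_exists .
  note d = F_Hom[OF E(1)[of "Suc 0"]]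
  note a = B.zer_Hom[OF B.Hom_Ob(2)[OF d] Z(2)]
  obtain z q where "homology B (app F (choice_seq c (Suc 0)))
    (zer B (app F (tgt A (choice_seq c (Suc 0)))) Z) z q"
    using B.homology_exists[OF d a B.cmp_zer(2)[OF d Z(2)]] .
  with Z 0 HomD[OF a] HomD[OF d] show ?thesis
    by (intro exI[of _ z] exI[of _ q])
      (auto simp: homology_at_def intro!: bexI[of _ "zer B (app F (tgt A (diff c 0))) Z"])
next
  interpret O: abelian_cat "op_cat A" by (rule A.abelian_cat_op)
  note E = O.inj_resD[OF assms, simplified]
  case (Suc j)
  have E1: "choice_seq c n \<in> Hom A (tgt A (choice_seq c (Suc n))) (tgt A (choice_seq c n))" for n
    using O.inj_resD(1)[OF assms] by simp
  have E2: "exact A (choice_seq c (Suc n)) (choice_seq c n)" for n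
    using O.inj_resD(2)[OF assms] A.exact_op by simp
  have "cmp B (app F (choice_seq c (Suc j))) (app F (choice_seq c (Suc (Suc j)))) =
    app F (cmp A (choice_seq c (Suc j)) (choice_seq c (Suc (Suc j))))"
    by (rule F_cmp[OF E1 E1, symmetric])
  also have "\<dots> = zer B (app F (tgt A (choice_seq c (Suc (Suc (Suc j)))))) (app F (tgt A (choice_seq c (Suc j))))"
    unfolding A.exact_zer[OF E2 E1 E1]
    by (rule F_zer) (use A.Hom_Ob[OF E1] in blast)+
  finally obtain z q where
    "homology B (app F (choice_seq c (Suc (Suc j)))) (app F (choice_seq c (Suc j))) z q"
    by (rule B.homology_exists[OF F_Hom[OF E1] F_Hom[OF E1]])
  then show ?thesis using Suc by (auto simp: homology_at_def)
qed

abbreviation right_valid :: "nat \<Rightarrow> 'u \<Rightarrow> 'u choice \<Rightarrow> bool" where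
  "right_valid i X c \<equiv> injective_resolution A X c
     \<and> cohomology_at B (\<lambda>n. app F (diff c n)) i (cyc c) (quo c)"

abbreviation left_valid :: "nat \<Rightarrow> 'u \<Rightarrow> 'u choice \<Rightarrow> bool" where
  "left_valid i X c \<equiv> projective_resolution A X c
     \<and> homology_at B (\<lambda>n. app F (diff c n)) i (cyc c) (quo c)"

lemma right_derived_system:
  assumes "enough_injectives A"
  shows "derived_system A B (right_valid i) (right_induced A B F i)"
proof
  fix X assume X: "X \<in> Ob A"
  obtain e0 where e0: "inj_res A 0 e0" "src A (e0 0) = X" using A.inj_res_start[OF assms X] by blast
  obtain e where e: "\<And>k. k \<le> 0 \<Longrightarrow> e k = e0 k" "\<And>N. inj_res A N e"
    using A.inj_res_extend[OF assms e0(1)] by blast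
  define c where "c = (\<lambda>z q. \<lparr>aug = e 0, diff = \<lambda>n. e (Suc n), cyc = z, quo = q\<rparr>)"
  have se: "choice_seq (c z q) = e" for z q
    by (auto simp: c_def choice_seq_def fun_eq_iff split: nat.splits)
  \<comment> \<open>The differentials of \<open>c z q\<close> do not depend on \<open>z\<close> and
    \<open>q\<close>, so the cohomology can be found with dummies in their place.\<close>
  obtain z q where "cohomology_at B (\<lambda>n. app F (diff (c undefined undefined) n)) i z q"
    using cohomology_exists[of "c undefined undefined"] e(2) se by metis
  then have "right_valid i X (c z q)"
    using e e0 se by (simp add: injective_resolution_iff) (simp add: c_def)
  then show "\<exists>c. right_valid i X c" by blast
next
  fix f c c' h assume "right_induced A B F i f c c' h"
  then show "h \<in> Hom B (tgt B (quo c)) (tgt B (quo c'))" 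
    by (auto simp: right_induced_def homology_map_def)
next
  fix X c Y c' f assume v: "right_valid i X c" "right_valid i Y c'" "f \<in> Hom A X Y"
  then have r: "\<And>N. inj_res A N (choice_seq c)" "\<And>N. inj_res A N (choice_seq c')"
    and f: "f \<in> Hom A (src A (choice_seq c 0)) (src A (choice_seq c' 0))"
    by (simp_all add: injective_resolution_iff)
  note E = A.inj_resD[OF r(1)] and E' = A.inj_resD[OF r(2)]
  obtain \<psi> where \<psi>: "\<psi> 0 = f" "\<And>N. res_lift A N (choice_seq c) (choice_seq c') \<psi>"
    using A.res_lift_exists[OF r f] by blast
  note L = res_liftD[OF \<psi>(2)]
  obtain a where a: "homology B a (app F (choice_seq c (Suc i))) (cyc c) (quo c)"
    "i = 0 \<Longrightarrow> zero_object B (src B a)" "i > 0 \<Longrightarrow> a = app F (choice_seq c i)" using v cohomologyE by metis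
  obtain a' where a': "homology B a' (app F (choice_seq c' (Suc i))) (cyc c') (quo c')"
    "i = 0 \<Longrightarrow> zero_object B (src B a')" "i > 0 \<Longrightarrow> a' = app F (choice_seq c' i)" using v cohomologyE by metis
  have aH: "a \<in> Hom B (src B a) (app F (src A (choice_seq c (Suc i))))"
    using B.homologyE[OF a(1)] HomD[OF F_Hom[OF E(1)]] by metis
  have a'H: "a' \<in> Hom B (src B a') (app F (src A (choice_seq c' (Suc i))))"
    using B.homologyE[OF a'(1)] HomD[OF F_Hom[OF E'(1)]] by metis
  note v0 = F_Hom[OF L(1)[of "Suc i"]] and v1 = F_Hom[OF L(1)[of "Suc (Suc i)"]]
  have sq: "cmp B (app F (choice_seq c' n)) (app F (\<psi> n)) = cmp B (app F (\<psi> (Suc n))) (app F (choice_seq c n))" for n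
    using F_cmp[OF E'(1) L(1)] F_cmp[OF L(1) E(1)] L(2) by metis
  \<comment> \<open>In degree 0 both composites start at a zero object and hence agree; otherwise
    the lift itself supplies the component.\<close>
  have "\<exists>v. v \<in> Hom B (src B a) (src B a') \<and> cmp B (app F (\<psi> (Suc i))) a = cmp B a' v"
  proof (cases "i = 0")
    case True
    note z = B.zer_Hom[OF B.Hom_Ob(1)[OF aH] B.Hom_Ob(1)[OF a'H]]
    show ?thesis using z B.zero_object_unique(1)[OF a(2)[OF True] B.cmp_Hom[OF v0 aH] B.cmp_Hom[OF a'H z]] by blast
  next
    case False
    then show ?thesis using a(3) a'(3) sq[of i] F_Hom[OF L(1)[of i]] HomD[OF F_Hom[OF E(1)]] HomD[OF F_Hom[OF E'(1)]]
      by (intro exI[of _ "app F (\<psi> i)"]) simp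
  qed
  then obtain v where v: "v \<in> Hom B (src B a) (src B a')" "cmp B (app F (\<psi> (Suc i))) a = cmp B a' v"
    by blast
  have "\<exists>h. homology_map B (app F (\<psi> (Suc i))) (cyc c) (quo c) (cyc c') (quo c') h"
    by (rule B.homology_map_exists[OF a(1) a'(1) _ v _ sq])
      (simp_all only: HomD[OF F_Hom[OF E(1)]] HomD[OF F_Hom[OF E'(1)]] v0 v1)
  then obtain h where "homology_map B (app F (\<psi> (Suc i))) (cyc c) (quo c) (cyc c') (quo c') h" ..
  with injective_liftI[OF \<psi>(2,1)] show "\<exists>h. right_induced A B F i f c c' h"
    unfolding right_induced_def by blast
next
  fix X c Y c' f h k assume v: "right_valid i X c" "right_valid i Y c'" "f \<in> Hom A X Y"
    and ind: "right_induced A B F i f c c' h" "right_induced A B F i f c c' k"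
  then have r: "\<And>N. inj_res A N (choice_seq c)" "\<And>N. inj_res A N (choice_seq c')"
    and f: "f \<in> Hom A (src A (aug c)) (src A (aug c'))"
    by (simp_all add: injective_resolution_iff)
  note E = A.inj_resD[OF r(1)] and E' = A.inj_resD[OF r(2)]
  obtain \<phi> \<psi> where l: "\<And>N. res_lift A N (choice_seq c) (choice_seq c') (case_nat f \<phi>)"
      "\<And>N. res_lift A N (choice_seq c) (choice_seq c') (case_nat f \<psi>)"
    and hm: "homology_map B (app F (\<phi> i)) (cyc c) (quo c) (cyc c') (quo c') h"
      "homology_map B (app F (\<psi> i)) (cyc c) (quo c) (cyc c') (quo c') k"
    using ind by (auto simp: right_induced_def injective_lift_iff[OF f])
  obtain s t where s: "s \<in> Hom A (src A (choice_seq c (Suc (Suc i)))) (src A (choice_seq c' (Suc i)))"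
    and t: "t \<in> Hom A (src A (choice_seq c (Suc i))) (src A (choice_seq c' i))"
    and eq: "\<phi> i = add A (\<psi> i) (add A (cmp A s (choice_seq c (Suc i))) (cmp A (choice_seq c' i) t))"
    and t0: "i = 0 \<longrightarrow> zero_mor A t" using A.res_lift_homotopy[OF r l, of i] by auto
  have L: "\<psi> i \<in> Hom A (src A (choice_seq c (Suc i))) (src A (choice_seq c' (Suc i)))"
    "\<phi> i \<in> Hom A (src A (choice_seq c (Suc i))) (src A (choice_seq c' (Suc i)))"
    using res_liftD(1)[OF l(1), of "Suc i"] res_liftD(1)[OF l(2), of "Suc i"] by simp_all
  obtain a where a: "homology B a (app F (choice_seq c (Suc i))) (cyc c) (quo c)" using v cohomologyE by metis
  obtain a' where a': "homology B a' (app F (choice_seq c' (Suc i))) (cyc c') (quo c')"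
    "i = 0 \<Longrightarrow> zero_object B (src B a')" "i > 0 \<Longrightarrow> a' = app F (choice_seq c' i)" using v cohomologyE by metis
  note FE = HomD[OF F_Hom[OF E(1)]] and FE' = HomD[OF F_Hom[OF E'(1)]]
  have a'H: "a' \<in> Hom B (src B a') (app F (src A (choice_seq c' (Suc i))))"
    using B.homologyE[OF a'(1)] FE' by metis
  have Feq: "app F (\<phi> i) = add B (app F (\<psi> i)) (add B (cmp B (app F s) (app F (choice_seq c (Suc i))))
      (cmp B (app F (choice_seq c' i)) (app F t)))"
    unfolding eq F_add[OF L(1) A.add_Hom[OF A.cmp_Hom[OF s E(1)] A.cmp_Hom[OF E'(1) t]]]
      F_add[OF A.cmp_Hom[OF s E(1)] A.cmp_Hom[OF E'(1) t]] F_cmp[OF s E(1)] F_cmp[OF E'(1) t] ..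
  \<comment> \<open>The homotopy passes through entry \<open>i\<close>, which for
    \<open>i = 0\<close> is the augmentation and not the incoming differential \<open>a'\<close>.
    There \<open>t\<close> is zero, so the term can be rewritten through \<open>a'\<close>.\<close>
  have "\<exists>t'. t' \<in> Hom B (app F (src A (choice_seq c (Suc i)))) (src B a')
    \<and> cmp B a' t' = cmp B (app F (choice_seq c' i)) (app F t)"
  proof (cases "i = 0")
    case True
    note ob = A.Hom_Ob[OF t] A.Hom_Ob(2)[OF E'(1)[of i]]
    have "t = zer A (src A (choice_seq c (Suc i))) (src A (choice_seq c' i))"
      using t0 True A.zero_mor_iff[OF t] by blast
    then have "cmp B (app F (choice_seq c' i)) (app F t) = 
       zer B (app F (src A (choice_seq c (Suc i)))) (app F (src A (choice_seq c' (Suc i))))"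
      using F_cmp[OF E'(1) t] A.cmp_zer(1)[OF E'(1) ob(1)] F_zer[OF ob(1,3)] by simp
    then show ?thesis using B.zer_Hom[OF F_Ob[OF ob(1)] B.Hom_Ob(1)[OF a'H]]
      B.cmp_zer(1)[OF a'H F_Ob[OF ob(1)]] by metis
  next
    case False
    then show ?thesis using F_Hom[OF t] a'(3) FE' by (intro exI[of _ "app F t"]) simp
  qed
  then obtain t' where "t' \<in> Hom B (app F (src A (choice_seq c (Suc i)))) (src B a')"
    "cmp B a' t' = cmp B (app F (choice_seq c' i)) (app F t)" by blast
  note t' = this
  show "h = k"
    by (rule B.homology_map_homotopic[OF a a'(1) _ _ _ _ Feq[folded t'(2)] hm])
      (simp_all only: FE FE' F_Hom[OF L(1)] F_Hom[OF L(2)] F_Hom[OF s] t'(1))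
next
  fix X c Y c' Z c'' f g h k
  assume v: "right_valid i X c" "right_valid i Y c'" "right_valid i Z c''"
    and fg: "f \<in> Hom A X Y" "g \<in> Hom A Y Z"
    and ind: "right_induced A B F i f c c' h" "right_induced A B F i g c' c'' k"
  then have r: "\<And>N. inj_res A N (choice_seq c)" "\<And>N. inj_res A N (choice_seq c')"
    "\<And>N. inj_res A N (choice_seq c'')"
    and f: "f \<in> Hom A (src A (aug c)) (src A (aug c'))"
    and g: "g \<in> Hom A (src A (aug c')) (src A (aug c''))"
    by (simp_all add: injective_resolution_iff)
  obtain \<phi> \<psi> where l: "\<And>N. res_lift A N (choice_seq c) (choice_seq c') (case_nat f \<phi>)"
      "\<And>N. res_lift A N (choice_seq c') (choice_seq c'') (case_nat g \<psi>)"
    and hm: "homology_map B (app F (\<phi> i)) (cyc c) (quo c) (cyc c') (quo c') h"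
      "homology_map B (app F (\<psi> i)) (cyc c') (quo c') (cyc c'') (quo c'') k"
    using ind by (auto simp: right_induced_def injective_lift_iff[OF f] injective_lift_iff[OF g])
  obtain a where a: "homology B a (app F (choice_seq c (Suc i))) (cyc c) (quo c)" using v cohomologyE by metis
  obtain a' where a': "homology B a' (app F (choice_seq c' (Suc i))) (cyc c') (quo c')" using v cohomologyE by metis
  obtain a'' where a'': "homology B a'' (app F (choice_seq c'' (Suc i))) (cyc c'') (quo c'')" using v cohomologyE by metis
  note FE = HomD(2)[OF F_Hom[OF A.inj_resD(1)[OF r(1)]]] HomD(2)[OF F_Hom[OF A.inj_resD(1)[OF r(2)]]]
    HomD(2)[OF F_Hom[OF A.inj_resD(1)[OF r(3)]]]
  have L: "\<phi> i \<in> Hom A (src A (choice_seq c (Suc i))) (src A (choice_seq c' (Suc i)))"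
    "\<psi> i \<in> Hom A (src A (choice_seq c' (Suc i))) (src A (choice_seq c'' (Suc i)))"
    using res_liftD(1)[OF l(1), of "Suc i"] res_liftD(1)[OF l(2), of "Suc i"] by simp_all
  have "homology_map B (app F (cmp A (\<psi> i) (\<phi> i))) (cyc c) (quo c) (cyc c'') (quo c'') (cmp B k h)"
    unfolding F_cmp[OF L(2,1)]
    by (rule B.homology_map_cmp[OF a a' a'' _ _ hm]) (simp_all only: FE F_Hom[OF L(1)] F_Hom[OF L(2)])
  with injective_liftI[OF A.res_lift_cmp[OF r l]] show "right_induced A B F i (cmp A g f) c c'' (cmp B k h)"
    unfolding right_induced_def by (intro exI[of _ "\<lambda>n. cmp A (\<psi> n) (\<phi> n)"]) simp
next
  fix X c assume X: "X \<in> Ob A" and v: "right_valid i X c"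
  then have r: "\<And>N. inj_res A N (choice_seq c)" and X': "src A (aug c) = X"
    by (simp_all add: injective_resolution_iff)
  obtain a where a: "homology B a (app F (choice_seq c (Suc i))) (cyc c) (quo c)" using v cohomologyE by metis
  have "homology_map B (app F (src A (choice_seq c (Suc i)))) (cyc c) (quo c) (cyc c) (quo c) (tgt B (quo c))"
    using B.homology_map_id[OF a] by (simp only: HomD(2)[OF F_Hom[OF A.inj_resD(1)[OF r]]])
  with injective_liftI[OF A.res_lift_id[OF r]] X' show "right_induced A B F i X c c (tgt B (quo c))"
    unfolding right_induced_def by (intro exI[of _ "\<lambda>n. src A (choice_seq c (Suc n))"]) simp
qed

end

context additive_functor_setup
begin

text \<open>Only resolutions and lifts live in \<open>op_cat A\<close>; homology in \<open>B\<close>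
  and the maps on it keep their direction. The facts \<open>lift\<close>, \<open>liftI\<close> and
  \<open>liftD\<close> mediate between the two.\<close>

lemma left_derived_system:
  assumes "enough_projectives A"
  shows "derived_system A B (left_valid i) (left_induced A B F i)"
proof -
  interpret O: abelian_cat "op_cat A" by (rule A.abelian_cat_op)
  have res: "src (op_cat A) (aug c) = X \<and> (\<forall>N. inj_res (op_cat A) N (choice_seq c))"
    if "left_valid i X c" for X c
    using conjunct1[OF that] unfolding A.projective_resolution_iff injective_resolution_iff .
  have E: "choice_seq c n \<in> Hom A (tgt A (choice_seq c (Suc n))) (tgt A (choice_seq c n))"
    if "\<And>N. inj_res (op_cat A) N (choice_seq c)" for c n
    using O.inj_resD(1)[OF that] by simp
  have lift: "left_induced A B F i f c c' h \<longleftrightarrow>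
    (\<exists>\<phi>. (\<forall>N. res_lift (op_cat A) N (choice_seq c') (choice_seq c) (case_nat f \<phi>)) \<and>
      homology_map B (app F (\<phi> i)) (cyc c) (quo c) (cyc c') (quo c') h)"
    if "f \<in> Hom A (tgt A (aug c)) (tgt A (aug c'))" for f c c' h
    using that by (simp add: left_induced_def projective_lift_iff injective_lift_iff)
  have liftI: "left_induced A B F i (\<psi> 0) c c' h"
    if "\<And>N. res_lift (op_cat A) N (choice_seq c') (choice_seq c) \<psi>"
      "homology_map B (app F (\<psi> (Suc i))) (cyc c) (quo c) (cyc c') (quo c') h" for c c' \<psi> h
    using injective_liftI[OF that(1) refl] that(2) by (auto simp: left_induced_def projective_lift_iff)
  have liftD: "\<psi> n \<in> Hom A (tgt A (choice_seq c n)) (tgt A (choice_seq c' n))"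
    "cmp A (choice_seq c' n) (\<psi> (Suc n)) = cmp A (\<psi> n) (choice_seq c n)"
    if "\<And>N. res_lift (op_cat A) N (choice_seq c') (choice_seq c) \<psi>" for c c' \<psi> n
    using res_liftD[OF that] by simp_all
  show ?thesis
  proof
    fix X assume X: "X \<in> Ob A"
    have ei: "enough_injectives (op_cat A)" using assms by simp
    obtain e0 where e0: "inj_res (op_cat A) 0 e0" "tgt A (e0 0) = X"
      using O.inj_res_start[OF ei, of X] X by auto
    obtain e where e: "\<And>k. k \<le> 0 \<Longrightarrow> e k = e0 k" "\<And>N. inj_res (op_cat A) N e"
      using O.inj_res_extend[OF ei e0(1)] by blast
    define c where "c = (\<lambda>z q. \<lparr>aug = e 0, diff = \<lambda>n. e (Suc n), cyc = z, quo = q\<rparr>)"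
    have se: "choice_seq (c z q) = e" for z q
      by (auto simp: c_def choice_seq_def fun_eq_iff split: nat.splits)
    obtain z q where "homology_at B (\<lambda>n. app F (diff (c undefined undefined) n)) i z q"
      using homology_exists[of "c undefined undefined"] e(2) se by metis
    then have "left_valid i X (c z q)"
      using e e0 se by (simp add: A.projective_resolution_iff injective_resolution_iff) (simp add: c_def)
    then show "\<exists>c. left_valid i X c" by blast
  next
    fix f c c' h assume "left_induced A B F i f c c' h"
    then show "h \<in> Hom B (tgt B (quo c)) (tgt B (quo c'))" 
      by (auto simp: left_induced_def homology_map_def)
  next
    fix X c Y c' f assume v: "left_valid i X c" "left_valid i Y c'" "f \<in> Hom A X Y"
    then have r: "\<And>N. inj_res (op_cat A) N (choice_seq c)" "\<And>N. inj_res (op_cat A) N (choice_seq c')"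
      and f: "f \<in> Hom (op_cat A) (src (op_cat A) (choice_seq c' 0)) (src (op_cat A) (choice_seq c 0))"
      using res[OF v(1)] res[OF v(2)] by simp_all
    note E = E[OF r(1)] and E' = E[OF r(2)]
    obtain \<psi> where \<psi>: "\<psi> 0 = f" "\<And>N. res_lift (op_cat A) N (choice_seq c') (choice_seq c) \<psi>"
      using O.res_lift_exists[OF r(2,1) f] by blast
    note L = liftD[OF \<psi>(2)]
    obtain a where a: "homology B (app F (choice_seq c (Suc i))) a (cyc c) (quo c)"
      "i = 0 \<Longrightarrow> zero_object B (tgt B a)" "i > 0 \<Longrightarrow> a = app F (choice_seq c i)" using v homologyE by metis
    obtain a' where a': "homology B (app F (choice_seq c' (Suc i))) a' (cyc c') (quo c')"
      "i = 0 \<Longrightarrow> zero_object B (tgt B a')" "i > 0 \<Longrightarrow> a' = app F (choice_seq c' i)" using v homologyE by metis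
    have sa: "src B a = app F (tgt A (choice_seq c (Suc i)))"
      using B.homologyE[OF a(1)] HomD[OF F_Hom[OF E]] by (metis HomD(3))
    have sa': "src B a' = app F (tgt A (choice_seq c' (Suc i)))"
      using B.homologyE[OF a'(1)] HomD[OF F_Hom[OF E']] by (metis HomD(3))
    have aH: "a \<in> Hom B (app F (tgt A (choice_seq c (Suc i)))) (tgt B a)"
      using B.homologyE[OF a(1)] sa by metis
    have a'H: "a' \<in> Hom B (app F (tgt A (choice_seq c' (Suc i)))) (tgt B a')"
      using B.homologyE[OF a'(1)] sa' by metis
    note v0 = F_Hom[OF L(1)[of "Suc i"]] and v1 = F_Hom[OF L(1)[of "Suc (Suc i)"]]
    have sq: "cmp B (app F (choice_seq c' n)) (app F (\<psi> (Suc n))) = cmp B (app F (\<psi> n)) (app F (choice_seq c n))" for n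
      using F_cmp[OF E' L(1)] F_cmp[OF L(1) E] L(2) by metis
    \<comment> \<open>Here degree 0 is exceptional on the outgoing side: both composites end in a
      zero object.\<close>
    have "\<exists>v. v \<in> Hom B (tgt B a) (tgt B a') \<and> cmp B a' (app F (\<psi> (Suc i))) = cmp B v a"
    proof (cases "i = 0")
      case True
      note z = B.zer_Hom[OF B.Hom_Ob(2)[OF aH] B.Hom_Ob(2)[OF a'H]]
      show ?thesis using z B.zero_object_unique(2)[OF a'(2)[OF True] B.cmp_Hom[OF a'H v0] B.cmp_Hom[OF z aH]] by blast
    next
      case False
      then show ?thesis using a(3) a'(3) sq[of i] F_Hom[OF L(1)[of i]] HomD[OF F_Hom[OF E]] HomD[OF F_Hom[OF E']]
        by (intro exI[of _ "app F (\<psi> i)"]) simp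
    qed
    then obtain v where v: "v \<in> Hom B (tgt B a) (tgt B a')" "cmp B a' (app F (\<psi> (Suc i))) = cmp B v a"
      by blast
    have "\<exists>h. homology_map B (app F (\<psi> (Suc i))) (cyc c) (quo c) (cyc c') (quo c') h"
      by (rule B.homology_map_exists[OF a(1) a'(1) _ _ sq[of "Suc i", symmetric] v])
        (simp_all only: sa sa' HomD[OF F_Hom[OF E]] HomD[OF F_Hom[OF E']] v0 v1)
    with liftI[OF \<psi>(2)] \<psi>(1) show "\<exists>h. left_induced A B F i f c c' h" by blast
  next
    fix X c Y c' f h k assume v: "left_valid i X c" "left_valid i Y c'" "f \<in> Hom A X Y"
      and ind: "left_induced A B F i f c c' h" "left_induced A B F i f c c' k"
    then have r: "\<And>N. inj_res (op_cat A) N (choice_seq c)" "\<And>N. inj_res (op_cat A) N (choice_seq c')"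
      and f: "f \<in> Hom A (tgt A (aug c)) (tgt A (aug c'))"
      using res[OF v(1)] res[OF v(2)] by simp_all
    note E = E[OF r(1)] and E' = E[OF r(2)]
    obtain \<phi> \<psi> where l: "\<And>N. res_lift (op_cat A) N (choice_seq c') (choice_seq c) (case_nat f \<phi>)"
        "\<And>N. res_lift (op_cat A) N (choice_seq c') (choice_seq c) (case_nat f \<psi>)"
      and hm: "homology_map B (app F (\<phi> i)) (cyc c) (quo c) (cyc c') (quo c') h"
        "homology_map B (app F (\<psi> i)) (cyc c) (quo c) (cyc c') (quo c') k"
      using ind by (auto simp: lift[OF f])
    obtain s t where s: "s \<in> Hom A (tgt A (choice_seq c (Suc i))) (tgt A (choice_seq c' (Suc (Suc i))))"
      and t: "t \<in> Hom A (tgt A (choice_seq c i)) (tgt A (choice_seq c' (Suc i)))"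
      and eq: "\<phi> i = add A (\<psi> i) (add A (cmp A (choice_seq c' (Suc i)) s) (cmp A t (choice_seq c i)))"
      and t0: "i = 0 \<longrightarrow> zero_mor A t" using O.res_lift_homotopy[OF r(2,1) l, of i] by auto
    have L: "\<psi> i \<in> Hom A (tgt A (choice_seq c (Suc i))) (tgt A (choice_seq c' (Suc i)))"
      "\<phi> i \<in> Hom A (tgt A (choice_seq c (Suc i))) (tgt A (choice_seq c' (Suc i)))"
      using liftD(1)[OF l(1), of "Suc i"] liftD(1)[OF l(2), of "Suc i"] by simp_all
    obtain a' where a': "homology B (app F (choice_seq c' (Suc i))) a' (cyc c') (quo c')" using v homologyE by metis
    obtain a where a: "homology B (app F (choice_seq c (Suc i))) a (cyc c) (quo c)"
      "i = 0 \<Longrightarrow> zero_object B (tgt B a)" "i > 0 \<Longrightarrow> a = app F (choice_seq c i)" using v homologyE by metis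
    note FE = HomD[OF F_Hom[OF E]] and FE' = HomD[OF F_Hom[OF E']]
    have sa: "src B a = app F (tgt A (choice_seq c (Suc i)))"
      using B.homologyE[OF a(1)] FE by (metis HomD(3))
    have sa': "src B a' = app F (tgt A (choice_seq c' (Suc i)))"
      using B.homologyE[OF a'(1)] FE' by (metis HomD(3))
    have aH: "a \<in> Hom B (app F (tgt A (choice_seq c (Suc i)))) (tgt B a)"
      using B.homologyE[OF a(1)] sa by metis
    note cs = A.cmp_Hom[OF E' s] and tc = A.cmp_Hom[OF t E]
    \<comment> \<open>Reversing arrows exchanges the two homotopy terms: the one through
      \<open>s\<close> now gives boundaries, the one through \<open>t\<close> vanishes on cycles.
      The sum is commuted to fit \<open>homology_map_homotopic\<close>.\<close>
    have Feq: "app F (\<phi> i) = add B (app F (\<psi> i)) (add B (cmp B (app F t) (app F (choice_seq c i)))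
        (cmp B (app F (choice_seq c' (Suc i))) (app F s)))"
      unfolding eq A.add_comm[OF cs tc] F_add[OF L(1) A.add_Hom[OF tc cs]] F_add[OF tc cs]
        F_cmp[OF E' s] F_cmp[OF t E] ..
    have "\<exists>t'. t' \<in> Hom B (tgt B a) (app F (tgt A (choice_seq c' (Suc i))))
      \<and> cmp B t' a = cmp B (app F t) (app F (choice_seq c i))"
    proof (cases "i = 0")
      case True
      note ob = A.Hom_Ob(1)[OF E[of i]] A.Hom_Ob[OF t] 
      have "t = zer A (tgt A (choice_seq c i)) (tgt A (choice_seq c' (Suc i)))"
        using t0 True A.zero_mor_iff[OF t] by blast
      then have "cmp B (app F t) (app F (choice_seq c i)) = 
         zer B (app F (tgt A (choice_seq c (Suc i)))) (app F (tgt A (choice_seq c' (Suc i))))"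
        using F_cmp[OF t E] A.cmp_zer(2)[OF E ob(3)] F_zer[OF ob(1,3)] by simp
      then show ?thesis using B.zer_Hom[OF B.Hom_Ob(2)[OF aH] F_Ob[OF ob(3)]]
        B.cmp_zer(2)[OF aH F_Ob[OF ob(3)]] by metis
    next
      case False
      then show ?thesis using F_Hom[OF t] a(3) FE by (intro exI[of _ "app F t"]) simp
    qed
    then obtain t' where t': "t' \<in> Hom B (tgt B a) (app F (tgt A (choice_seq c' (Suc i))))"
      "cmp B t' a = cmp B (app F t) (app F (choice_seq c i))" by blast
    show "h = k"
      by (rule B.homology_map_homotopic[OF a(1) a' _ _ _ _ Feq[folded t'(2)] hm])
        (simp_all only: sa sa' FE FE' F_Hom[OF L(1)] F_Hom[OF L(2)] F_Hom[OF s] t'(1))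
  next
    fix X c Y c' Z c'' f g h k
    assume v: "left_valid i X c" "left_valid i Y c'" "left_valid i Z c''"
      and fg: "f \<in> Hom A X Y" "g \<in> Hom A Y Z"
      and ind: "left_induced A B F i f c c' h" "left_induced A B F i g c' c'' k"
    then have r: "\<And>N. inj_res (op_cat A) N (choice_seq c)" "\<And>N. inj_res (op_cat A) N (choice_seq c')"
      "\<And>N. inj_res (op_cat A) N (choice_seq c'')"
      and f: "f \<in> Hom A (tgt A (aug c)) (tgt A (aug c'))"
      and g: "g \<in> Hom A (tgt A (aug c')) (tgt A (aug c''))"
      using res[OF v(1)] res[OF v(2)] res[OF v(3)] by simp_all
    obtain \<phi> \<psi> where l: "\<And>N. res_lift (op_cat A) N (choice_seq c') (choice_seq c) (case_nat f \<phi>)"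
        "\<And>N. res_lift (op_cat A) N (choice_seq c'') (choice_seq c') (case_nat g \<psi>)"
      and hm: "homology_map B (app F (\<phi> i)) (cyc c) (quo c) (cyc c') (quo c') h"
        "homology_map B (app F (\<psi> i)) (cyc c') (quo c') (cyc c'') (quo c'') k"
      using ind by (auto simp: lift[OF f] lift[OF g])
    obtain a where a: "homology B (app F (choice_seq c (Suc i))) a (cyc c) (quo c)" using v homologyE by metis
    obtain a' where a': "homology B (app F (choice_seq c' (Suc i))) a' (cyc c') (quo c')" using v homologyE by metis
    obtain a'' where a'': "homology B (app F (choice_seq c'' (Suc i))) a'' (cyc c'') (quo c'')" using v homologyE by metis
    have sa: "src B a = app F (tgt A (choice_seq c (Suc i)))"
      using B.homologyE[OF a] HomD[OF F_Hom[OF E[OF r(1)]]] by (metis HomD(3))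
    have sa': "src B a' = app F (tgt A (choice_seq c' (Suc i)))"
      using B.homologyE[OF a'] HomD[OF F_Hom[OF E[OF r(2)]]] by (metis HomD(3))
    have sa'': "src B a'' = app F (tgt A (choice_seq c'' (Suc i)))"
      using B.homologyE[OF a''] HomD[OF F_Hom[OF E[OF r(3)]]] by (metis HomD(3))
    have L: "\<phi> i \<in> Hom A (tgt A (choice_seq c (Suc i))) (tgt A (choice_seq c' (Suc i)))"
      "\<psi> i \<in> Hom A (tgt A (choice_seq c' (Suc i))) (tgt A (choice_seq c'' (Suc i)))"
      using liftD(1)[OF l(1), of "Suc i"] liftD(1)[OF l(2), of "Suc i"] by simp_all
    have "homology_map B (app F (cmp A (\<psi> i) (\<phi> i))) (cyc c) (quo c) (cyc c'') (quo c'') (cmp B k h)"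
      unfolding F_cmp[OF L(2,1)]
      by (rule B.homology_map_cmp[OF a a' a'' _ _ hm])
        (simp_all only: sa sa' sa'' F_Hom[OF L(1)] F_Hom[OF L(2)])
    with liftI[OF O.res_lift_cmp[OF r(3,2,1) l(2,1)]]
    show "left_induced A B F i (cmp A g f) c c'' (cmp B k h)" by simp
  next
    fix X c assume X: "X \<in> Ob A" and v: "left_valid i X c"
    then have r: "\<And>N. inj_res (op_cat A) N (choice_seq c)" and X': "tgt A (aug c) = X"
      using res[OF v] by simp_all
    obtain a where a: "homology B (app F (choice_seq c (Suc i))) a (cyc c) (quo c)" using v homologyE by metis
    have sa: "src B a = app F (tgt A (choice_seq c (Suc i)))"
      using B.homologyE[OF a] HomD[OF F_Hom[OF E[OF r]]] by (metis HomD(3))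
    have "homology_map B (app F (tgt A (choice_seq c (Suc i)))) (cyc c) (quo c) (cyc c) (quo c) (tgt B (quo c))"
      using B.homology_map_id[OF a] by (simp only: sa)
    with liftI[OF O.res_lift_id[OF r]] X' show "left_induced A B F i X c c (tgt B (quo c))" by simp
  qed
qed

lemma right_derived_exists:
  assumes "enough_injectives A"
  shows "\<exists>R. right_derived A B F i R"
proof -
  interpret derived_system A B "right_valid i" "right_induced A B F i"
    by (rule right_derived_system[OF assms])
  show ?thesis using derived_exists
    by (auto simp: right_derived_def right_derived_by_def derived_by_def)
qed

lemma right_derived_unique:
  assumes "enough_injectives A" "right_derived A B F i R" "right_derived A B F i R'"
  shows "right_derived_eq A B F i R R'"
proof -
  interpret derived_system A B "right_valid i" "right_induced A B F i"
    by (rule right_derived_system[OF assms(1)])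
  have "right_derived_by A B F i r R \<longleftrightarrow> derived_by r R" for r R
    by (auto simp: right_derived_by_def derived_by_def)
  with derived_natural_iso assms(2,3) show ?thesis by (simp add: right_derived_eq_def)
qed

lemma left_derived_exists:
  assumes "enough_projectives A"
  shows "\<exists>L. left_derived A B F i L"
proof -
  interpret derived_system A B "left_valid i" "left_induced A B F i"
    by (rule left_derived_system[OF assms])
  show ?thesis using derived_exists
    by (auto simp: left_derived_def left_derived_by_def derived_by_def)
qed

lemma left_derived_unique:
  assumes "enough_projectives A" "left_derived A B F i L" "left_derived A B F i L'"
  shows "left_derived_eq A B F i L L'"
proof -
  interpret derived_system A B "left_valid i" "left_induced A B F i"
    by (rule left_derived_system[OF assms(1)])
  have "left_derived_by A B F i r L \<longleftrightarrow> derived_by r L" for r L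
    by (auto simp: left_derived_by_def derived_by_def)
  with derived_natural_iso assms(2,3) show ?thesis by (simp add: left_derived_eq_def)
qed

end

subsection \<open>Transfer\<close>

text \<open>The values of the first \<open>n\<close> variables, the innermost one at the head.\<close>

definition env :: "nat \<Rightarrow> (nat \<Rightarrow> 'u) \<Rightarrow> 'u list" where
  "env n \<rho> = map \<rho> (rev [0..<n])"

lemma env_simps [simp]: "env 0 \<rho> = []" "env (Suc n) \<rho> = \<rho> n # env n \<rho>"
  by (simp_all add: env_def)

lemma env_upd [simp]: "env n (\<rho>(n := a)) = env n \<rho>"
  by (simp add: env_def)

text \<open>Transfer reaches bounded quantifiers only. The variables bound in the definition already
  range over morphisms, and this form makes the bounds visible; the same is done for the notions
  that follow.\<close>

lemma injective_object_bounded: "injective_object C J \<longleftrightarrow> J \<in> Ob C \<and>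
     (\<forall>m\<in>Mor C. \<forall>f\<in>Mor C. mono_in C m \<and> f \<in> Hom C (src C m) J \<longrightarrow>
       (\<exists>g\<in>Hom C (tgt C m) J. cmp C g m = f))"
  unfolding injective_object_def mono_in_def Hom_def by blast

lemma projective_object_bounded: "projective_object C P \<longleftrightarrow> P \<in> Ob C \<and>
     (\<forall>e\<in>Mor C. \<forall>f\<in>Mor C. epi_in C e \<and> f \<in> Hom C P (tgt C e) \<longrightarrow>
       (\<exists>g\<in>Hom C P (src C e). cmp C e g = f))"
  unfolding projective_object_def epi_in_def Hom_def by blast

lemma enough_injectives_bounded: "enough_injectives C \<longleftrightarrow>
     (\<forall>X\<in>Ob C. \<exists>m\<in>Mor C. mono_in C m \<and> src C m = X \<and> injective_object C (tgt C m))"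
  unfolding enough_injectives_def mono_in_def by blast

lemma enough_projectives_bounded: "enough_projectives C \<longleftrightarrow>
     (\<forall>X\<in>Ob C. \<exists>e\<in>Mor C. epi_in C e \<and> tgt C e = X \<and> projective_object C (src C e))"
  unfolding enough_projectives_def epi_in_def by blast

lemma exact_bounded: "exact C f g \<longleftrightarrow>
     (\<exists>q\<in>Mor C. \<exists>k\<in>Mor C. is_cokernel C q f \<and> is_kernel C k q \<and> is_kernel C k g)"
  unfolding exact_def by (auto dest: kernelM)

text \<open>\<open>is_set\<close> is not among the atomic formulas, so it stays a separate conjunct,
  to be handled by \<open>is_set_star\<close>; all the rest becomes bounded.\<close>

lemma is_map_bounded: "is_map f X Y \<longleftrightarrow> is_set f
     \<and> (\<forall>p\<in>elts f. \<exists>x\<in>elts X. \<exists>y\<in>elts Y. p = opair x y)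
     \<and> (\<forall>x\<in>elts X. \<exists>y\<in>elts Y. opair x y \<in> elts f
         \<and> (\<forall>y'\<in>elts Y. opair x y' \<in> elts f \<longrightarrow> y' = (y::'u::set_universe)))" (is "?L \<longleftrightarrow> ?R")
proof
  assume L: ?L
  note * = is_map_app[OF L]
  have u: "y = app f x" if "opair x y \<in> elts f" "x \<in> elts X" for x y
    using L * that unfolding is_map_def by blast
  have "\<exists>x\<in>elts X. \<exists>y\<in>elts Y. p = opair x y" if "p \<in> elts f" for p
    using L that unfolding is_map_def by blast
  moreover have "\<exists>y\<in>elts Y. opair x y \<in> elts f \<and> (\<forall>y'\<in>elts Y. opair x y' \<in> elts f \<longrightarrow> y' = y)"
    if "x \<in> elts X" for x
    by (intro bexI[of _ "app f x"] conjI ballI impI) (fact *[OF that] | erule u[OF _ that])+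
  moreover have "is_set f" using L by (simp add: is_map_def)
  ultimately show ?R by blast
next
  assume R: ?R
  then have sub: "elts f \<subseteq> {opair x y | x y. x \<in> elts X \<and> y \<in> elts Y}" by blast
  have "\<exists>!y. opair x y \<in> elts f" if "x \<in> elts X" for x
  proof -
    obtain y where y: "opair x y \<in> elts f" "\<forall>y'\<in>elts Y. opair x y' \<in> elts f \<longrightarrow> y' = y"
      using conjunct2[OF conjunct2[OF R]] \<open>x \<in> elts X\<close> by blast
    have "y' \<in> elts Y" if "opair x y' \<in> elts f" for y'
      using subsetD[OF sub that] by auto
    with y show ?thesis by blast
  qed
  moreover have "is_set f" using R by blast
  ultimately show ?L using sub unfolding is_map_def by blast
qed

lemma Ex1_Hom_bounded: "(\<exists>!u. u \<in> Hom C X Y \<and> P u) \<longleftrightarrow>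
    (\<exists>u\<in>Mor C. (u \<in> Hom C X Y \<and> P u) \<and> (\<forall>y\<in>Mor C. y \<in> Hom C X Y \<and> P y \<longrightarrow> y = u))"
  unfolding Ex1_def Hom_def by blast

section \<open>A calculus of transferable terms and formulas\<close>

locale enlarged =
  fixes S :: "'u::set_universe" and star :: "'u \<Rightarrow> 'u"
  assumes enlargement: "enlargement S star"
begin

lemma base: "base_set S" "base_set (star S)"
  using enlargement by (simp_all add: enlargement_def)

text \<open>A term and its image are represented by their values as functions of the variables in
  scope; \<open>tr_fm\<close> does the same for formulas. Formulas then need not be written down:
  \<open>intro\<close> with the closure rules assembles them along HOL definitions.\<close>

definition tr_trm :: "nat \<Rightarrow> ('u list \<Rightarrow> 'u) \<Rightarrow> ('u list \<Rightarrow> 'u) \<Rightarrow> bool" where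
  "tr_trm n f g \<longleftrightarrow> (\<exists>t. fv_trm t \<subseteq> {..<n} \<and> set_trm t \<subseteq> superstr S
     \<and> (\<forall>\<rho>. trm_val \<rho> t = f (env n \<rho>)) \<and> (\<forall>\<rho>. trm_val \<rho> (map_trm star t) = g (env n \<rho>)))"

definition tr_fm :: "nat \<Rightarrow> ('u list \<Rightarrow> bool) \<Rightarrow> ('u list \<Rightarrow> bool) \<Rightarrow> bool" where
  "tr_fm n P Q \<longleftrightarrow> (\<exists>p. fv_fm p \<subseteq> {..<n} \<and> set_fm p \<subseteq> superstr S
     \<and> (\<forall>\<rho>. sat \<rho> p = P (env n \<rho>)) \<and> (\<forall>\<rho>. sat \<rho> (map_fm star p) = Q (env n \<rho>)))"

lemma transfer:
  assumes "tr_fm 0 (\<lambda>_. P) (\<lambda>_. Q)"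
  shows "P \<longleftrightarrow> Q"
proof -
  obtain p where p: "fv_fm p \<subseteq> {..<0}" "set_fm p \<subseteq> superstr S"
     "\<forall>\<rho>. sat \<rho> p = P" "\<forall>\<rho>. sat \<rho> (map_fm star p) = Q"
    using assms by (auto simp: tr_fm_def)
  then have "fm_true p \<longleftrightarrow> fm_true (map_fm star p)"
    using enlargement by (simp add: enlargement_def statement_in_def)
  with p show ?thesis by (simp add: fm_true_def)
qed

lemma tr_const: "a \<in> superstr S \<Longrightarrow> tr_trm n (\<lambda>_. a) (\<lambda>_. star a)"
  unfolding tr_trm_def by (rule exI[of _ "Const a"]) simp

text \<open>A binder puts its variable at the head of the list, so a term from outside its scope
  sees the tail.\<close>

lemma tr_wk: "tr_trm n f g \<Longrightarrow> tr_trm (Suc n) (\<lambda>c. f (tl c)) (\<lambda>c. g (tl c))"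
  unfolding tr_trm_def by (auto simp: lessThan_Suc)

lemma tr_var0: "tr_trm (Suc n) (\<lambda>c. hd c) (\<lambda>c. hd c)"
  unfolding tr_trm_def by (rule exI[of _ "Var n"]) simp

lemmas tr_var1 = tr_wk[OF tr_var0]
lemmas tr_var2 = tr_wk[OF tr_var1]
lemmas tr_var3 = tr_wk[OF tr_var2]
lemmas tr_vars = tr_var0 tr_var1 tr_var2 tr_var3

lemma tr_pair: "tr_trm n f f' \<Longrightarrow> tr_trm n g g' \<Longrightarrow>
    tr_trm n (\<lambda>c. opair (f c) (g c)) (\<lambda>c. opair (f' c) (g' c))"
  unfolding tr_trm_def by (elim exE) (rename_tac s t, rule_tac x = "Pair s t" in exI, auto)

lemma tr_app: "tr_trm n f f' \<Longrightarrow> tr_trm n g g' \<Longrightarrow>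
    tr_trm n (\<lambda>c. app (f c) (g c)) (\<lambda>c. app (f' c) (g' c))"
  unfolding tr_trm_def by (elim exE) (rename_tac s t, rule_tac x = "App s t" in exI, auto)

lemma tr_eq: "tr_trm n f f' \<Longrightarrow> tr_trm n g g' \<Longrightarrow> tr_fm n (\<lambda>c. f c = g c) (\<lambda>c. f' c = g' c)"
  unfolding tr_trm_def tr_fm_def by (elim exE) (rename_tac s t, rule_tac x = "Eq s t" in exI, auto)

lemma tr_mem: "tr_trm n f f' \<Longrightarrow> tr_trm n g g' \<Longrightarrow>
    tr_fm n (\<lambda>c. f c \<in> elts (g c)) (\<lambda>c. f' c \<in> elts (g' c))"
  unfolding tr_trm_def tr_fm_def by (elim exE) (rename_tac s t, rule_tac x = "Mem s t" in exI, auto)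

lemma tr_not: "tr_fm n P P' \<Longrightarrow> tr_fm n (\<lambda>c. \<not> P c) (\<lambda>c. \<not> P' c)"
  unfolding tr_fm_def by (elim exE) (rename_tac p, rule_tac x = "Neg p" in exI, auto)

lemma tr_conj: "tr_fm n P P' \<Longrightarrow> tr_fm n Q Q' \<Longrightarrow> tr_fm n (\<lambda>c. P c \<and> Q c) (\<lambda>c. P' c \<and> Q' c)"
  unfolding tr_fm_def by (elim exE) (rename_tac p q, rule_tac x = "Conj p q" in exI, auto)

lemma tr_imp: "tr_fm n P P' \<Longrightarrow> tr_fm n Q Q' \<Longrightarrow>
    tr_fm n (\<lambda>c. P c \<longrightarrow> Q c) (\<lambda>c. P' c \<longrightarrow> Q' c)"
  using tr_not[OF tr_conj[OF _ tr_not], of n P P' Q Q'] by simp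

lemma tr_ball: 
  assumes "tr_trm n t t'" "tr_fm (Suc n) (\<lambda>c. P (tl c) (hd c)) (\<lambda>c. P' (tl c) (hd c))"
  shows "tr_fm n (\<lambda>c. \<forall>x\<in>elts (t c). P c x) (\<lambda>c. \<forall>x\<in>elts (t' c). P' c x)"
proof -
  obtain s where s: "fv_trm s \<subseteq> {..<n}" "set_trm s \<subseteq> superstr S"
    "\<forall>\<rho>. trm_val \<rho> s = t (env n \<rho>)" "\<forall>\<rho>. trm_val \<rho> (map_trm star s) = t' (env n \<rho>)"
    using assms(1) by (auto simp: tr_trm_def)
  obtain p where p: "fv_fm p \<subseteq> {..<Suc n}" "set_fm p \<subseteq> superstr S"
     "\<forall>\<rho>. sat \<rho> p = P (env n \<rho>) (\<rho> n)" "\<forall>\<rho>. sat \<rho> (map_fm star p) = P' (env n \<rho>) (\<rho> n)"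
    using assms(2) by (auto simp: tr_fm_def)
  from s p show ?thesis 
    unfolding tr_fm_def by (intro exI[of _ "All_in n s p"]) (auto simp: lessThan_Suc)
qed

lemma tr_bex:
  assumes "tr_trm n t t'" "tr_fm (Suc n) (\<lambda>c. P (tl c) (hd c)) (\<lambda>c. P' (tl c) (hd c))"
  shows "tr_fm n (\<lambda>c. \<exists>x\<in>elts (t c). P c x) (\<lambda>c. \<exists>x\<in>elts (t' c). P' c x)"
  using tr_not[OF tr_ball[OF assms(1) tr_not[OF assms(2)]]] by simp

lemma tr_True: "tr_fm n (\<lambda>_. True) (\<lambda>_. True)"
  unfolding tr_fm_def
  \<comment> \<open>A closed atomic formula is needed, hence some constant; \<open>S\<close> itself
    lies in level 1.\<close>
  by (rule exI[of _ "Eq (Const S) (Const S)"]) 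
    (auto simp: superstr_def intro!: exI[of _ "Suc 0"] simp: base_set_def[THEN iffD1, OF base(1)])

text \<open>\<open>N\<close> is a number of HOL, so this is a conjunction of \<open>N\<close>
  formulas and not a quantifier over indices that transfer would enlarge. Each conjunct may use
  constants of its own.\<close>

lemma tr_all_less: "(\<And>k. tr_fm n (P k) (P' k)) \<Longrightarrow>
    tr_fm n (\<lambda>c. \<forall>k<N. P k c) (\<lambda>c. \<forall>k<(N::nat). P' k c)"
proof (induction N)
  case 0
  then show ?case using tr_True by simp
next
  case (Suc N)
  have "(\<forall>k<Suc N. Q k) \<longleftrightarrow> Q N \<and> (\<forall>k<N. Q k)" for Q by (auto simp: less_Suc_eq)
  with tr_conj[OF Suc.prems Suc.IH[OF Suc.prems]] show ?case by simp
qed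

text \<open>Says that the five sets may occur as constants. The name does not refer to
  \<open>internal\<close>, whose elements belong to the enlarged side.\<close>

definition internal_cat :: "'u add_cat \<Rightarrow> bool" where
  "internal_cat C \<longleftrightarrow> {mors C, srcs C, tgts C, comps C, adds C} \<subseteq> superstr S"

abbreviation sc :: "'u add_cat \<Rightarrow> 'u add_cat" where "sc \<equiv> star_cat star"

section \<open>Transfer of the categorical notions\<close>

context
  fixes C :: "'u add_cat"
  assumes C: "internal_cat C"
begin

lemma tr_cat:
  "tr_trm n (\<lambda>_. mors C) (\<lambda>_. mors (sc C))" "tr_trm n (\<lambda>_. srcs C) (\<lambda>_. srcs (sc C))"
  "tr_trm n (\<lambda>_. tgts C) (\<lambda>_. tgts (sc C))" "tr_trm n (\<lambda>_. comps C) (\<lambda>_. comps (sc C))"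
  "tr_trm n (\<lambda>_. adds C) (\<lambda>_. adds (sc C))"
  using C by (auto simp: star_cat_def internal_cat_def intro: tr_const)

lemma tr_src: "tr_trm n f f' \<Longrightarrow> tr_trm n (\<lambda>c. src C (f c)) (\<lambda>c. src (sc C) (f' c))"
  and tr_tgt: "tr_trm n f f' \<Longrightarrow> tr_trm n (\<lambda>c. tgt C (f c)) (\<lambda>c. tgt (sc C) (f' c))"
  unfolding src_def tgt_def by (intro tr_app tr_cat; assumption)+

lemma tr_cmp: "tr_trm n f f' \<Longrightarrow> tr_trm n g g' \<Longrightarrow>
    tr_trm n (\<lambda>c. cmp C (f c) (g c)) (\<lambda>c. cmp (sc C) (f' c) (g' c))"
  and tr_add: "tr_trm n f f' \<Longrightarrow> tr_trm n g g' \<Longrightarrow>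
    tr_trm n (\<lambda>c. add C (f c) (g c)) (\<lambda>c. add (sc C) (f' c) (g' c))"
  unfolding cmp_def add_def by (intro tr_app tr_cat tr_pair; assumption)+

lemma tr_Mor: "tr_trm n f f' \<Longrightarrow> tr_fm n (\<lambda>c. f c \<in> Mor C) (\<lambda>c. f' c \<in> Mor (sc C))"
  unfolding Mor_def by (intro tr_mem tr_cat)

lemmas tr_basic = tr_vars tr_src tr_tgt tr_cmp tr_add tr_Mor tr_eq tr_conj tr_imp tr_not

lemma tr_Hom: "tr_trm n f f' \<Longrightarrow> tr_trm n X X' \<Longrightarrow> tr_trm n Y Y' \<Longrightarrow>
    tr_fm n (\<lambda>c. f c \<in> Hom C (X c) (Y c)) (\<lambda>c. f' c \<in> Hom (sc C) (X' c) (Y' c))"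
  unfolding Hom_def mem_Collect_eq by (intro tr_basic; assumption)

lemma tr_Ob: "tr_trm n f f' \<Longrightarrow> tr_fm n (\<lambda>c. f c \<in> Ob C) (\<lambda>c. f' c \<in> Ob (sc C))"
  unfolding Ob_def mem_Collect_eq by (intro tr_basic; assumption)

lemma tr_ball_Mor:
  assumes "tr_fm (Suc n) (\<lambda>c. P (tl c) (hd c)) (\<lambda>c. P' (tl c) (hd c))"
  shows "tr_fm n (\<lambda>c. \<forall>x\<in>Mor C. P c x) (\<lambda>c. \<forall>x\<in>Mor (sc C). P' c x)"
  unfolding Mor_def by (intro tr_ball tr_cat assms)

lemma tr_bex_Mor:
  assumes "tr_fm (Suc n) (\<lambda>c. P (tl c) (hd c)) (\<lambda>c. P' (tl c) (hd c))"
  shows "tr_fm n (\<lambda>c. \<exists>x\<in>Mor C. P c x) (\<lambda>c. \<exists>x\<in>Mor (sc C). P' c x)"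
  unfolding Mor_def by (intro tr_bex tr_cat assms)

lemma tr_ball_Ob:
  assumes "tr_fm (Suc n) (\<lambda>c. P (tl c) (hd c)) (\<lambda>c. P' (tl c) (hd c))"
  shows "tr_fm n (\<lambda>c. \<forall>x\<in>Ob C. P c x) (\<lambda>c. \<forall>x\<in>Ob (sc C). P' c x)"
proof -
  have "(\<forall>x\<in>Ob D. Q x) \<longleftrightarrow> (\<forall>x\<in>Mor D. x \<in> Ob D \<longrightarrow> Q x)" for D :: "'u add_cat" and Q
    by (auto simp: Ob_def)
  then show ?thesis by (simp only:) (intro tr_ball_Mor tr_imp tr_Ob tr_vars assms)
qed

lemma tr_ball_Hom:
  assumes X: "tr_trm n X X'" and Y: "tr_trm n Y Y'"
    and P: "tr_fm (Suc n) (\<lambda>c. P (tl c) (hd c)) (\<lambda>c. P' (tl c) (hd c))"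
  shows "tr_fm n (\<lambda>c. \<forall>x\<in>Hom C (X c) (Y c). P c x) (\<lambda>c. \<forall>x\<in>Hom (sc C) (X' c) (Y' c). P' c x)"
proof -
  have "(\<forall>x\<in>Hom D X Y. Q x) \<longleftrightarrow> (\<forall>x\<in>Mor D. x \<in> Hom D X Y \<longrightarrow> Q x)" for D :: "'u add_cat" and X Y Q
    by (auto simp: Hom_def)
  then show ?thesis by (simp only:) (intro tr_ball_Mor tr_imp tr_Hom tr_vars X[THEN tr_wk] Y[THEN tr_wk] P)
qed

lemma tr_bex_Hom:
  assumes X: "tr_trm n X X'" and Y: "tr_trm n Y Y'"
    and P: "tr_fm (Suc n) (\<lambda>c. P (tl c) (hd c)) (\<lambda>c. P' (tl c) (hd c))"
  shows "tr_fm n (\<lambda>c. \<exists>x\<in>Hom C (X c) (Y c). P c x) (\<lambda>c. \<exists>x\<in>Hom (sc C) (X' c) (Y' c). P' c x)"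
  using tr_not[OF tr_ball_Hom[OF X Y tr_not[OF P]]] by simp

text \<open>\<open>P\<close> is required at two depths because bounded unique existence mentions it
  under one binder and again under a second one.\<close>

lemma tr_ex1_Hom:
  assumes X: "tr_trm n X X'" and Y: "tr_trm n Y Y'"
    and P: "tr_fm (Suc n) (\<lambda>c. P (tl c) (hd c)) (\<lambda>c. P' (tl c) (hd c))"
      "tr_fm (Suc (Suc n)) (\<lambda>c. P (tl (tl c)) (hd c)) (\<lambda>c. P' (tl (tl c)) (hd c))"
  shows "tr_fm n (\<lambda>c. \<exists>!x. x \<in> Hom C (X c) (Y c) \<and> P c x)
    (\<lambda>c. \<exists>!x. x \<in> Hom (sc C) (X' c) (Y' c) \<and> P' c x)"
  unfolding Ex1_Hom_bounded
  by (intro tr_bex_Mor tr_ball_Mor tr_conj tr_imp tr_Hom tr_eq tr_vars X[THEN tr_wk] Y[THEN tr_wk]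
    X[THEN tr_wk, THEN tr_wk] Y[THEN tr_wk, THEN tr_wk] P)

lemma tr_ex1_Hom':
  assumes X: "tr_trm n X X'" and Y: "tr_trm n Y Y'"
  shows "tr_fm n (\<lambda>c. \<exists>!x. x \<in> Hom C (X c) (Y c)) (\<lambda>c. \<exists>!x. x \<in> Hom (sc C) (X' c) (Y' c))"
  using tr_ex1_Hom[OF X Y tr_True tr_True] by simp

lemmas tr_rules = tr_basic tr_Hom tr_Ob tr_ball_Mor tr_bex_Mor tr_ball_Ob tr_ball_Hom tr_bex_Hom
  tr_ex1_Hom tr_ex1_Hom'

lemma tr_zero_mor:
  assumes f: "tr_trm n f f'"
  shows "tr_fm n (\<lambda>c. zero_mor C (f c)) (\<lambda>c. zero_mor (sc C) (f' c))"
  unfolding zero_mor_def by (intro tr_rules f f[THEN tr_wk])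

lemma tr_mono:
  assumes f: "tr_trm n f f'"
  shows "tr_fm n (\<lambda>c. mono_in C (f c)) (\<lambda>c. mono_in (sc C) (f' c))"
    and "tr_fm n (\<lambda>c. epi_in C (f c)) (\<lambda>c. epi_in (sc C) (f' c))"
  unfolding mono_in_def epi_in_def by (intro tr_rules f f[THEN tr_wk, THEN tr_wk])+

lemma tr_kernel:
  assumes f: "tr_trm n f f'" and k: "tr_trm n k k'"
  shows "tr_fm n (\<lambda>c. is_kernel C (k c) (f c)) (\<lambda>c. is_kernel (sc C) (k' c) (f' c))"
    and "tr_fm n (\<lambda>c. is_cokernel C (k c) (f c)) (\<lambda>c. is_cokernel (sc C) (k' c) (f' c))"
  unfolding is_kernel_def is_cokernel_def
  by (intro tr_rules tr_zero_mor f k f[THEN tr_wk] k[THEN tr_wk] k[THEN tr_wk, THEN tr_wk]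
    k[THEN tr_wk, THEN tr_wk, THEN tr_wk])+

lemma tr_exact:
  assumes f: "tr_trm n f f'" and g: "tr_trm n g g'"
  shows "tr_fm n (\<lambda>c. exact C (f c) (g c)) (\<lambda>c. exact (sc C) (f' c) (g' c))"
  unfolding exact_bounded
  by (intro tr_rules tr_kernel f[THEN tr_wk, THEN tr_wk] g[THEN tr_wk, THEN tr_wk])

lemma tr_zero_object:
  assumes f: "tr_trm n f f'"
  shows "tr_fm n (\<lambda>c. zero_object C (f c)) (\<lambda>c. zero_object (sc C) (f' c))"
  unfolding zero_object_def by (intro tr_rules f f[THEN tr_wk])

lemma tr_injective:
  assumes f: "tr_trm n f f'"
  shows "tr_fm n (\<lambda>c. injective_object C (f c)) (\<lambda>c. injective_object (sc C) (f' c))"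
    and "tr_fm n (\<lambda>c. projective_object C (f c)) (\<lambda>c. projective_object (sc C) (f' c))"
  unfolding injective_object_bounded projective_object_bounded
  by (intro tr_rules tr_mono f f[THEN tr_wk, THEN tr_wk])+

lemma tr_homology:
  assumes a: "tr_trm n a a'" and b: "tr_trm n b b'" and z: "tr_trm n z z'" and q: "tr_trm n q q'"
  shows "tr_fm n (\<lambda>c. homology C (a c) (b c) (z c) (q c)) (\<lambda>c. homology (sc C) (a' c) (b' c) (z' c) (q' c))"
  unfolding homology_def by (intro tr_rules tr_kernel assms assms[THEN tr_wk])

lemma tr_homology_map:
  assumes "tr_trm n v v'" "tr_trm n z z'" "tr_trm n q q'" "tr_trm n y y'" "tr_trm n p p'" "tr_trm n h h'"
  shows "tr_fm n (\<lambda>c. homology_map C (v c) (z c) (q c) (y c) (p c) (h c))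
    (\<lambda>c. homology_map (sc C) (v' c) (z' c) (q' c) (y' c) (p' c) (h' c))"
  unfolding homology_map_def by (intro tr_rules assms assms[THEN tr_wk])

text \<open>The degree is fixed outside the formula, so the case distinction is made beforehand and
  each case has its own formula.\<close>

lemma tr_homology_at:
  assumes d: "\<And>k. tr_trm n (d k) (d' k)" and z: "tr_trm n z z'" and q: "tr_trm n q q'"
  shows "tr_fm n (\<lambda>c. cohomology_at C (\<lambda>k. d k c) i (z c) (q c))
      (\<lambda>c. cohomology_at (sc C) (\<lambda>k. d' k c) i (z' c) (q' c))"
    and "tr_fm n (\<lambda>c. homology_at C (\<lambda>k. d k c) i (z c) (q c))
      (\<lambda>c. homology_at (sc C) (\<lambda>k. d' k c) i (z' c) (q' c))"
  unfolding cohomology_at_def homology_at_def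
  by (cases i; simp only: nat.case; intro tr_rules tr_zero_object tr_homology d[THEN tr_wk]
    z[THEN tr_wk] q[THEN tr_wk] d z q)+

lemma tr_inj_res:
  assumes e: "\<And>k. tr_trm n (e k) (e' k)"
  shows "tr_fm n (\<lambda>c. inj_res C N (\<lambda>k. e k c)) (\<lambda>c. inj_res (sc C) N (\<lambda>k. e' k c))"
  unfolding inj_res_def by (intro tr_rules tr_mono tr_all_less tr_injective tr_exact e)

lemma tr_res_lift:
  assumes d: "\<And>k. tr_trm n (d k) (d' k)" and e: "\<And>k. tr_trm n (e k) (e' k)"
    and h: "\<And>k. tr_trm n (h k) (h' k)"
  shows "tr_fm n (\<lambda>c. res_lift C N (\<lambda>k. d k c) (\<lambda>k. e k c) (\<lambda>k. h k c))
    (\<lambda>c. res_lift (sc C) N (\<lambda>k. d' k c) (\<lambda>k. e' k c) (\<lambda>k. h' k c))"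
  unfolding res_lift_def by (intro tr_rules tr_all_less d e h)

lemma transfer_abelian: "abelian_cat C \<longleftrightarrow> abelian_cat (sc C)"
  by (rule transfer, unfold abelian_cat_def)
    (intro tr_rules tr_zero_mor tr_zero_object tr_kernel tr_mono)

lemma transfer_enough:
  "enough_injectives C \<longleftrightarrow> enough_injectives (sc C)"
  "enough_projectives C \<longleftrightarrow> enough_projectives (sc C)"
  unfolding enough_injectives_bounded enough_projectives_bounded
  by (rule transfer, intro tr_rules tr_mono tr_injective)+

end

text \<open>\<open>star\<close> is not applied to the data of \<open>op_cat C\<close>. The opposite
  is unfolded on both sides first, leaving notions of \<open>C\<close> and \<open>sc C\<close>; the
  duality rules used for this ask for both to be abelian.\<close>

lemma tr_inj_res_op:
  assumes C: "internal_cat C" "abelian_cat C" and e: "\<And>k. tr_trm n (e k) (e' k)"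
  shows "tr_fm n (\<lambda>c. inj_res (op_cat C) N (\<lambda>k. e k c)) (\<lambda>c. inj_res (op_cat (sc C)) N (\<lambda>k. e' k c))"
proof -
  interpret C: abelian_cat C by fact
  interpret D: abelian_cat "sc C" using C transfer_abelian by simp
  show ?thesis
    unfolding inj_res_def C.injective_op D.injective_op C.exact_op D.exact_op
      mono_op Mor_op src_op tgt_op
    by (intro tr_rules[OF C(1)] tr_mono[OF C(1)] tr_all_less tr_injective[OF C(1)] tr_exact[OF C(1)] e)
qed

lemma tr_res_lift_op:
  assumes C: "internal_cat C" and d: "\<And>k. tr_trm n (d k) (d' k)" and e: "\<And>k. tr_trm n (e k) (e' k)"
    and h: "\<And>k. tr_trm n (h k) (h' k)"
  shows "tr_fm n (\<lambda>c. res_lift (op_cat C) N (\<lambda>k. d k c) (\<lambda>k. e k c) (\<lambda>k. h k c))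
    (\<lambda>c. res_lift (op_cat (sc C)) N (\<lambda>k. d' k c) (\<lambda>k. e' k c) (\<lambda>k. h' k c))"
  unfolding res_lift_def Hom_op cmp_op src_op by (intro tr_rules[OF C] tr_all_less d e h)

section \<open>Elements, sets and functors under the enlargement\<close>

lemma star_eqI:
  assumes "tr_trm 0 (\<lambda>_. a) (\<lambda>_. b)" "a \<in> superstr S"
  shows "star a = b"
  using transfer[OF tr_eq[OF assms(1) tr_const[OF assms(2)]]] by simp

lemma star_memI: "x \<in> elts a \<Longrightarrow> x \<in> superstr S \<Longrightarrow> a \<in> superstr S \<Longrightarrow> star x \<in> elts (star a)"
  using transfer[OF tr_mem[OF tr_const tr_const]] by simp

lemma superstr_elts: "x \<in> elts a \<Longrightarrow> a \<in> superstr S \<Longrightarrow> x \<in> superstr S"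
  using level_elts[OF base(1)] by (fastforce simp: superstr_def)

text \<open>Being a set is not expressible in a formula, but having a given element is, and
  urelements have none.\<close>

lemma is_set_star:
  assumes "a \<in> superstr S" "elts a \<noteq> {}"
  shows "is_set (star a)"
proof -
  obtain x where "x \<in> elts a" using assms(2) by blast
  then have "star x \<in> elts (star a)" using assms superstr_elts star_memI by blast
  then show ?thesis using elts_urelement by blast
qed

text \<open>The superstructure is given to contain the set of morphisms; the other four sets are
  relations over it and lie only finitely many levels higher.\<close>

lemma internal_cat_abelian:
  assumes "abelian_small_category S C"
  shows "internal_cat C"
proof -
  have sc: "small_category S C" and ad: "is_set (adds C)"
    "elts (adds C) \<subseteq> {triple f g h | f g h. f \<in> Mor C \<and> g \<in> Mor C \<and> h \<in> Mor C}"
    using assms unfolding abelian_small_category_def by - (elim conjE, assumption)+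
  have m: "mors C \<in> superstr S - elts S" and st: "is_map (srcs C) (mors C) (mors C)"
    "is_map (tgts C) (mors C) (mors C)" and co: "is_set (comps C)"
    "elts (comps C) \<subseteq> {triple f g h | f g h. f \<in> Mor C \<and> g \<in> Mor C \<and> h \<in> Mor C}"
    using sc unfolding small_category_def by - (elim conjE, assumption)+
  have map: "f \<in> superstr S" if "is_map f (mors C) (mors C)" for f
    using that m superstr_relation[OF base(1)] unfolding is_map_def by blast
  have "comps C \<in> superstr S" "adds C \<in> superstr S"
    using superstr_ternary[OF base(1)] m ad co unfolding Mor_def by blast+
  with m st map show ?thesis by (simp add: internal_cat_def)
qed

lemma transfer_functor:
  assumes A: "internal_cat A" and B: "internal_cat B" and F: "F \<in> superstr S" "elts F \<noteq> {}"
    and "is_functor A B F"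
  shows "is_functor (sc A) (sc B) (star F)"
proof -
  note F' = tr_const[OF F(1)]
  have "is_map F (mors A) (mors B) \<longleftrightarrow> is_map (star F) (mors (sc A)) (mors (sc B))"
  proof -
    have "is_set F" using F(2) elts_urelement by blast
    then show ?thesis
      unfolding is_map_bounded using is_set_star[OF F]
      by (simp only: simp_thms) (rule transfer, intro tr_ball tr_bex tr_conj tr_imp tr_eq tr_mem tr_pair F'
        tr_cat[OF A] tr_cat[OF B] tr_vars)
  qed
  moreover have "functor_map A B (app F) \<longleftrightarrow> functor_map (sc A) (sc B) (app (star F))"
    unfolding functor_map_def 
    by (rule transfer, intro tr_rules[OF A] tr_rules[OF B] tr_app F')
  ultimately show ?thesis using assms(5) by (simp add: is_functor_def)
qed

lemma transfer_additive:
  assumes A: "internal_cat A" and B: "internal_cat B" and F: "F \<in> superstr S"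
  shows "(\<forall>f\<in>Mor A. \<forall>g\<in>Mor A. src A f = src A g \<and> tgt A f = tgt A g \<longrightarrow>
      app F (add A f g) = add B (app F f) (app F g)) \<longleftrightarrow>
    (\<forall>f\<in>Mor (sc A). \<forall>g\<in>Mor (sc A). src (sc A) f = src (sc A) g \<and> tgt (sc A) f = tgt (sc A) g \<longrightarrow>
      app (star F) (add (sc A) f g) = add (sc B) (app (star F) f) (app (star F) g))"
  by (rule transfer, intro tr_rules[OF A] tr_rules[OF B] tr_app tr_const[OF F])

end

text \<open>Degree \<open>i\<close> looks at no differential beyond index \<open>i\<close>, which is
  entry \<open>Suc i\<close> of a choice sequence. This fixes the length of the truncations.\<close>

lemma cohomology_at_cong:
  assumes "\<And>j. j \<le> i \<Longrightarrow> d j = d' j"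
  shows "cohomology_at C d i z q \<longleftrightarrow> cohomology_at C d' i z q"
    and "homology_at C d i z q \<longleftrightarrow> homology_at C d' i z q"
  using assms by (cases i; simp add: cohomology_at_def homology_at_def)+

lemma cohomology_at_Mor:
  assumes "cohomology_at C d i z q"
  shows "z \<in> Mor C" "q \<in> Mor C"
  using assms by (auto simp: cohomology_at_def homology_def kernelM split: nat.splits)

lemma homology_at_Mor:
  assumes "homology_at C d i z q"
  shows "z \<in> Mor C" "q \<in> Mor C"
  using assms by (auto simp: homology_at_def homology_def kernelM split: nat.splits)

section \<open>Derived functors under the enlargement\<close>

context enlarged
begin

lemma internalize:
  assumes A: "internal_cat A" and B: "internal_cat B" and "D \<subseteq> Mor A" and "\<And>x. x \<in> D \<Longrightarrow> g x \<in> Mor B"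
  shows "\<exists>G\<in>superstr S. \<forall>x\<in>D. app G x = g x"
  by (rule superstr_map_exists[OF base(1), of "mors A" "mors B"])
    (use assms in \<open>auto simp: internal_cat_def Mor_def\<close>)

lemma functor_superstr:
  assumes A: "internal_cat A" and B: "internal_cat B" and "is_functor A B R"
  shows "R \<in> superstr S"
  using assms superstr_relation[OF base(1), of "mors A" "mors B" R]
  unfolding is_functor_def is_map_def internal_cat_def by blast

text \<open>Supplies the element that \<open>is_set_star\<close> asks for: the value at a zero
  object.\<close>

lemma functor_nonempty:
  assumes "abelian_cat A" "is_functor A B R"
  shows "elts R \<noteq> {}"
proof -
  interpret abelian_cat A by fact
  obtain Z where "Z \<in> Mor A" using ax_zero_object by blast
  then show ?thesis using is_map_app(2) assms(2) unfolding is_functor_def Mor_def by blast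
qed

context
  fixes A B :: "'u add_cat" and F :: 'u
  assumes A: "internal_cat A" "abelian_cat A" and B: "internal_cat B" and F: "F \<in> superstr S"
begin

interpretation A: abelian_cat A by (rule A(2))
interpretation A': abelian_cat "sc A" using A transfer_abelian by simp

lemmas tr_all = tr_rules[OF A(1)] tr_rules[OF B] tr_app tr_const tr_homology_map[OF B]
  tr_homology_at[OF B]

text \<open>The choices behind \<open>star R\<close> are the images of the internalized choices,
  evaluated at all objects and morphisms of the enlarged category, standard or not.\<close>

lemma star_right_derived:
  assumes R: "right_derived A B F i R" and enough: "enough_injectives (sc A)"
  shows "right_derived (sc A) (sc B) (star F) i (star R)"
proof -
  obtain r where by_r: "right_derived_by A B F i r R" using R by (auto simp: right_derived_def)
  then have fR: "is_functor A B R" by (simp add: right_derived_by_def)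
  note RS = functor_superstr[OF A(1) B fR] and Rn = functor_nonempty[OF A(2) fR]
  have r: "src A (aug (r X)) = X" "\<And>N. inj_res A N (choice_seq (r X))"
    "cohomology_at B (\<lambda>n. app F (diff (r X) n)) i (cyc (r X)) (quo (r X))"
    "app R X = tgt B (quo (r X))" if "X \<in> Ob A" for X
    using by_r that by (auto simp: right_derived_by_def injective_resolution_iff)
  have "\<exists>\<psi>. \<psi> 0 = f \<and> (\<forall>N. res_lift A N (choice_seq (r (src A f))) (choice_seq (r (tgt A f))) \<psi>)
    \<and> homology_map B (app F (\<psi> (Suc i))) (cyc (r (src A f))) (quo (r (src A f)))
        (cyc (r (tgt A f))) (quo (r (tgt A f))) (app R f)" if f: "f \<in> Mor A" for f
  proof -
    obtain \<phi> where \<phi>: "injective_lift A f (r (src A f)) (r (tgt A f)) \<phi>"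
      "homology_map B (app F (\<phi> i)) (cyc (r (src A f))) (quo (r (src A f)))
        (cyc (r (tgt A f))) (quo (r (tgt A f))) (app R f)"
      using by_r f by (auto simp: right_derived_by_def right_induced_def)
    have "f \<in> Hom A (src A (aug (r (src A f)))) (src A (aug (r (tgt A f))))"
      using HomI[OF f] r(1) A.Mor_Ob[OF f] by simp
    with \<phi> show ?thesis by (intro exI[of _ "case_nat f \<phi>"]) (simp add: injective_lift_iff)
  qed
  then obtain \<psi> where \<psi>: "\<And>f. f \<in> Mor A \<Longrightarrow> \<psi> f 0 = f"
    "\<And>f N. f \<in> Mor A \<Longrightarrow> res_lift A N (choice_seq (r (src A f))) (choice_seq (r (tgt A f))) (\<psi> f)"
    "\<And>f. f \<in> Mor A \<Longrightarrow> homology_map B (app F (\<psi> f (Suc i))) (cyc (r (src A f))) (quo (r (src A f)))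
        (cyc (r (tgt A f))) (quo (r (tgt A f))) (app R f)"
    by metis
  have ObM: "Ob A \<subseteq> Mor A" using A.Ob_Mor by blast
  \<comment> \<open>Each index gets its own map \<open>E n\<close>. The sequence of these maps is
    external, but only finitely many of them enter a formula.\<close>
  have "\<exists>G\<in>superstr S. \<forall>X\<in>Ob A. app G X = choice_seq (r X) n" for n
    by (rule internalize[OF A(1,1) ObM]) (use A.inj_resD(1)[OF r(2)] HomD(1) in blast)
  then obtain E where E: "\<And>n. E n \<in> superstr S" "\<And>n X. X \<in> Ob A \<Longrightarrow> app (E n) X = choice_seq (r X) n"
    by metis
  obtain Z where Z: "Z \<in> superstr S" "\<And>X. X \<in> Ob A \<Longrightarrow> app Z X = cyc (r X)"
    using internalize[OF A(1) B ObM, of "\<lambda>X. cyc (r X)"] cohomology_at_Mor(1)[OF r(3)] by blast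
  obtain Q where Q: "Q \<in> superstr S" "\<And>X. X \<in> Ob A \<Longrightarrow> app Q X = quo (r X)"
    using internalize[OF A(1) B ObM, of "\<lambda>X. quo (r X)"] cohomology_at_Mor(2)[OF r(3)] by blast
  have "\<exists>G\<in>superstr S. \<forall>f\<in>Mor A. app G f = \<psi> f n" for n
    by (rule internalize[OF A(1,1) subset_refl]) (use res_liftD(1)[OF \<psi>(2)] HomD(1) in blast)
  then obtain H where H: "\<And>n. H n \<in> superstr S" "\<And>n f. f \<in> Mor A \<Longrightarrow> app (H n) f = \<psi> f n"
    by metis
  \<comment> \<open>All objects are treated in one formula, so that its transfer speaks about
    nonstandard objects as well.\<close>
  have "\<forall>X\<in>Ob A. src A (app (E 0) X) = X \<and> inj_res A (Suc i) (\<lambda>n. app (E n) X)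
    \<and> cohomology_at B (\<lambda>n. app F (app (E (Suc n)) X)) i (app Z X) (app Q X)
    \<and> app R X = tgt B (app Q X)"
    using r E Z Q by simp
  also have "?this \<longleftrightarrow> (\<forall>X\<in>Ob (sc A). src (sc A) (app (star (E 0)) X) = X
    \<and> inj_res (sc A) (Suc i) (\<lambda>n. app (star (E n)) X)
    \<and> cohomology_at (sc B) (\<lambda>n. app (star F) (app (star (E (Suc n))) X)) i (app (star Z) X) (app (star Q) X)
    \<and> app (star R) X = tgt (sc B) (app (star Q) X))"
    by (rule transfer, intro tr_all tr_inj_res[OF A(1)] E Z Q F RS)
  finally have obs: "src (sc A) (app (star (E 0)) X) = X"
    "inj_res (sc A) (Suc i) (\<lambda>n. app (star (E n)) X)"
    "cohomology_at (sc B) (\<lambda>n. app (star F) (app (star (E (Suc n))) X)) i (app (star Z) X) (app (star Q) X)"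
    "app (star R) X = tgt (sc B) (app (star Q) X)" if "X \<in> Ob (sc A)" for X using that by blast+
  have "\<forall>f\<in>Mor A. app (H 0) f = f
    \<and> res_lift A (Suc i) (\<lambda>n. app (E n) (src A f)) (\<lambda>n. app (E n) (tgt A f)) (\<lambda>n. app (H n) f)
    \<and> homology_map B (app F (app (H (Suc i)) f)) (app Z (src A f)) (app Q (src A f))
      (app Z (tgt A f)) (app Q (tgt A f)) (app R f)"
    using \<psi> E Z Q H A.Mor_Ob by simp
  also have "?this \<longleftrightarrow> (\<forall>f\<in>Mor (sc A). app (star (H 0)) f = f
    \<and> res_lift (sc A) (Suc i) (\<lambda>n. app (star (E n)) (src (sc A) f)) (\<lambda>n. app (star (E n)) (tgt (sc A) f))
        (\<lambda>n. app (star (H n)) f)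
    \<and> homology_map (sc B) (app (star F) (app (star (H (Suc i))) f)) (app (star Z) (src (sc A) f))
      (app (star Q) (src (sc A) f)) (app (star Z) (tgt (sc A) f)) (app (star Q) (tgt (sc A) f)) (app (star R) f))"
    by (rule transfer, intro tr_all tr_res_lift[OF A(1)] E Z Q H F RS)
  finally have mors: "app (star (H 0)) f = f"
    "res_lift (sc A) (Suc i) (\<lambda>n. app (star (E n)) (src (sc A) f)) (\<lambda>n. app (star (E n)) (tgt (sc A) f))
        (\<lambda>n. app (star (H n)) f)"
    "homology_map (sc B) (app (star F) (app (star (H (Suc i))) f)) (app (star Z) (src (sc A) f))
      (app (star Q) (src (sc A) f)) (app (star Z) (tgt (sc A) f)) (app (star Q) (tgt (sc A) f)) (app (star R) f)"
    if "f \<in> Mor (sc A)" for f using that by blast+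
  \<comment> \<open>The tails are chosen object by object and need not be internal. The entries up
    to \<open>Suc i\<close>, and with them the cohomology in degree \<open>i\<close>, remain the
    transferred ones.\<close>
  have "\<exists>e. (\<forall>k\<le>Suc i. e k = app (star (E k)) X) \<and> (\<forall>N. inj_res (sc A) N e)" if "X \<in> Ob (sc A)" for X
    using A'.inj_res_extend[OF enough obs(2)[OF that]] by metis
  then obtain e where e: "\<And>X k. X \<in> Ob (sc A) \<Longrightarrow> k \<le> Suc i \<Longrightarrow> e X k = app (star (E k)) X"
    "\<And>X N. X \<in> Ob (sc A) \<Longrightarrow> inj_res (sc A) N (e X)" by metis
  define r' where "r' X = \<lparr>aug = e X 0, diff = \<lambda>n. e X (Suc n), cyc = app (star Z) X,
    quo = app (star Q) X\<rparr>" for X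
  have seq: "choice_seq (r' X) = e X" for X
    by (auto simp: r'_def choice_seq_def fun_eq_iff split: nat.splits)
  have "injective_resolution (sc A) X (r' X)" if "X \<in> Ob (sc A)" for X
    using e[OF that] obs(1)[OF that] seq by (simp add: injective_resolution_iff) (simp add: r'_def)
  moreover have "cohomology_at (sc B) (\<lambda>n. app (star F) (diff (r' X) n)) i (cyc (r' X)) (quo (r' X))"
    if "X \<in> Ob (sc A)" for X
    using obs(3)[OF that] e(1)[OF that] cohomology_at_cong(1)[of i "\<lambda>n. app (star F) (diff (r' X) n)"
      "\<lambda>n. app (star F) (app (star (E (Suc n))) X)" "sc B"] by (simp add: r'_def)
  moreover have "app (star R) X = tgt (sc B) (quo (r' X))" if "X \<in> Ob (sc A)" for X
    using obs(4)[OF that] by (simp add: r'_def)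
  moreover have "right_induced (sc A) (sc B) (star F) i f (r' (src (sc A) f)) (r' (tgt (sc A) f)) (app (star R) f)"
    if f: "f \<in> Mor (sc A)" for f
  proof -
    note ob = A'.Mor_Ob[OF f]
    \<comment> \<open>Up to \<open>Suc i\<close> the extended resolutions agree with the transferred
      ones, so the transferred lift fits them and can be continued along the tails.\<close>
    have "res_lift (sc A) (Suc i) (e (src (sc A) f)) (e (tgt (sc A) f)) (\<lambda>n. app (star (H n)) f)"
      by (rule res_lift_cong[OF mors(2)[OF f]]) (use e(1) ob in auto)
    then obtain \<phi> where \<phi>: "\<And>k. k \<le> Suc i \<Longrightarrow> \<phi> k = app (star (H k)) f"
      "\<And>M. res_lift (sc A) M (e (src (sc A) f)) (e (tgt (sc A) f)) \<phi>"
      using A'.res_lift_extend[OF e(2)[OF ob(1)] e(2)[OF ob(2)]] by blast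
    have "injective_lift (sc A) f (r' (src (sc A) f)) (r' (tgt (sc A) f)) (\<lambda>n. \<phi> (Suc n))"
      by (rule injective_liftI) (use \<phi> mors(1)[OF f] seq in simp_all)
    moreover have "homology_map (sc B) (app (star F) (\<phi> (Suc i))) (cyc (r' (src (sc A) f)))
       (quo (r' (src (sc A) f))) (cyc (r' (tgt (sc A) f))) (quo (r' (tgt (sc A) f))) (app (star R) f)"
      using mors(3)[OF f] \<phi>(1)[of "Suc i"] by (simp add: r'_def)
    ultimately show ?thesis unfolding right_induced_def by blast
  qed
  ultimately show ?thesis
    using transfer_functor[OF A(1) B RS Rn fR] unfolding right_derived_def right_derived_by_def by blast
qed

text \<open>Truncations are transferred in the opposite category, where lifts run from the choice
  for the target to the choice for the source.\<close>

lemma star_left_derived: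
  assumes L: "left_derived A B F i L" and enough: "enough_projectives (sc A)"
  shows "left_derived (sc A) (sc B) (star F) i (star L)"
proof -
  interpret O: abelian_cat "op_cat A" by (rule A.abelian_cat_op)
  interpret O': abelian_cat "op_cat (sc A)" by (rule A'.abelian_cat_op)
  obtain r where by_r: "left_derived_by A B F i r L" using L by (auto simp: left_derived_def)
  then have fL: "is_functor A B L" by (simp add: left_derived_by_def)
  note LS = functor_superstr[OF A(1) B fL] and Ln = functor_nonempty[OF A(2) fL]
  have r: "tgt A (aug (r X)) = X" "\<And>N. inj_res (op_cat A) N (choice_seq (r X))"
    "homology_at B (\<lambda>n. app F (diff (r X) n)) i (cyc (r X)) (quo (r X))"
    "app L X = tgt B (quo (r X))" if "X \<in> Ob A" for X
    using by_r that by (auto simp: left_derived_by_def A.projective_resolution_iff injective_resolution_iff)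
  have "\<exists>\<psi>. \<psi> 0 = f \<and> (\<forall>N. res_lift (op_cat A) N (choice_seq (r (tgt A f))) (choice_seq (r (src A f))) \<psi>)
    \<and> homology_map B (app F (\<psi> (Suc i))) (cyc (r (src A f))) (quo (r (src A f)))
        (cyc (r (tgt A f))) (quo (r (tgt A f))) (app L f)" if f: "f \<in> Mor A" for f
  proof -
    obtain \<phi> where \<phi>: "injective_lift (op_cat A) f (r (tgt A f)) (r (src A f)) \<phi>"
      "homology_map B (app F (\<phi> i)) (cyc (r (src A f))) (quo (r (src A f)))
        (cyc (r (tgt A f))) (quo (r (tgt A f))) (app L f)"
      using by_r f by (auto simp: left_derived_by_def left_induced_def projective_lift_iff)
    have "f \<in> Hom A (tgt A (aug (r (src A f)))) (tgt A (aug (r (tgt A f))))"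
      using HomI[OF f] r(1) A.Mor_Ob[OF f] by simp
    with \<phi> show ?thesis by (intro exI[of _ "case_nat f \<phi>"]) (simp add: injective_lift_iff)
  qed
  then obtain \<psi> where \<psi>: "\<And>f. f \<in> Mor A \<Longrightarrow> \<psi> f 0 = f"
    "\<And>f N. f \<in> Mor A \<Longrightarrow> res_lift (op_cat A) N (choice_seq (r (tgt A f))) (choice_seq (r (src A f))) (\<psi> f)"
    "\<And>f. f \<in> Mor A \<Longrightarrow> homology_map B (app F (\<psi> f (Suc i))) (cyc (r (src A f))) (quo (r (src A f)))
        (cyc (r (tgt A f))) (quo (r (tgt A f))) (app L f)"
    by metis
  have ObM: "Ob A \<subseteq> Mor A" using A.Ob_Mor by blast
  have "\<exists>G\<in>superstr S. \<forall>X\<in>Ob A. app G X = choice_seq (r X) n" for n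
    by (rule internalize[OF A(1,1) ObM]) (use O.inj_resD(1)[OF r(2)] HomD(1) Mor_op in blast)
  then obtain E where E: "\<And>n. E n \<in> superstr S" "\<And>n X. X \<in> Ob A \<Longrightarrow> app (E n) X = choice_seq (r X) n"
    by metis
  obtain Z where Z: "Z \<in> superstr S" "\<And>X. X \<in> Ob A \<Longrightarrow> app Z X = cyc (r X)"
    using internalize[OF A(1) B ObM, of "\<lambda>X. cyc (r X)"] homology_at_Mor(1)[OF r(3)] by blast
  obtain Q where Q: "Q \<in> superstr S" "\<And>X. X \<in> Ob A \<Longrightarrow> app Q X = quo (r X)"
    using internalize[OF A(1) B ObM, of "\<lambda>X. quo (r X)"] homology_at_Mor(2)[OF r(3)] by blast
  have "\<exists>G\<in>superstr S. \<forall>f\<in>Mor A. app G f = \<psi> f n" for n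
    by (rule internalize[OF A(1,1) subset_refl]) (use res_liftD(1)[OF \<psi>(2)] HomD(1) Mor_op in blast)
  then obtain H where H: "\<And>n. H n \<in> superstr S" "\<And>n f. f \<in> Mor A \<Longrightarrow> app (H n) f = \<psi> f n"
    by metis
  have "\<forall>X\<in>Ob A. tgt A (app (E 0) X) = X \<and> inj_res (op_cat A) (Suc i) (\<lambda>n. app (E n) X)
    \<and> homology_at B (\<lambda>n. app F (app (E (Suc n)) X)) i (app Z X) (app Q X)
    \<and> app L X = tgt B (app Q X)"
    using r E Z Q by simp
  also have "?this \<longleftrightarrow> (\<forall>X\<in>Ob (sc A). tgt (sc A) (app (star (E 0)) X) = X
    \<and> inj_res (op_cat (sc A)) (Suc i) (\<lambda>n. app (star (E n)) X)
    \<and> homology_at (sc B) (\<lambda>n. app (star F) (app (star (E (Suc n))) X)) i (app (star Z) X) (app (star Q) X)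
    \<and> app (star L) X = tgt (sc B) (app (star Q) X))"
    by (rule transfer, intro tr_all tr_inj_res_op[OF A] E Z Q F LS)
  finally have obs: "tgt (sc A) (app (star (E 0)) X) = X"
    "inj_res (op_cat (sc A)) (Suc i) (\<lambda>n. app (star (E n)) X)"
    "homology_at (sc B) (\<lambda>n. app (star F) (app (star (E (Suc n))) X)) i (app (star Z) X) (app (star Q) X)"
    "app (star L) X = tgt (sc B) (app (star Q) X)" if "X \<in> Ob (sc A)" for X using that by blast+
  have "\<forall>f\<in>Mor A. app (H 0) f = f
    \<and> res_lift (op_cat A) (Suc i) (\<lambda>n. app (E n) (tgt A f)) (\<lambda>n. app (E n) (src A f)) (\<lambda>n. app (H n) f)
    \<and> homology_map B (app F (app (H (Suc i)) f)) (app Z (src A f)) (app Q (src A f))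
      (app Z (tgt A f)) (app Q (tgt A f)) (app L f)"
    using \<psi> E Z Q H A.Mor_Ob by simp
  also have "?this \<longleftrightarrow> (\<forall>f\<in>Mor (sc A). app (star (H 0)) f = f
    \<and> res_lift (op_cat (sc A)) (Suc i) (\<lambda>n. app (star (E n)) (tgt (sc A) f))
        (\<lambda>n. app (star (E n)) (src (sc A) f)) (\<lambda>n. app (star (H n)) f)
    \<and> homology_map (sc B) (app (star F) (app (star (H (Suc i))) f)) (app (star Z) (src (sc A) f))
      (app (star Q) (src (sc A) f)) (app (star Z) (tgt (sc A) f)) (app (star Q) (tgt (sc A) f)) (app (star L) f))"
    by (rule transfer, intro tr_all tr_res_lift_op[OF A(1)] E Z Q H F LS)
  finally have mors: "app (star (H 0)) f = f"
    "res_lift (op_cat (sc A)) (Suc i) (\<lambda>n. app (star (E n)) (tgt (sc A) f))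
        (\<lambda>n. app (star (E n)) (src (sc A) f)) (\<lambda>n. app (star (H n)) f)"
    "homology_map (sc B) (app (star F) (app (star (H (Suc i))) f)) (app (star Z) (src (sc A) f))
      (app (star Q) (src (sc A) f)) (app (star Z) (tgt (sc A) f)) (app (star Q) (tgt (sc A) f)) (app (star L) f)"
    if "f \<in> Mor (sc A)" for f using that by blast+
  have enough': "enough_injectives (op_cat (sc A))" using enough by simp
  have "\<exists>e. (\<forall>k\<le>Suc i. e k = app (star (E k)) X) \<and> (\<forall>N. inj_res (op_cat (sc A)) N e)"
    if "X \<in> Ob (sc A)" for X
    using O'.inj_res_extend[OF enough' obs(2)[OF that]] by metis
  then obtain e where e: "\<And>X k. X \<in> Ob (sc A) \<Longrightarrow> k \<le> Suc i \<Longrightarrow> e X k = app (star (E k)) X"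
    "\<And>X N. X \<in> Ob (sc A) \<Longrightarrow> inj_res (op_cat (sc A)) N (e X)" by metis
  define r' where "r' X = \<lparr>aug = e X 0, diff = \<lambda>n. e X (Suc n), cyc = app (star Z) X,
    quo = app (star Q) X\<rparr>" for X
  have seq: "choice_seq (r' X) = e X" for X
    by (auto simp: r'_def choice_seq_def fun_eq_iff split: nat.splits)
  have "projective_resolution (sc A) X (r' X)" if "X \<in> Ob (sc A)" for X
    using e[OF that] obs(1)[OF that] seq
    by (simp add: A'.projective_resolution_iff injective_resolution_iff) (simp add: r'_def)
  moreover have "homology_at (sc B) (\<lambda>n. app (star F) (diff (r' X) n)) i (cyc (r' X)) (quo (r' X))"
    if "X \<in> Ob (sc A)" for X
    using obs(3)[OF that] e(1)[OF that] cohomology_at_cong(2)[of i "\<lambda>n. app (star F) (diff (r' X) n)"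
      "\<lambda>n. app (star F) (app (star (E (Suc n))) X)" "sc B"] by (simp add: r'_def)
  moreover have "app (star L) X = tgt (sc B) (quo (r' X))" if "X \<in> Ob (sc A)" for X
    using obs(4)[OF that] by (simp add: r'_def)
  moreover have "left_induced (sc A) (sc B) (star F) i f (r' (src (sc A) f)) (r' (tgt (sc A) f)) (app (star L) f)"
    if f: "f \<in> Mor (sc A)" for f
  proof -
    note ob = A'.Mor_Ob[OF f]
    have "res_lift (op_cat (sc A)) (Suc i) (e (tgt (sc A) f)) (e (src (sc A) f)) (\<lambda>n. app (star (H n)) f)"
      by (rule res_lift_cong[OF mors(2)[OF f]]) (use e(1) ob in auto)
    then obtain \<phi> where \<phi>: "\<And>k. k \<le> Suc i \<Longrightarrow> \<phi> k = app (star (H k)) f"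
      "\<And>M. res_lift (op_cat (sc A)) M (e (tgt (sc A) f)) (e (src (sc A) f)) \<phi>"
      using O'.res_lift_extend[OF e(2)[OF ob(2)] e(2)[OF ob(1)]] by blast
    have "projective_lift (sc A) f (r' (src (sc A) f)) (r' (tgt (sc A) f)) (\<lambda>n. \<phi> (Suc n))"
      unfolding projective_lift_iff
      by (rule injective_liftI) (use \<phi> mors(1)[OF f] seq in simp_all)
    moreover have "homology_map (sc B) (app (star F) (\<phi> (Suc i))) (cyc (r' (src (sc A) f)))
       (quo (r' (src (sc A) f))) (cyc (r' (tgt (sc A) f))) (quo (r' (tgt (sc A) f))) (app (star L) f)"
      using mors(3)[OF f] \<phi>(1)[of "Suc i"] by (simp add: r'_def)
    ultimately show ?thesis unfolding left_induced_def by blast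
  qed
  ultimately show ?thesis
    using transfer_functor[OF A(1) B LS Ln fL] unfolding left_derived_def left_derived_by_def by blast
qed

text \<open>Evaluation is a term of the formula language, so \<open>star\<close> commutes with it at
  standard morphisms. The argument applies to any functor between the two categories.\<close>

lemma star_functor_eq:
  assumes fR: "is_functor A B R"
  shows "functor_eq A (sc B) (app (star R) \<circ> star) (star \<circ> app R)"
proof -
  note RS = functor_superstr[OF A(1) B fR]
  have fm: "functor_map A B (app R)" using fR by (simp add: is_functor_def)
  have MA: "x \<in> superstr S" if "x \<in> Mor A" for x
    using that A superstr_elts by (auto simp: Mor_def internal_cat_def)
  have MB: "x \<in> superstr S" if "x \<in> Mor B" for x
    using that B superstr_elts by (auto simp: Mor_def internal_cat_def)
  have RM: "app R f \<in> Mor B" "app R (src A f) = src B (app R f)" "app R (tgt A f) = tgt B (app R f)"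
    if "f \<in> Mor A" for f using that fm by (simp_all add: functor_map_def)
  have eq: "app (star R) (star f) = star (app R f)" if "f \<in> Mor A" for f
    by (rule star_eqI[symmetric, OF tr_app[OF tr_const[OF RS] tr_const]]) (use that RM MA MB in auto)
  have st: "star (app R f) \<in> Mor (sc B)" "star (src B (app R f)) = src (sc B) (star (app R f))"
    "star (tgt B (app R f)) = tgt (sc B) (star (app R f))" if f: "f \<in> Mor A" for f
  proof -
    note Rf = MB[OF RM(1)[OF f]]
    show "star (app R f) \<in> Mor (sc B)"
      using transfer[OF tr_Mor[OF B tr_const[OF Rf]]] RM(1)[OF f] by simp
    show "star (src B (app R f)) = src (sc B) (star (app R f))"
      by (rule star_eqI[OF tr_src[OF B tr_const[OF Rf]]])
        (use RM[OF f] RM(1)[of "src A f"] MB A.ax_src_tgt f in metis)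
    show "star (tgt B (app R f)) = tgt (sc B) (star (app R f))"
      by (rule star_eqI[OF tr_tgt[OF B tr_const[OF Rf]]])
        (use RM[OF f] RM(1)[of "tgt A f"] MB A.ax_src_tgt f in metis)
  qed
  have ct: "star (cmp B (app R f) (app R g)) = cmp (sc B) (star (app R f)) (star (app R g))"
    "app R (cmp A f g) = cmp B (app R f) (app R g)" "cmp A f g \<in> Mor A"
    if f: "f \<in> Mor A" "g \<in> Mor A" "src A f = tgt A g" for f g
  proof -
    show c: "cmp A f g \<in> Mor A" using A.ax_cmp f by blast
    show e: "app R (cmp A f g) = cmp B (app R f) (app R g)" using fm f by (simp add: functor_map_def)
    show "star (cmp B (app R f) (app R g)) = cmp (sc B) (star (app R f)) (star (app R g))"
      by (rule star_eqI[OF tr_cmp[OF B tr_const tr_const]]) (use MB RM f e c in metis)+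
  qed
  have 1: "functor_map A (sc B) (star \<circ> app R)"
    unfolding functor_map_def using st ct RM by simp
  have "functor_map A (sc B) (app (star R) \<circ> star)"
    unfolding functor_map_def using st ct RM eq A.ax_src_tgt by simp
  with 1 show ?thesis unfolding functor_eq_def using eq by simp
qed

end

end

theorem corollary5p10:
  fixes S F :: "'u::set_universe"
    and star :: "'u \<Rightarrow> 'u"
    and A B :: "'u add_cat"
  assumes "enlargement S star"
    and "abelian_small_category S A"
    and "abelian_small_category S B"
    and "additive_functor A B F"
  shows
    "(enough_injectives A \<and> left_exact A B F \<longrightarrow>
       (\<forall>i. (\<exists>R. right_derived A B F i R)
          \<and> (\<exists>R'. right_derived (star_cat star A) (star_cat star B) (star F) i R')
          \<and> (\<forall>R. right_derived A B F i R \<longrightarrow>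
               functor_eq A (star_cat star B) (app (star R) \<circ> star) (star \<circ> app R)
             \<and> (\<forall>R'. right_derived (star_cat star A) (star_cat star B) (star F) i R' \<longrightarrow>
                  right_derived_eq (star_cat star A) (star_cat star B) (star F) i (star R) R'))))
   \<and> (enough_projectives A \<and> right_exact A B F \<longrightarrow>
       (\<forall>i. (\<exists>L. left_derived A B F i L)
          \<and> (\<exists>L'. left_derived (star_cat star A) (star_cat star B) (star F) i L')
          \<and> (\<forall>L. left_derived A B F i L \<longrightarrow>
               functor_eq A (star_cat star B) (app (star L) \<circ> star) (star \<circ> app L)
             \<and> (\<forall>L'. left_derived (star_cat star A) (star_cat star B) (star F) i L' \<longrightarrow>
                  left_derived_eq (star_cat star A) (star_cat star B) (star F) i (star L) L'))))"
proof -
  interpret enlarged S star by unfold_locales fact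
  note A = internal_cat_abelian[OF assms(2)] abelian_catI[OF assms(2)]
    and B = internal_cat_abelian[OF assms(3)] abelian_catI[OF assms(3)]
  have FF: "is_functor A B F" and Fadd: "\<forall>f\<in>Mor A. \<forall>g\<in>Mor A. src A f = src A g \<and> tgt A f = tgt A g \<longrightarrow>
      app F (add A f g) = add B (app F f) (app F g)"
    using assms(4) by (simp_all add: additive_functor_def)
  note F = functor_superstr[OF A(1) B(1) FF]
  interpret std: additive_functor_setup A B F
    using A B FF Fadd unfolding additive_functor_setup_def additive_functor_setup_axioms_def is_functor_def
    by blast
  \<comment> \<open>The enlarged data satisfy the same hypotheses, so existence and uniqueness of
    derived functors are proved there directly.\<close>
  interpret ext: additive_functor_setup "sc A" "sc B" "star F"
    using transfer_abelian[OF A(1)] transfer_abelian[OF B(1)] A B Fadd transfer_additive[OF A(1) B(1) F]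
      transfer_functor[OF A(1) B(1) F functor_nonempty[OF A(2) FF] FF]
    unfolding additive_functor_setup_def additive_functor_setup_axioms_def is_functor_def by blast
  show ?thesis
  proof (intro conjI impI allI)
    fix i assume *: "enough_injectives A \<and> left_exact A B F"
    then have ei: "enough_injectives A" "enough_injectives (sc A)"
      using transfer_enough(1)[OF A(1)] by simp_all
    show "\<exists>R. right_derived A B F i R" by (rule std.right_derived_exists[OF ei(1)])
    show "\<exists>R'. right_derived (sc A) (sc B) (star F) i R'" by (rule ext.right_derived_exists[OF ei(2)])
    fix R assume R: "right_derived A B F i R"
    then show "functor_eq A (sc B) (app (star R) \<circ> star) (star \<circ> app R)"
      by (intro star_functor_eq[OF A B(1) F]) (auto simp: right_derived_def right_derived_by_def)
    fix R' assume "right_derived (sc A) (sc B) (star F) i R'"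
    \<comment> \<open>Transfer makes \<open>star R\<close> one derived functor of
      \<open>star F\<close>; the comparison with \<open>R'\<close> is uniqueness in the enlarged
      category.\<close>
    with star_right_derived[OF A B(1) F R ei(2)]
    show "right_derived_eq (sc A) (sc B) (star F) i (star R) R'" by (rule ext.right_derived_unique[OF ei(2)])
  next
    fix i assume *: "enough_projectives A \<and> right_exact A B F"
    then have ep: "enough_projectives A" "enough_projectives (sc A)"
      using transfer_enough(2)[OF A(1)] by simp_all
    show "\<exists>L. left_derived A B F i L" by (rule std.left_derived_exists[OF ep(1)])
    show "\<exists>L'. left_derived (sc A) (sc B) (star F) i L'" by (rule ext.left_derived_exists[OF ep(2)])
    fix L assume L: "left_derived A B F i L"
    then show "functor_eq A (sc B) (app (star L) \<circ> star) (star \<circ> app L)"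
      by (intro star_functor_eq[OF A B(1) F]) (auto simp: left_derived_def left_derived_by_def)
    fix L' assume "left_derived (sc A) (sc B) (star F) i L'"
    with star_left_derived[OF A B(1) F L ep(2)]
    show "left_derived_eq (sc A) (sc B) (star F) i (star L) L'" by (rule ext.left_derived_unique[OF ep(2)])
  qed
qed

end
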